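(* Let $d\ge 1$, let $L:D(L)\subset L^2(\mathbb{H}^d)\to L^2(\mathbb{H}^d)$ be the (self-adjoint) horizontal Laplacian, and let $U(\tau)=e^{i\tau\frac{L}{2}}$, $\tau\in\mathbb{R}$, be the strongly continuous one-parameter unitary group associated with the self-adjoint operator $L/2$. Let $S:[0,\infty)\to\mathfrak{B}(L^2(\mathbb{H}^d))$ be the map such that, for each $\tau\geq 0$, $S(\tau)$ is the bounded extension to $L^2(\mathbb{H}^d)$ of the operator defined for $\psi\in\mathcal{S}(\mathbb{H}^d)$ by the oscillatory integral $$[S(\tau)\psi](z,s)=\frac{1}{(2\pi i)^d}\int^o_{\mathbb{R}^{2d}}e^{i|\zeta|^2/2}\,\psi\big(z+\sqrt{\tau}\,\zeta,\;s+\sqrt{\tau}\,z\cdot_\sigma\zeta\big)\,\mathrm{d}^{2d}\zeta .$$ Then $S$ is Chernoff equivalent to $(e^{i\tau\frac{L}{2}})_{\tau\ge 0}$, i.e. $$\lim_{n\to\infty}\sup_{\tau\in[0,T]}\big\|S(\tau/n)^n\psi-e^{i\tau\frac{L}{2}}\psi\big\|_{L^2(\mathbb{H}^d)}=0\qquad\text{for every }\psi\in L^2(\mathbb{H}^d)\text{ and every }T>0.$$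
   Context: The Heisenberg group is $\mathbb{H}^d=\mathbb{R}^{2d}\times\mathbb{R}$ with points $(z,s)=(x,y,s)$, $x,y\in\mathbb{R}^d$, $s\in\mathbb{R}$, and group law $(x,y,s)\cdot(x',y',s')=(x+x',y+y',s+s'+x'y-xy')$. For $z=(x,y)$ and $z'=(x',y')$ in $\mathbb{R}^{2d}$, $z\cdot_\sigma z':=x'y-xy'$ (Euclidean scalar products in $\mathbb{R}^d$). $L^2(\mathbb{H}^d)=L^2(\mathbb{R}^{2d+1})$ with Lebesgue measure, $\mathcal{S}(\mathbb{H}^d)=\mathcal{S}(\mathbb{R}^{2d+1})$ is the Schwartz space, and $\mathfrak{B}(L^2(\mathbb{H}^d))$ is the space of bounded linear operators on $L^2(\mathbb{H}^d)$. Let $X_i=\partial_{x^i}+y^i\partial_s$, $Y_i=\partial_{y^i}-x^i\partial_s$, $i=1,\dots,d$, and $L_0=\sum_{i=1}^d(X_i^2+Y_i^2)$ on $C_c^\infty(\mathbb{H}^d)$. $L_0$ is essentially self-adjoint in $L^2(\mathbb{H}^d)$, and $L=\overline{L_0}$ is its self-adjoint closure. The oscillatory integral $\int^o_{\mathbb{R}^{2d}}e^{i|\zeta|^2/2}f(\zeta)\,\mathrm{d}^{2d}\zeta$ is defined as $\lim_{\epsilon\downarrow 0}\int_{\mathbb{R}^{2d}}\phi(\epsilon\zeta)e^{i|\zeta|^2/2}f(\zeta)\,\mathrm{d}^{2d}\zeta$ for $\phi\in\mathcal{S}(\mathbb{R}^{2d})$ with $\phi(0)=1$, where the limit is required to exist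 and to be independent of the choice of such $\phi$. For every $\tau\ge0$ the operator $S(\tau)$ defined on $\mathcal{S}(\mathbb{H}^d)$ by the formula in the claim is well defined and extends to a bounded operator on $L^2(\mathbb{H}^d)$. $S(\tau/n)^n$ is the composition of $n$ copies of $S(\tau/n)$. *)

theory Defs
  imports "HOL-Analysis.Analysis"
begin

section \<open>The Hilbert space of square-integrable functions\<close>

text \<open>
  Elements are almost-everywhere classes of Borel measurable functions. Every Lebesgue measurable
  function agrees almost everywhere with a Borel measurable one, so this is the usual space.
\<close>

definition square_integrable :: "('a::euclidean_space \<Rightarrow> complex) \<Rightarrow> bool" where
  "square_integrable f \<longleftrightarrow>
     f \<in> borel_measurable lborel \<and> integrable lborel (\<lambda>x. (norm (f x))\<^sup>2)"

definition l2_rel :: "('a::euclidean_space \<Rightarrow> complex) \<Rightarrow> ('a \<Rightarrow> complex) \<Rightarrow> bool" where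
  "l2_rel f g \<longleftrightarrow>
     square_integrable f \<and> square_integrable g \<and> (AE x in lborel. f x = g x)"

lemma square_integrable_zero: "square_integrable (\<lambda>_. 0)"
  by (simp add: square_integrable_def)

lemma square_integrable_scale:
  assumes "square_integrable f"
  shows "square_integrable (\<lambda>x. c * f x)"
  using assms by (auto simp: square_integrable_def norm_mult power_mult_distrib)

lemma square_integrable_scaleR:
  assumes "square_integrable f"
  shows "square_integrable (\<lambda>x. r *\<^sub>R f x)"
  using square_integrable_scale[OF assms, of "complex_of_real r"]
  by (simp add: scaleR_conv_of_real)

lemma square_integrable_uminus:
  assumes "square_integrable f"
  shows "square_integrable (\<lambda>x. - f x)"
  using square_integrable_scale[OF assms, of "- 1"] by simp

lemma square_integrable_add:
  assumes "square_integrable f" "square_integrable g"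
  shows "square_integrable (\<lambda>x. f x + g x)"
proof -
  have m: "f \<in> borel_measurable lborel" "g \<in> borel_measurable lborel"
    using assms by (auto simp: square_integrable_def)
  have i: "integrable lborel (\<lambda>x. 2 * (norm (f x))\<^sup>2 + 2 * (norm (g x))\<^sup>2)"
    using assms by (intro Bochner_Integration.integrable_add integrable_mult_right)
      (auto simp: square_integrable_def)
  have "(norm (f x + g x))\<^sup>2 \<le> 2 * (norm (f x))\<^sup>2 + 2 * (norm (g x))\<^sup>2" for x
  proof -
    have "(norm (f x + g x))\<^sup>2 \<le> (norm (f x) + norm (g x))\<^sup>2"
      by (intro power_mono norm_triangle_ineq) auto
    also have "\<dots> \<le> 2 * (norm (f x))\<^sup>2 + 2 * (norm (g x))\<^sup>2"
      using zero_le_power2[of "norm (f x) - norm (g x)"] by (simp add: power2_eq_square algebra_simps)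
    finally show ?thesis .
  qed
  then have "integrable lborel (\<lambda>x. (norm (f x + g x))\<^sup>2)"
    using m by (intro Bochner_Integration.integrable_bound[OF i]) auto
  with m show ?thesis by (simp add: square_integrable_def)
qed

lemma square_integrable_diff:
  assumes "square_integrable f" "square_integrable g"
  shows "square_integrable (\<lambda>x. f x - g x)"
  using square_integrable_add[OF assms(1) square_integrable_uminus[OF assms(2)]] by simp

lemma integrable_inner_square_integrable:
  assumes "square_integrable f" "square_integrable g"
  shows "integrable lborel (\<lambda>x. f x \<bullet> g x)"
proof -
  have m: "f \<in> borel_measurable lborel" "g \<in> borel_measurable lborel"
    using assms by (auto simp: square_integrable_def)
  have i: "integrable lborel (\<lambda>x. (norm (f x))\<^sup>2 + (norm (g x))\<^sup>2)"
    using assms by (intro Bochner_Integration.integrable_add) (auto simp: square_integrable_def)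
  have "\<bar>f x \<bullet> g x\<bar> \<le> (norm (f x))\<^sup>2 + (norm (g x))\<^sup>2" for x
  proof -
    have "\<bar>f x \<bullet> g x\<bar> \<le> norm (f x) * norm (g x)" by (rule Cauchy_Schwarz_ineq2)
    also have "2 * (norm (f x) * norm (g x)) \<le> (norm (f x))\<^sup>2 + (norm (g x))\<^sup>2"
      using sum_squares_bound[of "norm (f x)" "norm (g x)"] by (simp add: mult.assoc)
    then have "norm (f x) * norm (g x) \<le> (norm (f x))\<^sup>2 + (norm (g x))\<^sup>2"
      using mult_nonneg_nonneg[OF norm_ge_zero[of "f x"] norm_ge_zero[of "g x"]] by linarith
    finally show ?thesis .
  qed
  then show ?thesis
    using m by (intro Bochner_Integration.integrable_bound[OF i]) auto
qed

lemma part_equivp_l2_rel: "part_equivp l2_rel"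
proof (rule part_equivpI)
  show "\<exists>f. l2_rel f f"
    using square_integrable_zero by (auto simp: l2_rel_def)
  show "symp l2_rel"
    by (rule sympI) (auto simp: l2_rel_def elim: AE_mp)
  show "transp l2_rel"
    by (rule transpI) (auto simp: l2_rel_def)
qed

quotient_type (overloaded) 'a L2 = "'a::euclidean_space \<Rightarrow> complex" / partial: l2_rel
  by (rule part_equivp_l2_rel)

instantiation L2 :: (euclidean_space) real_inner
begin

lift_definition zero_L2 :: "'a L2" is "\<lambda>_. 0"
  by (simp add: l2_rel_def square_integrable_zero)

lift_definition plus_L2 :: "'a L2 \<Rightarrow> 'a L2 \<Rightarrow> 'a L2" is "\<lambda>f g x. f x + g x"
  by (auto simp: l2_rel_def square_integrable_add)

lift_definition minus_L2 :: "'a L2 \<Rightarrow> 'a L2 \<Rightarrow> 'a L2" is "\<lambda>f g x. f x - g x"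
  by (auto simp: l2_rel_def square_integrable_diff)

lift_definition uminus_L2 :: "'a L2 \<Rightarrow> 'a L2" is "\<lambda>f x. - f x"
  by (auto simp: l2_rel_def square_integrable_uminus)

lift_definition scaleR_L2 :: "real \<Rightarrow> 'a L2 \<Rightarrow> 'a L2" is "\<lambda>r f x. r *\<^sub>R f x"
  by (auto simp: l2_rel_def square_integrable_scaleR)

text \<open>On \<open>complex\<close>, \<open>a \<bullet> b\<close> is the real part of the Hermitian product of \<open>a\<close> and \<open>b\<close>.\<close>

lift_definition inner_L2 :: "'a L2 \<Rightarrow> 'a L2 \<Rightarrow> real" is "\<lambda>f g. LINT x|lborel. f x \<bullet> g x"
  by (rule integral_cong_AE)
    (auto simp: l2_rel_def square_integrable_def intro!: borel_measurable_inner)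

lift_definition norm_L2 :: "'a L2 \<Rightarrow> real" is "\<lambda>f. sqrt (LINT x|lborel. (norm (f x))\<^sup>2)"
  by (rule arg_cong[where f = sqrt], rule integral_cong_AE)
    (auto simp: l2_rel_def square_integrable_def)

definition sgn_L2 :: "'a L2 \<Rightarrow> 'a L2" where
  "sgn_L2 \<psi> = inverse (norm \<psi>) *\<^sub>R \<psi>"

definition dist_L2 :: "'a L2 \<Rightarrow> 'a L2 \<Rightarrow> real" where
  "dist_L2 \<psi> \<eta> = norm (\<psi> - \<eta>)"

definition uniformity_L2 :: "('a L2 \<times> 'a L2) filter" where
  "uniformity_L2 = (INF e\<in>{0<..}. principal {(\<psi>, \<eta>). dist \<psi> \<eta> < e})"

definition open_L2 :: "'a L2 set \<Rightarrow> bool" where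
  "open_L2 A \<longleftrightarrow> (\<forall>\<psi>\<in>A. eventually (\<lambda>(\<psi>', \<eta>). \<psi>' = \<psi> \<longrightarrow> \<eta> \<in> A) uniformity)"

instance
proof
  fix a b c :: "'a L2" and r q :: real
  show "a + b + c = a + (b + c)"
    by transfer (auto simp: l2_rel_def add.assoc square_integrable_add)
  show "a + b = b + a"
    by transfer (auto simp: l2_rel_def add.commute square_integrable_add)
  show "0 + a = a"
    by transfer (auto simp: l2_rel_def)
  show "- a + a = 0"
    by transfer (auto simp: l2_rel_def square_integrable_zero)
  show "a - b = a + - b"
    by transfer (auto simp: l2_rel_def square_integrable_diff)
  show "r *\<^sub>R (a + b) = r *\<^sub>R a + r *\<^sub>R b"
    by transfer (auto simp: l2_rel_def scaleR_add_right square_integrable_add square_integrable_scaleR)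
  show "(r + q) *\<^sub>R a = r *\<^sub>R a + q *\<^sub>R a"
    by transfer (auto simp: l2_rel_def scaleR_add_left square_integrable_add square_integrable_scaleR)
  show "r *\<^sub>R q *\<^sub>R a = (r * q) *\<^sub>R a"
  proof transfer
    fix r q :: real and a :: "'a \<Rightarrow> complex"
    assume "l2_rel a a"
    then have "square_integrable (\<lambda>x. (r * q) *\<^sub>R a x)"
      by (intro square_integrable_scaleR) (simp add: l2_rel_def)
    then show "l2_rel (\<lambda>x. r *\<^sub>R q *\<^sub>R a x) (\<lambda>x. (r * q) *\<^sub>R a x)"
      by (simp add: l2_rel_def)
  qed
  show "1 *\<^sub>R a = a"
    by transfer (auto simp: l2_rel_def)
  show "sgn a = inverse (norm a) *\<^sub>R a"
    by (fact sgn_L2_def)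
  show "dist a b = norm (a - b)"
    by (fact dist_L2_def)
  show "uniformity = (INF e\<in>{0<..}. principal {(x :: 'a L2, y). dist x y < e})"
    by (fact uniformity_L2_def)
  show "open A \<longleftrightarrow> (\<forall>x\<in>A. eventually (\<lambda>(x', y). x' = x \<longrightarrow> y \<in> A) uniformity)"
    for A :: "'a L2 set"
    by (fact open_L2_def)
  show "inner a b = inner b a"
    by transfer (simp add: inner_commute)
  show "inner (a + b) c = inner a c + inner b c"
    by transfer (auto simp: l2_rel_def inner_add_left
        intro!: Bochner_Integration.integral_add integrable_inner_square_integrable)
  show "inner (r *\<^sub>R a) b = r * inner a b"
    by transfer simp
  show "0 \<le> inner a a"
    by transfer simp
  show "inner a a = 0 \<longleftrightarrow> a = 0"
  proof transfer
    fix a :: "'a \<Rightarrow> complex"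
    assume "l2_rel a a"
    then have sq: "square_integrable a" by (simp add: l2_rel_def)
    have "(LINT x|lborel. a x \<bullet> a x) = 0 \<longleftrightarrow> (AE x in lborel. a x \<bullet> a x = 0)"
      by (intro integral_nonneg_eq_0_iff_AE integrable_inner_square_integrable sq) auto
    then show "(LINT x|lborel. a x \<bullet> a x) = 0 \<longleftrightarrow> l2_rel a (\<lambda>_. 0)"
      using sq by (simp add: l2_rel_def square_integrable_zero)
  qed
  show "norm a = sqrt (inner a a)"
    by transfer (simp add: power2_norm_eq_inner)
qed

end

lift_definition scaleC :: "complex \<Rightarrow> 'a::euclidean_space L2 \<Rightarrow> 'a L2" (infixr \<open>*\<^sub>C\<close> 75)
  is "\<lambda>c f x. c * f x"
  by (auto simp: l2_rel_def square_integrable_scale)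


section \<open>Operators and unitary groups\<close>

definition bounded_operator :: "('a::euclidean_space L2 \<Rightarrow> 'a L2) \<Rightarrow> bool" where
  "bounded_operator B \<longleftrightarrow> bounded_linear B \<and> (\<forall>c \<psi>. B (c *\<^sub>C \<psi>) = c *\<^sub>C B \<psi>)"

definition unitary_operator :: "('a::euclidean_space L2 \<Rightarrow> 'a L2) \<Rightarrow> bool" where
  "unitary_operator B \<longleftrightarrow> bounded_operator B \<and> surj B \<and> (\<forall>\<psi>. norm (B \<psi>) = norm \<psi>)"

definition strongly_continuous_unitary_group :: "(real \<Rightarrow> 'a::euclidean_space L2 \<Rightarrow> 'a L2) \<Rightarrow> bool"
  where
  "strongly_continuous_unitary_group U \<longleftrightarrow>
     (\<forall>t. unitary_operator (U t)) \<and>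
     U 0 = id \<and> (\<forall>t u. U (t + u) = U t \<circ> U u) \<and>
     (\<forall>\<psi>. continuous_on UNIV (\<lambda>t. U t \<psi>))"

text \<open>
  Unbounded operators are represented by their graphs. The predicate below expresses
  \<open>U t = exp (\<i> t A)\<close> through Stone's correspondence: the domain of \<open>A\<close> is the set of vectors on
  which \<open>t \<mapsto> U t \<psi>\<close> is differentiable at \<open>0\<close>, and \<open>A \<psi>\<close> is \<open>- \<i>\<close> times that derivative.
\<close>

definition unitary_group_of ::
  "('a::euclidean_space L2 \<times> 'a L2) set \<Rightarrow> (real \<Rightarrow> 'a L2 \<Rightarrow> 'a L2) \<Rightarrow> bool" where
  "unitary_group_of A U \<longleftrightarrow>
     strongly_continuous_unitary_group U \<and>
     A = {(\<psi>, \<eta>). ((\<lambda>t. (1 / (\<i> * complex_of_real t)) *\<^sub>C (U t \<psi> - \<psi>)) \<longlongrightarrow> \<eta>) (at 0)}"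

definition scale_operator ::
  "complex \<Rightarrow> ('a::euclidean_space L2 \<times> 'a L2) set \<Rightarrow> ('a L2 \<times> 'a L2) set" where
  "scale_operator c A = {(\<psi>, c *\<^sub>C \<eta>) | \<psi> \<eta>. (\<psi>, \<eta>) \<in> A}"

text \<open>
  The supremum is taken in \<open>[0, \<infinity>]\<close>, because \<open>Sup\<close> on \<open>real\<close> is meaningful only for sets that are
  bounded above.
\<close>

definition chernoff_equivalent ::
  "(real \<Rightarrow> 'a::euclidean_space L2 \<Rightarrow> 'a L2) \<Rightarrow> (real \<Rightarrow> 'a L2 \<Rightarrow> 'a L2) \<Rightarrow> bool" where
  "chernoff_equivalent S U \<longleftrightarrow>
     (\<forall>\<psi>. \<forall>T>0.
        (\<lambda>n. SUP \<tau>\<in>{0..T}. ennreal (norm ((S (\<tau> / real n) ^^ n) \<psi> - U \<tau> \<psi>))) \<longlonglongrightarrow> 0)"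


section \<open>Smooth and Schwartz functions, oscillatory integrals\<close>

definition pderiv_dir :: "'a \<Rightarrow> ('a::euclidean_space \<Rightarrow> complex) \<Rightarrow> 'a \<Rightarrow> complex" where
  "pderiv_dir v f = (\<lambda>p. frechet_derivative f (at p) v)"

definition iterated_pderiv :: "'a list \<Rightarrow> ('a::euclidean_space \<Rightarrow> complex) \<Rightarrow> 'a \<Rightarrow> complex" where
  "iterated_pderiv vs f = foldr pderiv_dir vs f"

definition smooth :: "('a::euclidean_space \<Rightarrow> complex) \<Rightarrow> bool" where
  "smooth f \<longleftrightarrow> (\<forall>vs. set vs \<subseteq> Basis \<longrightarrow> (\<forall>p. iterated_pderiv vs f differentiable (at p)))"

definition smooth_compact_support :: "('a::euclidean_space \<Rightarrow> complex) \<Rightarrow> bool" where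
  "smooth_compact_support f \<longleftrightarrow> smooth f \<and> compact (closure {p. f p \<noteq> 0})"

definition schwartz :: "('a::euclidean_space \<Rightarrow> complex) \<Rightarrow> bool" where
  "schwartz f \<longleftrightarrow> smooth f \<and>
     (\<forall>k vs. set vs \<subseteq> Basis \<longrightarrow> bounded (range (\<lambda>p. norm p ^ k *\<^sub>R iterated_pderiv vs f p)))"

definition has_osc_integral :: "('a::euclidean_space \<Rightarrow> complex) \<Rightarrow> complex \<Rightarrow> bool"
    (infix \<open>has'_osc'_integral\<close> 50) where
  "(f has_osc_integral J) \<longleftrightarrow>
     (\<forall>\<phi>. schwartz \<phi> \<and> \<phi> 0 = 1 \<longrightarrow>
        (\<forall>\<epsilon>>0. integrable lborel
           (\<lambda>\<zeta>. \<phi> (\<epsilon> *\<^sub>R \<zeta>) * exp (\<i> * complex_of_real ((norm \<zeta>)\<^sup>2 / 2)) * f \<zeta>)) \<and>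
        ((\<lambda>\<epsilon>. LINT \<zeta>|lborel.
           \<phi> (\<epsilon> *\<^sub>R \<zeta>) * exp (\<i> * complex_of_real ((norm \<zeta>)\<^sup>2 / 2)) * f \<zeta>) \<longlongrightarrow> J) (at_right 0))"


section \<open>The Heisenberg group and its horizontal Laplacian\<close>

text \<open>Points are written \<open>(z, s)\<close> with \<open>z = (x, y)\<close>; the dimension \<open>d\<close> is \<open>CARD('d)\<close>.\<close>

type_synonym 'd phase = "(real ^ 'd) \<times> (real ^ 'd)"
type_synonym 'd heis = "'d phase \<times> real"

definition symp_prod :: "'d::finite phase \<Rightarrow> 'd phase \<Rightarrow> real" (infixl \<open>\<bullet>\<^sub>\<sigma>\<close> 70) where
  "z \<bullet>\<^sub>\<sigma> z' = fst z' \<bullet> snd z - fst z \<bullet> snd z'"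

definition X_field :: "'d::finite \<Rightarrow> ('d heis \<Rightarrow> complex) \<Rightarrow> 'd heis \<Rightarrow> complex" where
  "X_field i f = (\<lambda>((x, y), s).
     pderiv_dir ((axis i 1, 0), 0) f ((x, y), s) + y $ i *\<^sub>R pderiv_dir ((0, 0), 1) f ((x, y), s))"

definition Y_field :: "'d::finite \<Rightarrow> ('d heis \<Rightarrow> complex) \<Rightarrow> 'd heis \<Rightarrow> complex" where
  "Y_field i f = (\<lambda>((x, y), s).
     pderiv_dir ((0, axis i 1), 0) f ((x, y), s) - x $ i *\<^sub>R pderiv_dir ((0, 0), 1) f ((x, y), s))"

definition sublaplacian :: "('d::finite heis \<Rightarrow> complex) \<Rightarrow> 'd heis \<Rightarrow> complex" where
  "sublaplacian f = (\<lambda>p. \<Sum>i\<in>UNIV. X_field i (X_field i f) p + Y_field i (Y_field i f) p)"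

definition L0_graph :: "('d::finite heis L2 \<times> 'd heis L2) set" where
  "L0_graph = {(abs_L2 f, abs_L2 (sublaplacian f)) | f. smooth_compact_support f}"

definition horizontal_laplacian :: "('d::finite heis L2 \<times> 'd heis L2) set" where
  "horizontal_laplacian = closure L0_graph"

definition extends_osc_operator :: "real \<Rightarrow> ('d::finite heis L2 \<Rightarrow> 'd heis L2) \<Rightarrow> bool" where
  "extends_osc_operator \<tau> B \<longleftrightarrow>
     (\<forall>\<psi>. schwartz \<psi> \<longrightarrow>
        (AE (z, s) in lborel. \<exists>J.
           (\<lambda>\<zeta>. \<psi> (z + sqrt \<tau> *\<^sub>R \<zeta>, s + sqrt \<tau> * (z \<bullet>\<^sub>\<sigma> \<zeta>))) has_osc_integral J \<and>
           rep_L2 (B (abs_L2 \<psi>)) (z, s) = 1 / (2 * pi * \<i>) ^ CARD('d) * J))"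

end

theory Submission
  imports Defs "HOL-Probability.Distributions"
begin

text \<open>
  The proof is the Lax principle: \<open>S\<close> consists of contractions and is consistent with the generator of
  \<open>U\<close> on a core, hence its powers converge to \<open>U\<close>.

  Convergence (\<open>chernoff_product_formula\<close>) is a statement about a Banach space. Telescoping
  \<open>S(h)\<^sup>n - U(n h)\<close> produces local errors at the points \<open>U(k h) p\<close>, and these leave the core, where
  consistency says nothing. Multiplication by the resolvent of \<open>(S(h) - 1) / h\<close> repairs this: the
  resolvent maps a difference quotient to a bounded expression, and the resolvents converge strongly as
  soon as the quotients converge on a core. Only vectors in the domain of the square of the generator
  are needed, and these are dense because time averages of orbits lie in the domain. The averages are
  integrals with values in \<open>L\<^sup>2\<close>, which is why \<open>L\<^sup>2\<close> has to be complete. By construction the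
  horizontal Laplacian is the closure of its restriction to \<open>C\<^sub>c\<^sup>\<infinity>\<close>, so \<open>C\<^sub>c\<^sup>\<infinity>\<close> provides the core; it is
  dense in \<open>L\<^sup>2\<close> because the domain of the generator is.

  For \<open>\<eta> \<in> C\<^sub>c\<^sup>\<infinity>\<close> and \<open>r = sqrt \<tau> > 0\<close> the oscillatory integral is an absolutely convergent one,
  \<open>S(r\<^sup>2) \<eta> (z, s) = (2 \<pi> i)\<^bsup>-d\<^esup> \<integral> exp (i |\<zeta>|\<^sup>2 / 2) \<eta> (z + r \<zeta>, s + r z \<bullet>\<^sub>\<sigma> \<zeta>) d\<zeta>\<close>.

  Contractivity (\<open>energy_osc_le\<close>) comes from expanding the square of this integral against the weight
  \<open>exp (- \<delta> |z|\<^sup>2 / 2)\<close>. For two integration points with difference \<open>u\<close>, the integrand depends on \<open>z\<close>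
  through the character \<open>exp (- i z \<bullet> u / r\<^sup>2)\<close> and through a translation in \<open>s\<close> by \<open>z \<bullet>\<^sub>\<sigma> u\<close>. The
  latter depends only on the component of \<open>z\<close> along a vector orthogonal to \<open>u\<close>, so it is
  independent of the former under the Gaussian weight, and averaging over translations does not increase
  the norm in \<open>s\<close>. What remains is a Gaussian kernel in \<open>u\<close>, to which the Schur test applies; its
  total mass gives the constant \<open>1\<close> for every \<open>\<delta>\<close>.

  Consistency (\<open>energy_O_second\<close>) comes from differentiating in \<open>r\<close> and integrating by parts in \<open>\<zeta>\<close>,
  which gives \<open>d/dr S(r\<^sup>2) \<eta> = i r S(r\<^sup>2) L \<eta>\<close> up to terms \<open>r\<^sup>2 \<integral> exp (i |\<zeta>|\<^sup>2 / 2) (\<zeta> \<bullet> e) \<dots>\<close>. The weight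
  \<open>\<zeta> \<bullet> e\<close> is unbounded, but two further integrations by parts reproduce the same weighted integral,
  multiplied by \<open>r\<^sup>4 \<partial>\<^sub>s\<^sup>2\<close>. Since \<open>1 - r\<^sup>4 \<partial>\<^sub>s\<^sup>2 \<ge> 1\<close>, the weighted integral is \<open>O(r)\<close> in
  \<open>L\<^sup>2\<close> by contractivity, and therefore \<open>S(\<tau>) \<eta> = \<eta> + (i \<tau> / 2) L \<eta> + O(\<tau>\<^sup>2)\<close>.
\<close>

section \<open>The Chernoff product formula in a Banach space\<close>

lemma norm_add3_le: "norm (a + b + c) \<le> norm a + norm b + norm (c :: 'a::real_normed_vector)"
  using norm_triangle_ineq[of "a + b" c] norm_triangle_ineq[of a b] by linarith

lemma norm_add4_le: "norm (a + b + c + d) \<le> norm a + norm b + norm c + norm (d :: 'a::real_normed_vector)"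
  using norm_triangle_ineq[of "a + b + c" d] norm_add3_le[of a b c] by linarith

text \<open>
  Contractions are equicontinuous, so convergence on a finite net of a compact curve controls the
  whole curve.
\<close>

lemma tendsto_uniformly_on_compact_orbit:
  fixes B :: "'i \<Rightarrow> 'h::real_normed_vector \<Rightarrow> 'h" and f g :: "'t::metric_space \<Rightarrow> 'h"
  assumes B: "\<forall>\<^sub>F h in F. bounded_linear (B h) \<and> (\<forall>v. norm (B h v) \<le> norm v)"
    and K: "compact K" and f: "continuous_on K f" and g: "continuous_on K g"
    and lim: "\<And>t. t \<in> K \<Longrightarrow> ((\<lambda>h. B h (f t)) \<longlongrightarrow> g t) F" and e: "e > 0"
  shows "\<forall>\<^sub>F h in F. \<forall>t\<in>K. norm (B h (f t) - g t) < e"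
proof -
  obtain d1 where d1: "d1 > 0" "\<And>x y. x \<in> K \<Longrightarrow> y \<in> K \<Longrightarrow> dist y x < d1 \<Longrightarrow> dist (f y) (f x) < e/3"
    using compact_uniformly_continuous[OF f K] e
    unfolding uniformly_continuous_on_def by (metis divide_pos_pos zero_less_numeral)
  obtain d2 where d2: "d2 > 0" "\<And>x y. x \<in> K \<Longrightarrow> y \<in> K \<Longrightarrow> dist y x < d2 \<Longrightarrow> dist (g y) (g x) < e/3"
    using compact_uniformly_continuous[OF g K] e
    unfolding uniformly_continuous_on_def by (metis divide_pos_pos zero_less_numeral)
  define d where "d = min d1 d2"
  have "d > 0" using d1 d2 by (simp add: d_def)
  then obtain N where N: "finite N" "N \<subseteq> K" "K \<subseteq> (\<Union>x\<in>N. ball x d)"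
    using seq_compact_imp_totally_bounded[of K] K by (auto simp: compact_eq_seq_compact_metric)
  have "\<forall>\<^sub>F h in F. \<forall>t\<in>N. norm (B h (f t) - g t) < e/3"
    using N lim e unfolding tendsto_iff dist_norm
    by (intro eventually_ball_finite) (auto simp del: less_divide_eq_numeral1)
  then show ?thesis using B
  proof eventually_elim
    case (elim h)
    interpret bounded_linear "B h" using elim by simp
    show ?case
    proof
      fix t assume t: "t \<in> K"
      then obtain s where s: "s \<in> N" "dist s t < d" using N by (auto simp: ball_def)
      have "norm (B h (f t) - g t) \<le> norm (B h (f t - f s)) + norm (B h (f s) - g s) + norm (g s - g t)"
        using norm_add3_le[of "B h (f t - f s)" "B h (f s) - g s" "g s - g t"] by (simp add: diff)
      moreover have "norm (B h (f t - f s)) < e/3"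
        using elim(2) d1(2)[of s t] s(2) subsetD[OF N(2) s(1)] t
          le_less_trans[of "norm (B h (f t - f s))" "norm (f t - f s)" "e/3"]
        by (simp add: d_def dist_commute) (simp add: dist_norm norm_minus_commute)
      moreover have "norm (g s - g t) < e/3"
        using d2(2)[of t s] s(2) subsetD[OF N(2) s(1)] t by (simp add: d_def dist_norm)
      moreover have "norm (B h (f s) - g s) < e/3" using elim s by auto
      ultimately show "norm (B h (f t) - g t) < e" by linarith
    qed
  qed
qed

lemma norm_funpow_contraction:
  fixes S :: "'h::real_normed_vector \<Rightarrow> 'h"
  assumes "\<And>x. norm (S x) \<le> norm x"
  shows "norm ((S ^^ k) x) \<le> norm x"
proof (induction k)
  case (Suc k) then show ?case using assms[of "(S ^^ k) x"] by simp
qed simp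

lemma bounded_linear_funpow:
  fixes S :: "'h::real_normed_vector \<Rightarrow> 'h"
  assumes "bounded_linear S" shows "bounded_linear (S ^^ k)"
proof (induction k)
  case 0 then show ?case using bounded_linear_ident by (simp add: id_def)
next
  case (Suc k) then show ?case
    using bounded_linear_compose[OF assms Suc] by (simp add: o_def)
qed

text \<open>
  The Neumann series of the resolvent \<open>(1 - (S - 1) / h)\<inverse>\<close>, that is, of the solution \<open>x\<close> of
  \<open>(1 + h) x - S x = h y\<close>.
\<close>

definition discrete_resolvent :: "real \<Rightarrow> ('h::banach \<Rightarrow> 'h) \<Rightarrow> 'h \<Rightarrow> 'h" where
  "discrete_resolvent h S y = (\<Sum>k. (h / (1 + h) ^ Suc k) *\<^sub>R (S ^^ k) y)"

locale contraction_step =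
  fixes h :: real and S :: "'h::banach \<Rightarrow> 'h"
  assumes h: "h > 0" and S: "bounded_linear S" and contr: "\<And>x. norm (S x) \<le> norm x"
begin

abbreviation "R \<equiv> discrete_resolvent h S"

lemma weights_sums: "(\<lambda>k. h / (1 + h) ^ Suc k) sums 1"
proof -
  have "(\<lambda>k. (h/(1+h)) * (1 / (1 + h)) ^ k) sums ((h/(1+h)) * (1 / (1 - 1 / (1 + h))))"
    using h by (intro sums_mult geometric_sums) auto
  moreover have "(h/(1+h)) * (1 / (1 - 1 / (1 + h))) = 1" using h by (simp add: divide_simps)
  ultimately show ?thesis using h by (simp add: power_one_over)
qed

lemma summable_norm_terms: "summable (\<lambda>k. norm ((h / (1 + h) ^ Suc k) *\<^sub>R (S ^^ k) y))"
proof (rule summable_comparison_test)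
  show "summable (\<lambda>k. h / (1 + h) ^ Suc k * norm y)"
    using sums_summable[OF weights_sums] by (intro summable_mult2)
  show "\<exists>N. \<forall>k\<ge>N. norm (norm ((h / (1 + h) ^ Suc k) *\<^sub>R (S ^^ k) y)) \<le> h / (1 + h) ^ Suc k * norm y"
    using h norm_funpow_contraction[of S, OF contr] by (auto intro!: divide_right_mono mult_left_mono)
qed

lemma summable_terms: "summable (\<lambda>k. (h / (1 + h) ^ Suc k) *\<^sub>R (S ^^ k) y)"
  using summable_norm_terms by (rule summable_norm_cancel)

lemma norm_R_le: "norm (R y) \<le> norm y"
proof -
  have "norm (R y) \<le> (\<Sum>k. norm ((h / (1 + h) ^ Suc k) *\<^sub>R (S ^^ k) y))"
    unfolding discrete_resolvent_def by (rule summable_norm[OF summable_norm_terms])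
  also have "\<dots> \<le> (\<Sum>k. h / (1 + h) ^ Suc k * norm y)"
    using h norm_funpow_contraction[of S, OF contr] sums_summable[OF weights_sums] summable_norm_terms
    by (intro suminf_le summable_mult2) (auto intro!: divide_right_mono mult_left_mono)
  also have "\<dots> = norm y"
    using weights_sums by (metis mult_1 sums_mult2 sums_unique)
  finally show ?thesis .
qed

lemma bounded_linear_R: "bounded_linear R"
proof (rule bounded_linear_intro[where K = 1])
  fix x y r
  have lin: "linear (S ^^ k)" for k
    using bounded_linear_funpow[OF S] by (rule bounded_linear.linear)
  show "R (x + y) = R x + R y"
    unfolding discrete_resolvent_def
    by (subst suminf_add[OF summable_terms summable_terms]) (simp add: linear_add[OF lin] scaleR_add_right)
  show "R (r *\<^sub>R x) = r *\<^sub>R R x"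
    unfolding discrete_resolvent_def
    by (subst suminf_scaleR_right[OF summable_terms]) (simp add: linear_scale[OF lin] mult.commute)
  show "norm (R x) \<le> norm x * 1" using norm_R_le by simp
qed

lemma R_commute: "R (S y) = S (R y)"
  unfolding discrete_resolvent_def
  by (subst bounded_linear.suminf[OF S summable_terms])
     (simp add: linear_scale[OF bounded_linear.linear[OF S]] funpow_swap1)

lemma R_step: "R ((1 + h) *\<^sub>R x - S x) = h *\<^sub>R x"
proof -
  let ?t = "\<lambda>k. (h / (1 + h) ^ k) *\<^sub>R (S ^^ k) x"
  have lin: "linear (S ^^ k)" for k
    using bounded_linear_funpow[OF S] by (rule bounded_linear.linear)
  have "(h / (1 + h) ^ Suc k) *\<^sub>R (S ^^ k) ((1 + h) *\<^sub>R x - S x) = ?t k - ?t (Suc k)" for k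
    using h by (simp add: linear_diff[OF lin] linear_scale[OF lin] scaleR_diff_right funpow_swap1 divide_simps)
  moreover have "(\<lambda>k. ?t k - ?t (Suc k)) sums (?t 0 - 0)"
  proof (rule telescope_sums')
    have "summable (\<lambda>k. (1+h) *\<^sub>R ((h / (1 + h) ^ Suc k) *\<^sub>R (S ^^ k) x))"
      by (intro summable_scaleR_right summable_terms)
    then have "summable ?t" using h by simp
    then show "?t \<longlonglongrightarrow> 0" by (rule summable_LIMSEQ_zero)
  qed
  ultimately show ?thesis
    unfolding discrete_resolvent_def by (simp add: sums_iff)
qed

text \<open>
  The resolvent turns the difference quotient, whose norm grows like \<open>1 / h\<close>, into a difference of
  contractions.
\<close>

lemma R_quotient: "R ((1 / h) *\<^sub>R (S x - x)) = R x - x"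
proof -
  interpret R: bounded_linear R by (rule bounded_linear_R)
  have "R ((1 + h) *\<^sub>R x - S x) = h *\<^sub>R R x - R (S x - x)"
    by (simp add: R.add R.diff R.scaleR scaleR_add_left)
  then have "R (S x - x) = h *\<^sub>R (R x - x)" using R_step[of x]
    by (simp add: algebra_simps)
  then show ?thesis using h by (simp add: R.scaleR)
qed

lemma R_funpow_commute: "R ((S ^^ n) y) = (S ^^ n) (R y)"
  by (induction n) (auto simp: R_commute)

end

text \<open>
  Used with \<open>x k = U (k h) p\<close>: the global error is the sum of the local errors, each transported
  by a power of the contraction.
\<close>

lemma funpow_diff_telescope:
  fixes S :: "'h::real_normed_vector \<Rightarrow> 'h"
  assumes "linear S"
  shows "(S ^^ n) x0 - x n = (S ^^ n) (x0 - x 0) + (\<Sum>k<n. (S ^^ (n - 1 - k)) (S (x k) - x (Suc k)))"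
proof -
  show ?thesis
  proof (induction n)
    case (Suc n)
    have "(\<Sum>k<Suc n. (S ^^ (Suc n - 1 - k)) (S (x k) - x (Suc k))) =
      S (\<Sum>k<n. (S ^^ (n - 1 - k)) (S (x k) - x (Suc k))) + (S (x n) - x (Suc n))"
      by (simp add: linear_sum[OF assms]) (rule sum.cong, auto simp: Suc_diff_Suc simp flip: funpow.simps(2)[THEN fun_cong, unfolded o_def])
    moreover have "S ((S ^^ n) x0 - x n) = S ((S ^^ n) (x0 - x 0)) + S (\<Sum>k<n. (S ^^ (n - 1 - k)) (S (x k) - x (Suc k)))"
      by (subst Suc) (simp add: linear_add[OF assms])
    ultimately show ?case by (simp add: linear_diff[OF assms] algebra_simps)
  qed (simp)
qed

lemma has_vector_derivative_iff_quotient: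
  "(F has_vector_derivative y) (at x within A) \<longleftrightarrow>
   ((\<lambda>t. (1 / (t - x)) *\<^sub>R (F t - F x)) \<longlongrightarrow> y) (at x within A)"
proof -
  let ?q = "\<lambda>t. (1 / (t - x)) *\<^sub>R (F t - F x)" and ?d = "\<lambda>t. (1 / norm (t - x)) *\<^sub>R (F t - (F x + (t - x) *\<^sub>R y))"
  have "norm (?d t) = norm (?q t - y)" if "t \<noteq> x" for t
  proof -
    have "?q t - y = (1 / (t - x)) *\<^sub>R (F t - (F x + (t - x) *\<^sub>R y))"
      using that by (simp add: scaleR_diff_right scaleR_add_right)
    then show ?thesis by simp
  qed
  then have "\<forall>\<^sub>F t in at x within A. norm (?d t) = norm (?q t - y)"
    by (auto simp: eventually_at_filter)
  then have "((\<lambda>t. norm (?d t)) \<longlongrightarrow> 0) (at x within A) \<longleftrightarrow> ((\<lambda>t. norm (?q t - y)) \<longlongrightarrow> 0) (at x within A)"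
    by (rule tendsto_cong)
  then show ?thesis
    unfolding tendsto_norm_zero_iff LIM_zero_iff has_vector_derivative_def has_derivative_within
    using bounded_linear_scaleR_left by blast
qed

lemmas has_vector_derivative_tendsto_quotient = has_vector_derivative_iff_quotient[THEN iffD1]

locale isometry_group =
  fixes U :: "real \<Rightarrow> 'h::banach \<Rightarrow> 'h"
  assumes bl: "bounded_linear (U t)" and iso: "norm (U t x) = norm x" and zero: "U 0 x = x"
    and flow: "U (s + t) x = U s (U t x)" and cont: "continuous_on UNIV (\<lambda>t. U t x)"
begin

definition generator :: "('h \<times> 'h) set" where
  "generator = {(x, y). ((\<lambda>t. (1 / t) *\<^sub>R (U t x - x)) \<longlongrightarrow> y) (at 0)}"

lemma generator_linear:
  assumes "(x, y) \<in> generator" "(x', y') \<in> generator"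
  shows "(c *\<^sub>R x, c *\<^sub>R y) \<in> generator" "(x - x', y - y') \<in> generator"
proof -
  have lim: "((\<lambda>t. (1 / t) *\<^sub>R (U t x - x)) \<longlongrightarrow> y) (at 0)" "((\<lambda>t. (1 / t) *\<^sub>R (U t x' - x')) \<longlongrightarrow> y') (at 0)"
    using assms by (auto simp: generator_def)
  have lin: "linear (U t)" for t using bl by (rule bounded_linear.linear)
  show "(c *\<^sub>R x, c *\<^sub>R y) \<in> generator"
    using tendsto_scaleR[OF tendsto_const[of c] lim(1)]
    by (simp add: generator_def linear_scale[OF lin] scaleR_right_diff_distrib mult.commute)
  show "(x - x', y - y') \<in> generator"
    using tendsto_diff[OF lim]
    by (simp add: generator_def linear_diff[OF lin] scaleR_right_diff_distrib algebra_simps)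
qed

lemma generator_invariant:
  assumes "(x, y) \<in> generator" shows "(U s x, U s y) \<in> generator"
proof -
  interpret bounded_linear "U s" by (rule bl)
  have "((\<lambda>t. U s ((1 / t) *\<^sub>R (U t x - x))) \<longlongrightarrow> U s y) (at 0)"
    using assms by (intro tendsto) (auto simp: generator_def)
  moreover have "U s (U t x) = U t (U s x)" for t by (metis flow add.commute)
  ultimately show ?thesis by (simp add: generator_def scaleR diff)
qed

text \<open>
  Applying \<open>U t\<close> moves the window of integration from \<open>[0, a]\<close> to \<open>[t, a + t]\<close>, so that only the
  boundary values survive differentiation at \<open>t = 0\<close>.
\<close>

lemma integral_in_generator:
  assumes a: "a > 0"
  shows "(integral {0..a} (\<lambda>s. U s x), U a x - x) \<in> generator"
proof -
  \<comment> \<open>The base point is negative because the derivative at \<open>0\<close> is two-sided.\<close>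
  define F where "F t = integral {-1..t} (\<lambda>s. U s x)" for t
  have c: "continuous_on S (\<lambda>s. U s x)" for S using cont by (rule continuous_on_subset) simp
  have int: "(\<lambda>s. U s x) integrable_on {l..u}" for l u
    by (rule integrable_continuous_real[OF c])
  have dF: "(F has_vector_derivative U t x) (at t)" if "-1 < t" "t < a + 1" for t
  proof -
    have "(F has_vector_derivative U t x) (at t within {-1..a+1})"
      unfolding F_def using that by (intro integral_has_vector_derivative c) auto
    then show ?thesis using that by (simp add: at_within_Icc_at)
  qed
  define I where "I = integral {0..a} (\<lambda>s. U s x)"
  have shift: "U t I = F (a + t) - F t" if t: "\<bar>t\<bar> < 1" for t
  proof -
    interpret bounded_linear "U t" by (rule bl)
    have "U t I = integral {0..a} (\<lambda>s. U (s + t) x)"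
      unfolding I_def using integral_linear[OF int bounded_linear_axioms, of 0 a]
      by (simp add: o_def flow add.commute[of _ t])
    also have "\<dots> = integral {t..a + t} (\<lambda>s. U s x)"
      using integral_shift_Icc_real[of 0 a "\<lambda>s. U s x" t]
      by (simp add: o_def add.commute[of _ t])
    also have "\<dots> = F (a + t) - F t"
      unfolding F_def using Henstock_Kurzweil_Integration.integral_combine[OF _ _ int, of "-1" t "a+t"] t a by (simp add: algebra_simps)
    finally show ?thesis .
  qed
  have "((\<lambda>t. F (a + t) - F t) has_vector_derivative (U a x - U 0 x)) (at 0)"
  proof (intro derivative_intros dF)
    have "(F has_vector_derivative U a x) (at (a + 0))" using dF[of a] a by simp
    moreover have "((\<lambda>t. a + t) has_vector_derivative 1) (at 0)"
      by (auto intro!: derivative_eq_intros)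
    ultimately show "((\<lambda>t. F (a + t)) has_vector_derivative U a x) (at 0)"
      using vector_diff_chain_at[of "\<lambda>t. a + t" 1 0 F "U a x"] by (simp add: o_def)
  qed (use a in auto)
  then have "((\<lambda>t. (1/t) *\<^sub>R ((F (a + t) - F t) - (F a - F 0))) \<longlongrightarrow> U a x - U 0 x) (at 0)"
    by (drule_tac has_vector_derivative_tendsto_quotient) simp
  then have "((\<lambda>t. (1/t) *\<^sub>R (U t I - I)) \<longlongrightarrow> U a x - U 0 x) (at 0)"
  proof (rule Lim_transform_eventually)
    have "\<forall>\<^sub>F t::real in at 0. \<bar>t\<bar> < 1" 
      using eventually_at_ball[of 1 "0::real" UNIV] by (simp add: dist_norm)
    then show "\<forall>\<^sub>F t in at 0. (1/t) *\<^sub>R ((F (a + t) - F t) - (F a - F 0)) = (1/t) *\<^sub>R (U t I - I)"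
      by eventually_elim (use shift[of 0] shift in \<open>simp add: zero flip: shift\<close>)
  qed
  then show ?thesis by (simp add: generator_def zero I_def)
qed

lemma average_tendsto: "((\<lambda>a. (1/a) *\<^sub>R integral {0..a} (\<lambda>s. U s x)) \<longlongrightarrow> x) (at_right 0)"
proof -
  have "((\<lambda>u. integral {0..u} (\<lambda>s. U s x)) has_vector_derivative U 0 x) (at 0 within {0..1})"
    by (intro integral_has_vector_derivative continuous_on_subset[OF cont]) auto
  then have "((\<lambda>a. (1/a) *\<^sub>R integral {0..a} (\<lambda>s. U s x)) \<longlongrightarrow> x) (at 0 within {0..1})"
    by (drule_tac has_vector_derivative_tendsto_quotient) (simp add: zero)
  moreover have "at (0::real) within {0..1} = at_right 0"
    by (metis at_within_Icc_at_right zero_less_one)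
  ultimately show ?thesis by simp
qed

lemma generator_domain_dense:
  assumes "e > 0" obtains p q where "(p, q) \<in> generator" "norm (p - x) < e"
proof -
  have "\<forall>\<^sub>F a in at_right 0. norm ((1/a) *\<^sub>R integral {0..a} (\<lambda>s. U s x) - x) < e \<and> a > 0"
    using tendstoD[OF average_tendsto assms] eventually_at_right_less
    by (auto simp: dist_norm eventually_conj_iff)
  then obtain a where "norm ((1/a) *\<^sub>R integral {0..a} (\<lambda>s. U s x) - x) < e" "a > 0"
    by (metis (no_types, lifting) eventually_happens trivial_limit_at_right_real)
  then show ?thesis
    using that generator_linear(1)[OF integral_in_generator integral_in_generator] by blast
qed

text \<open>
  Time averages of vectors in the domain lie in the domain of the square of the generator, because
  there the generator maps them to differences of orbit points. That domain appears in the form in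
  which it is used: \<open>p - q\<close> belongs to the domain of the generator again.
\<close>

lemma generator_square_domain_dense:
  assumes e: "e > 0"
  obtains p q q' where "(p, q) \<in> generator" "(p - q, q') \<in> generator" "norm (p - x) < e"
proof -
  obtain y z where y: "(y, z) \<in> generator" "norm (y - x) < e / 2"
    using generator_domain_dense[of "e/2" x] e by auto
  have "\<forall>\<^sub>F a in at_right 0. norm ((1/a) *\<^sub>R integral {0..a} (\<lambda>s. U s y) - y) < e/2 \<and> a > 0"
    using tendstoD[OF average_tendsto[of y], of "e/2"] e eventually_at_right_less
    by (auto simp: dist_norm eventually_conj_iff)
  then obtain a where a: "norm ((1/a) *\<^sub>R integral {0..a} (\<lambda>s. U s y) - y) < e/2" "a > 0"
    by (metis (no_types, lifting) eventually_happens trivial_limit_at_right_real)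
  define p q where "p = (1/a) *\<^sub>R integral {0..a} (\<lambda>s. U s y)" and "q = (1/a) *\<^sub>R (U a y - y)"
  have p: "(p, q) \<in> generator"
    unfolding p_def q_def using a generator_linear(1)[OF integral_in_generator integral_in_generator] by blast
  have q: "(q, (1/a) *\<^sub>R (U a z - z)) \<in> generator"
    unfolding q_def using generator_linear generator_invariant y(1) by blast
  have "norm (p - x) < e"
    using y(2) a(1) norm_triangle_ineq[of "p - y" "y - x"] unfolding p_def by (simp add: p_def)
  with p generator_linear(2)[OF p q] that show ?thesis by blast
qed

end

text \<open>
  A Trotter-Kato argument. The resolvents \<open>R\<^sub>h\<close> of the difference quotients converge to the resolvent
  of the generator, since \<open>R\<^sub>h\<close> is exact on the quotients and these converge on the core. For \<open>p\<close> in
  the domain, every term of \<open>R\<^sub>h (S(h)\<^sup>n - U(n h)) p\<close>, telescoped, is \<open>h\<close> times a quantity that tends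
  to \<open>0\<close> uniformly along the orbit. For \<open>p = (1 - A)\<inverse> p'\<close> with \<open>p'\<close> in the domain, the factor \<open>R\<^sub>h\<close> can be
  removed: it commutes with \<open>S(h)\<close> and is close to \<open>(1 - A)\<inverse>\<close>, which commutes with \<open>U\<close>.
\<close>

theorem chernoff_product_formula:
  fixes U S :: "real \<Rightarrow> 'h::banach \<Rightarrow> 'h"
  assumes U: "isometry_group U"
    and core: "isometry_group.generator U \<subseteq> closure G"
    and bl: "\<And>h. h > 0 \<Longrightarrow> bounded_linear (S h)"
    and contr: "\<And>h x. h > 0 \<Longrightarrow> norm (S h x) \<le> norm x"
    and consistent: "\<And>x y. (x, y) \<in> G \<Longrightarrow> ((\<lambda>h. (1 / h) *\<^sub>R (S h x - x)) \<longlongrightarrow> y) (at_right 0)"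
    and T: "T > 0" and e: "e > 0"
  shows "\<exists>h0>0. \<forall>h n. 0 < h \<longrightarrow> h < h0 \<longrightarrow> real n * h \<le> T \<longrightarrow> norm ((S h ^^ n) x - U (real n * h) x) < e"
proof -
  interpret U: isometry_group U by (rule U)
  have lin: "linear (U t)" for t using U.bl by (rule bounded_linear.linear)
  let ?R = "\<lambda>h. discrete_resolvent h (S h)"
  have cs: "contraction_step h (S h)" if "h > 0" for h
    using bl contr that by (auto simp: contraction_step_def)
  have Rbl: "bounded_linear (?R h)" "norm (?R h v) \<le> norm v" if "h > 0" for h v
    using contraction_step.bounded_linear_R[OF cs[OF that]] contraction_step.norm_R_le[OF cs[OF that]] by auto
  have pos: "\<forall>\<^sub>F h::real in at_right 0. h > 0" by (rule eventually_at_right_less)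
  have evR: "\<forall>\<^sub>F h in at_right 0. bounded_linear (?R h) \<and> (\<forall>v. norm (?R h v) \<le> norm v)"
    using pos by eventually_elim (use Rbl in auto)
  \<comment> \<open>If \<open>A p = q\<close> then \<open>p\<close> is the resolvent of \<open>p - q\<close>; a nearby pair \<open>(p', q')\<close> of the core stands in for \<open>(p, q)\<close>.\<close>
  have res: "((\<lambda>h. ?R h (p - q)) \<longlongrightarrow> p) (at_right 0)" if pq: "(p, q) \<in> U.generator" for p q
  proof (rule tendstoI, goal_cases)
    case (1 e)
    then have "(p, q) \<in> closure G" "e / 6 > 0" using core pq by auto
    then obtain p' q' where G: "(p', q') \<in> G" "dist (p', q') (p, q) < e / 6"
      unfolding closure_approachable by (metis surj_pair)
    have near: "norm (p' - p) < e/6" "norm (q' - q) < e/6"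
      using G(2) dist_fst_le[of "(p',q')" "(p,q)"] dist_snd_le[of "(p',q')" "(p,q)"] by (auto simp: dist_norm)
    have "\<forall>\<^sub>F h in at_right 0. norm ((1 / h) *\<^sub>R (S h p' - p') - q') < e/6"
      using tendstoD[OF consistent[OF G(1)] \<open>e/6 > 0\<close>] by (simp add: dist_norm)
    then show ?case using pos
    proof eventually_elim
      case (elim h)
      interpret R: bounded_linear "?R h" using Rbl elim by auto
      have "?R h ((1 / h) *\<^sub>R (S h p' - p')) = ?R h p' - p'"
        using contraction_step.R_quotient[OF cs] elim by blast
      then have *: "?R h (p - q) - p = ?R h (p - p') + ?R h (q' - q) + ?R h ((1 / h) *\<^sub>R (S h p' - p') - q') + (p' - p)"
        by (simp add: R.diff)
      have "norm (?R h (p - p')) < e/6" "norm (?R h (q' - q)) < e/6"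
        "norm (?R h ((1 / h) *\<^sub>R (S h p' - p') - q')) < e/6"
        using le_less_trans[OF Rbl(2)[OF elim(2)]] near elim(1) by (metis norm_minus_commute)+
      then show ?case unfolding dist_norm * using near 1
          norm_add4_le[of "?R h (p - p')" "?R h (q' - q)" "?R h ((1 / h) *\<^sub>R (S h p' - p') - q')" "p' - p"]
        by linarith
    qed
  qed
  have unif: "\<forall>\<^sub>F h in at_right 0. \<forall>t\<in>{0..T}. norm (?R h (U t (p - q)) - U t p) < c"
    if "(p, q) \<in> U.generator" "c > 0" for p q c
  proof (rule tendsto_uniformly_on_compact_orbit[OF evR _ _ _ _ that(2)])
    fix t show "((\<lambda>h. ?R h (U t (p - q))) \<longlongrightarrow> U t p) (at_right 0)"
      using res[OF U.generator_invariant[OF that(1), of t]] by (simp add: linear_diff[OF lin])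
  qed (auto intro: continuous_on_subset[OF U.cont])
  \<comment> \<open>There are at most \<open>T / h\<close> telescoping terms, hence the bound \<open>c / (2 T)\<close> for each of the two errors.\<close>
  have step1: "\<forall>\<^sub>F h in at_right 0. \<forall>n. real n * h \<le> T \<longrightarrow> norm (?R h ((S h ^^ n) p - U (real n * h) p)) \<le> c"
    if pq: "(p, q) \<in> U.generator" and c: "c > 0" for p q c
  proof -
    define b where "b = c / (2 * T)"
    have b: "b > 0" using c T by (simp add: b_def)
    have "((\<lambda>h. (1 / h) *\<^sub>R (U h p - p)) \<longlongrightarrow> q) (at_right 0)"
      using pq unfolding U.generator_def by (auto intro: tendsto_mono[OF at_le])
    from tendstoD[OF this b] have "\<forall>\<^sub>F h in at_right 0. norm ((1 / h) *\<^sub>R (U h p - p) - q) < b"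
      by (simp add: dist_norm)
    with unif[OF pq b] show ?thesis using pos
    proof (eventually_elim, safe)
      fix h :: real and n assume *: "\<forall>t\<in>{0..T}. norm (?R h (U t (p - q)) - U t p) < b"
        "norm ((1 / h) *\<^sub>R (U h p - p) - q) < b" "0 < h" "real n * h \<le> T"
      interpret R: bounded_linear "?R h" using Rbl * by auto
      interpret C: contraction_step h "S h" using cs * by auto
      have linS: "linear (S h)" using bl * bounded_linear.linear by blast
      have linSk: "linear (S h ^^ k)" for k
        using bounded_linear_funpow[OF bl] * bounded_linear.linear by blast
      define v where "v k = U (real k * h) p" for k
      have tele: "(S h ^^ n) p - v n = (\<Sum>k<n. (S h ^^ (n - 1 - k)) (S h (v k) - v (Suc k)))"
        using funpow_diff_telescope[OF linS, of n p v] by (simp add: v_def U.zero linear_0[OF linSk])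
      have "norm (?R h ((S h ^^ (n - 1 - k)) (S h (v k) - v (Suc k)))) \<le> h * (2 * b)" if k: "k < n" for k
      proof -
        let ?w = "(1 / h) *\<^sub>R (U h p - p) - q"
        have t: "real k * h \<in> {0..T}"
          using * k order_trans[OF mult_right_mono[of "real k" "real n" h] *(4)] by simp
        have suc: "v (Suc k) = U (real k * h) (U h p)"
          by (simp add: v_def U.flow[symmetric] algebra_simps)
        have "(1/h) *\<^sub>R ?R h (S h (v k) - v (Suc k)) =
           ?R h ((1/h) *\<^sub>R (S h (v k) - v k)) - ?R h (U (real k * h) ((1/h) *\<^sub>R (U h p - p)))"
          unfolding suc by (simp add: R.diff R.scaleR linear_diff[OF lin] linear_scale[OF lin] v_def scaleR_diff_right)
        also have "\<dots> = (?R h (U (real k * h) (p - q)) - v k) - ?R h (U (real k * h) ?w)"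
          by (simp add: C.R_quotient) (simp add: R.diff linear_diff[OF lin] v_def)
        finally have "norm ((1/h) *\<^sub>R ?R h (S h (v k) - v (Suc k))) \<le> b + b"
          using *(1)[rule_format, OF t] *(2) C.norm_R_le[of "U (real k * h) ?w"] U.iso[of "real k * h" ?w]
            norm_triangle_ineq4[of "?R h (U (real k * h) (p - q)) - v k" "?R h (U (real k * h) ?w)"]
          unfolding v_def by simp
        then have "norm (?R h (S h (v k) - v (Suc k))) \<le> h * (2 * b)"
          using *(3) by (simp add: field_simps)
        then show ?thesis
          unfolding C.R_funpow_commute using norm_funpow_contraction[of "S h", OF C.contr] order_trans by blast
      qed
      then have "norm (?R h ((S h ^^ n) p - v n)) \<le> (\<Sum>k<n. h * (2 * b))"
        unfolding tele R.sum by (intro sum_norm_le) auto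
      also have "\<dots> = real n * h * (2 * b)" by simp
      also have "\<dots> \<le> T * (2 * b)" using * b by (intro mult_right_mono) auto
      also have "\<dots> = c" using T by (simp add: b_def)
      finally show "norm (?R h ((S h ^^ n) p - U (real n * h) p)) \<le> c" by (simp add: v_def)
    qed
  qed
  obtain p q q' where p: "(p, q) \<in> U.generator" "(p - q, q') \<in> U.generator" "norm (p - x) < e / 6"
    using U.generator_square_domain_dense[of "e/6" x] e by auto
  have e6: "e / 6 > 0" using e by simp
  have "\<forall>\<^sub>F h in at_right 0. norm (?R h (p - q) - p) < e/6"
    using tendstoD[OF res[OF p(1)] e6] by (simp add: dist_norm)
  with unif[OF p(1) e6] step1[OF p(2) e6]
  have "\<forall>\<^sub>F h in at_right 0. h > 0 \<longrightarrow> (\<forall>n. real n * h \<le> T \<longrightarrow> norm ((S h ^^ n) x - U (real n * h) x) < e)"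
  proof (eventually_elim, safe)
    fix h :: real and n assume *: "\<forall>t\<in>{0..T}. norm (?R h (U t (p - q)) - U t p) < e/6"
      "\<forall>n. real n * h \<le> T \<longrightarrow> norm (?R h ((S h ^^ n) (p - q) - U (real n * h) (p - q))) \<le> e/6"
      "norm (?R h (p - q) - p) < e/6" "0 < h" "real n * h \<le> T"
    interpret R: bounded_linear "?R h" using Rbl * by auto
    interpret C: contraction_step h "S h" using cs * by auto
    interpret Sn: bounded_linear "S h ^^ n" using bounded_linear_funpow bl * by auto
    let ?t = "real n * h"
    have t: "?t \<in> {0..T}" using * by auto
    have "(S h ^^ n) x - U ?t x = (S h ^^ n) (x - p) - (S h ^^ n) (?R h (p - q) - p)
      + ?R h ((S h ^^ n) (p - q) - U ?t (p - q)) + (?R h (U ?t (p - q)) - U ?t p) - U ?t (x - p)"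
      by (simp add: R.diff Sn.diff linear_diff[OF lin] C.R_funpow_commute)
    moreover have "norm ((S h ^^ n) (x - p)) < e/6" "norm ((S h ^^ n) (?R h (p - q) - p)) < e/6" "norm (U ?t (x - p)) < e/6"
      using le_less_trans[OF norm_funpow_contraction[of "S h", OF C.contr, of n]] p(3) *(3)
      unfolding U.iso norm_minus_commute[of x p] by (metis norm_minus_commute)+
    moreover have "norm (?R h ((S h ^^ n) (p - q) - U ?t (p - q))) \<le> e/6" "norm (?R h (U ?t (p - q)) - U ?t p) < e/6"
      using * t by auto
    ultimately show "norm ((S h ^^ n) x - U ?t x) < e"
      using e norm_triangle_ineq4[of "(S h ^^ n) (x - p)" "(S h ^^ n) (?R h (p - q) - p)"]
        norm_triangle_ineq4[of "(S h ^^ n) (x - p) - (S h ^^ n) (?R h (p - q) - p)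
      + ?R h ((S h ^^ n) (p - q) - U ?t (p - q)) + (?R h (U ?t (p - q)) - U ?t p)" "U ?t (x - p)"]
        norm_add3_le[of "(S h ^^ n) (x - p) - (S h ^^ n) (?R h (p - q) - p)"
          "?R h ((S h ^^ n) (p - q) - U ?t (p - q))" "?R h (U ?t (p - q)) - U ?t p"] by simp
  qed
  then obtain b where "b > 0" "\<forall>h>0. h < b \<longrightarrow> (\<forall>n. real n * h \<le> T \<longrightarrow> norm ((S h ^^ n) x - U (real n * h) x) < e)"
    unfolding eventually_at_right_field by auto
  then show ?thesis by blast
qed

section \<open>The space \<open>L\<^sup>2\<close> is complete\<close>

lemma abs_L2_rep_L2 [simp]: "abs_L2 (rep_L2 \<psi>) = \<psi>"
  using Quotient3_L2 by (rule Quotient3_abs_rep)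

lemma square_integrable_rep_L2: "square_integrable (rep_L2 \<psi>)"
  using Quotient3_rep_reflp[OF Quotient3_L2, of \<psi>] by (simp add: l2_rel_def)

lemma l2_rel_refl: "square_integrable f \<Longrightarrow> l2_rel f f"
  by (simp add: l2_rel_def)

lemma abs_L2_eqI:
  assumes "square_integrable f" "square_integrable g" "AE x in lborel. f x = g x"
  shows "abs_L2 f = abs_L2 g"
  using assms Quotient3_rel_abs[OF Quotient3_L2, of f g] by (simp add: l2_rel_def)

lemma abs_L2_diff: "square_integrable f \<Longrightarrow> square_integrable g \<Longrightarrow> abs_L2 f - abs_L2 g = abs_L2 (\<lambda>x. f x - g x)"
  by (simp add: minus_L2.abs_eq l2_rel_refl)

lemma abs_L2_add: "square_integrable f \<Longrightarrow> square_integrable g \<Longrightarrow> abs_L2 f + abs_L2 g = abs_L2 (\<lambda>x. f x + g x)"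
  by (simp add: plus_L2.abs_eq l2_rel_refl)

lemma abs_L2_scaleR: "square_integrable f \<Longrightarrow> r *\<^sub>R abs_L2 f = abs_L2 (\<lambda>x. r *\<^sub>R f x)"
  by (simp add: scaleR_L2.abs_eq l2_rel_refl)

lemma abs_L2_scaleC: "square_integrable f \<Longrightarrow> c *\<^sub>C abs_L2 f = abs_L2 (\<lambda>x. c * f x)"
  by (simp add: scaleC.abs_eq l2_rel_refl)

text \<open>
  The squared norm with values in \<open>[0, \<infinity>]\<close>, so that estimates can be stated before membership in
  \<open>L\<^sup>2\<close> is known.
\<close>

definition energy :: "('a::euclidean_space \<Rightarrow> complex) \<Rightarrow> ennreal" where
  "energy f = (\<integral>\<^sup>+x. ennreal ((norm (f x))\<^sup>2) \<partial>lborel)"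

lemma square_integrable_iff_energy:
  "square_integrable f \<longleftrightarrow> f \<in> borel_measurable lborel \<and> energy f < \<infinity>"
  by (auto simp: square_integrable_def energy_def integrable_iff_bounded)

lemma energy_eq_norm: "square_integrable f \<Longrightarrow> energy f = ennreal ((norm (abs_L2 f))\<^sup>2)"
  unfolding energy_def
  by (subst nn_integral_eq_integral)
     (auto simp: square_integrable_def norm_L2.abs_eq l2_rel_refl)

lemma norm_abs_L2_leI:
  assumes "square_integrable f" "energy f \<le> ennreal (c\<^sup>2)" "c \<ge> 0"
  shows "norm (abs_L2 f) \<le> c"
  using assms energy_eq_norm[OF assms(1)] by (metis ennreal_le_iff power2_le_imp_le zero_le_power2)

lemma energy_scale: "f \<in> borel_measurable lborel \<Longrightarrow> energy (\<lambda>x. c * f x) = ennreal ((norm c)\<^sup>2) * energy f"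
  unfolding energy_def by (subst nn_integral_cmult[symmetric]) (auto simp: norm_mult power_mult_distrib ennreal_mult)

text \<open>
  Fatou's lemma.
\<close>

lemma energy_limit_le:
  assumes [measurable]: "\<And>n. f n \<in> borel_measurable lborel"
    and lim: "AE x in lborel. (\<lambda>n. f n x) \<longlonglongrightarrow> g x"
    and le: "\<forall>\<^sub>F n in sequentially. energy (f n) \<le> c"
  shows "energy g \<le> c"
proof -
  have "energy g = (\<integral>\<^sup>+x. liminf (\<lambda>n. ennreal ((norm (f n x))\<^sup>2)) \<partial>lborel)"
    unfolding energy_def
  proof (rule nn_integral_cong_AE, use lim in eventually_elim)
    case (elim x)
    then have "(\<lambda>n. ennreal ((norm (f n x))\<^sup>2)) \<longlonglongrightarrow> ennreal ((norm (g x))\<^sup>2)"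
      by (intro tendsto_intros)
    then show ?case by (intro lim_imp_Liminf[symmetric]) auto
  qed
  also have "\<dots> \<le> liminf (\<lambda>n. energy (f n))"
    unfolding energy_def by (rule nn_integral_liminf) measurable
  also have "\<dots> \<le> c"
    by (metis Liminf_le le sequentially_bot)
  finally show ?thesis .
qed

text \<open>
  The Riesz-Fischer argument: along a subsequence with summable increments, the pointwise sums of the
  absolute increments stay bounded in norm, hence are finite almost everywhere, so the subsequence
  converges almost everywhere. Fatou's lemma turns this into convergence in norm.
\<close>

lemma Cauchy_L2_convergent:
  fixes X :: "nat \<Rightarrow> 'a::euclidean_space L2"
  assumes X: "Cauchy X" shows "convergent X"
proof -
  have ex: "\<exists>N. \<forall>m\<ge>N. \<forall>n\<ge>N. dist (X m) (X n) < (1/2)^k" for k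
    using X unfolding Cauchy_def by (metis zero_less_divide_1_iff zero_less_numeral zero_less_power)
  obtain N where N: "\<And>k m n. m \<ge> N k \<Longrightarrow> n \<ge> N k \<Longrightarrow> dist (X m) (X n) < (1/2)^k"
    using ex by metis
  define r where "r k = (\<Sum>i\<le>k. N i) + k" for k
  have r: "r k \<ge> N k" for k by (simp add: r_def member_le_sum trans_le_add1)
  have rmono: "strict_mono r" by (rule strict_mono_Suc_iff[THEN iffD2]) (simp add: r_def)
  have close: "dist (X (r m)) (X (r k)) < (1/2)^k" if "m \<ge> k" for m k
    by (rule N) (use that r strict_mono_less_eq[OF rmono] in \<open>meson order_trans\<close>)+
  define F where "F k = rep_L2 (X (r k))" for k
  have sq: "square_integrable (F k)" for k by (simp add: F_def square_integrable_rep_L2)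
  have [measurable]: "F k \<in> borel_measurable lborel" for k using sq by (simp add: square_integrable_def)
  have absF: "abs_L2 (F k) = X (r k)" for k by (simp add: F_def)
  have FF: "energy (\<lambda>x. F m x - F k x) \<le> ennreal (((1/2)^k)\<^sup>2)" if "m \<ge> k" for m k
    using close[OF that] 
    by (subst energy_eq_norm) (auto simp: square_integrable_diff sq dist_norm abs_L2_diff[symmetric] absF intro!: ennreal_leI power_mono)
  define d where "d k x = complex_of_real (norm (F (Suc k) x - F k x))" for k x
  have sqd: "square_integrable (d k)" for k
    using square_integrable_diff[OF sq[of "Suc k"] sq[of k]] unfolding square_integrable_def d_def by auto
  have [measurable]: "d k \<in> borel_measurable lborel" for k using sqd by (simp add: square_integrable_def)
  have nd: "norm (abs_L2 (d k)) \<le> (1/2)^k" for k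
    using FF[of k "Suc k"] by (intro norm_abs_L2_leI sqd) (auto simp: d_def energy_def)
  have sumd: "square_integrable (\<lambda>x. \<Sum>k<n. d k x) \<and> abs_L2 (\<lambda>x. \<Sum>k<n. d k x) = (\<Sum>k<n. abs_L2 (d k))" for n
  proof (induction n)
    case 0 then show ?case by (simp add: square_integrable_zero zero_L2_def)
  next
    case (Suc n) then show ?case by (simp add: square_integrable_add sqd abs_L2_add[symmetric])
  qed
  have bound: "(\<integral>\<^sup>+x. (\<Sum>k<n. ennreal (cmod (d k x)))\<^sup>2 \<partial>lborel) \<le> 4" for n
  proof -
    have "(\<Sum>k<n. ennreal (cmod (d k x)))\<^sup>2 = ennreal ((cmod (\<Sum>k<n. d k x))\<^sup>2)" for x
    proof -
      have "cmod (\<Sum>k<n. d k x) = (\<Sum>k<n. cmod (d k x))"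
        unfolding d_def of_real_sum[symmetric] norm_of_real by (simp add: sum_nonneg)
      then show ?thesis by (simp add: sum_nonneg ennreal_power)
    qed
    then have "(\<integral>\<^sup>+x. (\<Sum>k<n. ennreal (cmod (d k x)))\<^sup>2 \<partial>lborel) = energy (\<lambda>x. \<Sum>k<n. d k x)"
      by (simp add: energy_def)
    also have "\<dots> = ennreal ((norm (\<Sum>k<n. abs_L2 (d k)))\<^sup>2)" using sumd energy_eq_norm by metis
    also have "norm (\<Sum>k<n. abs_L2 (d k)) \<le> (\<Sum>k<n. (1/2)^k)" using nd by (intro sum_norm_le)
    then have "norm (\<Sum>k<n. abs_L2 (d k)) \<le> 2" 
      using sum_le_suminf[of "\<lambda>k. (1/2::real)^k" "{..<n}"] by (simp add: suminf_geometric summable_geometric)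
    then have "ennreal ((norm (\<Sum>k<n. abs_L2 (d k)))\<^sup>2) \<le> ennreal (2\<^sup>2)" by (intro ennreal_leI power_mono) auto
    finally show ?thesis by simp
  qed
  have "(\<integral>\<^sup>+x. (SUP n. (\<Sum>k<n. ennreal (cmod (d k x)))\<^sup>2) \<partial>lborel) = (SUP n. \<integral>\<^sup>+x. (\<Sum>k<n. ennreal (cmod (d k x)))\<^sup>2 \<partial>lborel)"
    by (rule nn_integral_monotone_convergence_SUP)
       (auto simp: incseq_def le_fun_def simp del: sum_ennreal intro!: power_mono sum_mono2)
  also have "\<dots> \<le> 4" using bound by (intro SUP_least)
  finally have "(\<integral>\<^sup>+x. (SUP n. (\<Sum>k<n. ennreal (cmod (d k x)))\<^sup>2) \<partial>lborel) \<noteq> \<infinity>"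
    by (auto simp: top_unique)
  then have "AE x in lborel. (SUP n. (\<Sum>k<n. ennreal (cmod (d k x)))\<^sup>2) \<noteq> \<infinity>"
    by (intro nn_integral_noteq_infinite) auto
  then have conv: "AE x in lborel. (\<lambda>k. F k x) \<longlonglongrightarrow> lim (\<lambda>k. F k x)"
  proof eventually_elim
    case (elim x)
    then obtain C where C: "C \<ge> 0" "(SUP n. (\<Sum>k<n. ennreal (cmod (d k x)))\<^sup>2) = ennreal C"
      by (cases "SUP n. (\<Sum>k<n. ennreal (cmod (d k x)))\<^sup>2") auto
    have "(\<Sum>k<n. cmod (d k x)) \<le> C + 1" for n
    proof -
      have "(\<Sum>k<n. ennreal (cmod (d k x)))\<^sup>2 \<le> ennreal C"
        unfolding C(2)[symmetric] by (rule SUP_upper) auto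
      then have "(\<Sum>k<n. cmod (d k x))\<^sup>2 \<le> C" using C(1)
        by (simp add: sum_nonneg ennreal_power)
      moreover have "C \<le> (C + 1)\<^sup>2" using C(1) by (simp add: power2_eq_square algebra_simps)
      ultimately show ?thesis using C(1) by (meson order_trans power2_le_imp_le add_nonneg_nonneg zero_le_one)
    qed
    then have "summable (\<lambda>k. cmod (d k x))"
      by (intro bounded_imp_summable[of _ "C+1"]) (simp_all only: lessThan_Suc_atMost[symmetric] norm_ge_zero)
    then have "summable (\<lambda>k. F (Suc k) x - F k x)" by (auto simp: d_def intro: summable_norm_cancel)
    then have "convergent (\<lambda>n. \<Sum>k<n. F (Suc k) x - F k x)" by (simp add: summable_iff_convergent)
    then have "convergent (\<lambda>n. F n x - F 0 x)"
      unfolding sum_lessThan_telescope[of "\<lambda>k. F k x"] .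
    then have "convergent (\<lambda>n. F n x)"
      using convergent_add_const_right_iff[of "\<lambda>n. F n x" "- F 0 x"] by simp
    then show ?case by (simp add: convergent_LIMSEQ_iff)
  qed
  define f where "f x = lim (\<lambda>k. F k x)" for x
  have [measurable]: "f \<in> borel_measurable lborel" unfolding f_def by (rule borel_measurable_lim_metric) measurable
  have le: "energy (\<lambda>x. f x - F k x) \<le> ennreal (((1/2)^k)\<^sup>2)" for k
  proof (rule energy_limit_le[where f = "\<lambda>m x. F m x - F k x"])
    show "AE x in lborel. (\<lambda>n. F n x - F k x) \<longlonglongrightarrow> f x - F k x"
      using conv by eventually_elim (auto simp: f_def intro: tendsto_intros)
    show "\<forall>\<^sub>F n in sequentially. energy (\<lambda>x. F n x - F k x) \<le> ennreal (((1 / 2) ^ k)\<^sup>2)"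
      using eventually_ge_at_top[of k] by eventually_elim (rule FF)
  qed measurable
  have sqfd: "square_integrable (\<lambda>x. f x - F k x)" for k
    using le_less_trans[OF le[of k]] by (auto simp: square_integrable_iff_energy)
  have sqf: "square_integrable f"
    using square_integrable_add[OF sqfd[of 0] sq[of 0]] by simp
  have nf: "norm (abs_L2 f - X (r k)) \<le> (1/2)^k" for k
    using le[of k] by (simp add: absF[symmetric] abs_L2_diff sqf sq) (rule norm_abs_L2_leI[OF sqfd], auto)
  have "(\<lambda>k. X (r k)) \<longlonglongrightarrow> abs_L2 f"
  proof (rule metric_tendsto_imp_tendsto)
    show "(\<lambda>k. (1/2::real)^k) \<longlonglongrightarrow> 0" by (rule LIMSEQ_power_zero) simp
    show "\<forall>\<^sub>F k in sequentially. dist (X (r k)) (abs_L2 f) \<le> dist ((1/2::real)^k) 0"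
      using nf by (auto simp: dist_norm norm_minus_commute)
  qed
  then show ?thesis
    using Cauchy_converges_subseq[OF X rmono] by (auto simp: convergent_def o_def)
qed

instance L2 :: (euclidean_space) complete_space
  by standard (rule Cauchy_L2_convergent)

instance L2 :: (euclidean_space) banach ..

section \<open>Integrals depending on a parameter\<close>

lemma lborel_translate:
  fixes f :: "'a::euclidean_space \<Rightarrow> 'b::{banach, second_countable_topology}" and c :: 'a
  shows integrable_lborel_translate: "integrable lborel f \<Longrightarrow> integrable lborel (\<lambda>x. f (x + c))"
    and integral_lborel_translate: "f \<in> borel_measurable borel \<Longrightarrow> (LINT x|lborel. f (x + c)) = (LINT x|lborel. f x)"
proof -
  assume f: "integrable lborel f"
  then have [measurable]: "f \<in> borel_measurable borel" by (simp add: borel_measurable_integrable[OF f, simplified])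
  from f have "integrable (distr lborel borel ((+) c)) f" by (simp add: lborel_distr_plus)
  then show "integrable lborel (\<lambda>x. f (x + c))"
    by (subst (asm) integrable_distr_eq) (auto simp: add.commute)
next
  assume [measurable]: "f \<in> borel_measurable borel"
  have "(LINT x|lborel. f x) = (LINT x|distr lborel borel ((+) c). f x)" by (simp add: lborel_distr_plus)
  also have "\<dots> = (LINT x|lborel. f (x + c))" by (subst integral_distr) (auto simp: add.commute)
  finally show "(LINT x|lborel. f (x + c)) = (LINT x|lborel. f x)" by simp
qed

lemma nn_integral_lborel_translate:
  fixes c :: "'a::euclidean_space"
  assumes [measurable]: "f \<in> borel_measurable borel"
  shows "(\<integral>\<^sup>+x. f (x + c) \<partial>lborel) = (\<integral>\<^sup>+x. f x \<partial>lborel)"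
proof -
  have "(\<integral>\<^sup>+x. f x \<partial>lborel) = (\<integral>\<^sup>+x. f x \<partial>distr lborel borel ((+) c))" by (simp add: lborel_distr_plus)
  also have "\<dots> = (\<integral>\<^sup>+x. f (x + c) \<partial>lborel)" by (subst nn_integral_distr) (auto simp: add.commute)
  finally show ?thesis by simp
qed

lemma integral_lborel_affine:
  fixes c :: "'a::euclidean_space" and f :: "'a \<Rightarrow> 'b::{banach, second_countable_topology}"
  assumes [measurable]: "f \<in> borel_measurable borel" and r: "r > 0"
  shows "(LINT x|lborel. f x) = r ^ DIM('a) *\<^sub>R (LINT x|lborel. f (c + r *\<^sub>R x))"
  using r by (subst lborel_affine[of r c]) (auto simp: integral_density integral_distr)

text \<open>
  \<open>H\<close> and its translate by \<open>u\<close> have the same integral. Their difference is the integral of \<open>H'\<close> over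
  the segment from \<open>x\<close> to \<open>x + u\<close>, and by Fubini's theorem the integral of that over \<open>x\<close> is \<open>\<integral> H'\<close>.
\<close>

lemma integral_directional_derivative_zero:
  fixes H H' :: "'a::euclidean_space \<Rightarrow> 'b::euclidean_space"
  assumes H: "integrable lborel H" and H': "integrable lborel H'"
    and deriv: "\<And>x t. ((\<lambda>t. H (x + t *\<^sub>R u)) has_vector_derivative H' (x + t *\<^sub>R u)) (at t)"
    and cont: "\<And>x. continuous_on UNIV (\<lambda>t. H' (x + t *\<^sub>R u))"
  shows "(LINT x|lborel. H' x) = 0"
proof -
  have [measurable]: "H' \<in> borel_measurable borel" "H \<in> borel_measurable borel"
    using H H' by (auto dest: borel_measurable_integrable)
  have FTC: "(LINT t|lborel. indicator {0..1::real} t *\<^sub>R H' (x + t *\<^sub>R u)) = H (x + u) - H x" for x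
    using integral_FTC_Icc[of 0 1 "\<lambda>t. H (x + t *\<^sub>R u)" "\<lambda>t. H' (x + t *\<^sub>R u)"] deriv
    by (auto intro: has_vector_derivative_at_within continuous_on_subset[OF cont])
  have int: "integrable (lborel \<Otimes>\<^sub>M lborel) (\<lambda>(t::real, x). indicator {0..1::real} t *\<^sub>R H' (x + t *\<^sub>R u))"
  proof (rule lborel_pair.Fubini_integrable)
    have eq: "(LINT x|lborel. norm (indicator {0..1::real} t *\<^sub>R H' (x + t *\<^sub>R u))) = indicator {0..1} t *\<^sub>R (LINT x|lborel. norm (H' x))" for t :: real
      using integral_lborel_translate[of "\<lambda>x. norm (H' x)" "t *\<^sub>R u"] by simp
    show "integrable lborel (\<lambda>t::real. LINT x|lborel. norm (case (t, x) of (t, x) \<Rightarrow> indicator {0..1::real} t *\<^sub>R H' (x + t *\<^sub>R u)))"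
      unfolding prod.case eq by (simp add: integrable_real_indicator)
    show "AE t::real in lborel. integrable lborel (\<lambda>x. case (t, x) of (t, x) \<Rightarrow> indicator {0..1::real} t *\<^sub>R H' (x + t *\<^sub>R u))"
      using integrable_lborel_translate[OF H'] by auto
  qed measurable
  have "0 = (LINT x|lborel. H (x + u) - H x)"
    using H integrable_lborel_translate[OF H] by (simp add: integral_lborel_translate)
  also have "\<dots> = (LINT x|lborel. LINT t|lborel. indicator {0..1::real} t *\<^sub>R H' (x + t *\<^sub>R u))"
    by (simp add: FTC)
  also have "\<dots> = (LINT t|lborel. LINT x|lborel. indicator {0..1::real} t *\<^sub>R H' (x + t *\<^sub>R u))"
    using lborel_pair.Fubini_integral[OF int] by simp
  also have "\<dots> = (LINT t|lborel. indicator {0..1::real} t *\<^sub>R (LINT x|lborel. H' x))"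
    by (simp add: integral_lborel_translate)
  also have "\<dots> = (LINT x|lborel. H' x)" by simp
  finally show ?thesis by simp
qed

text \<open>
  Dominated convergence for the difference quotients, which are bounded by \<open>g\<close> through the mean value
  inequality.
\<close>

lemma has_vector_derivative_integral:
  fixes f f' :: "real \<Rightarrow> 'a \<Rightarrow> 'b::{banach, second_countable_topology}"
  assumes int: "\<And>t. t \<in> {a<..<b} \<Longrightarrow> integrable M (f t)"
    and deriv: "\<And>t x. t \<in> {a<..<b} \<Longrightarrow> x \<in> space M \<Longrightarrow> ((\<lambda>t. f t x) has_vector_derivative f' t x) (at t)"
    and bound: "\<And>t x. t \<in> {a<..<b} \<Longrightarrow> x \<in> space M \<Longrightarrow> norm (f' t x) \<le> g x"
    and g: "integrable M g" and t0: "t0 \<in> {a<..<b}" and meas: "f' t0 \<in> borel_measurable M"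
  shows "((\<lambda>t. LINT x|M. f t x) has_vector_derivative (LINT x|M. f' t0 x)) (at t0)"
proof (rule has_vector_derivative_iff_quotient[THEN iffD2])
  have at: "at t0 = at t0 within {a<..<b}" using t0 by (intro at_within_open[symmetric]) auto
  show "((\<lambda>t. (1 / (t - t0)) *\<^sub>R ((LINT x|M. f t x) - (LINT x|M. f t0 x))) \<longlongrightarrow> (LINT x|M. f' t0 x)) (at t0)"
    unfolding at tendsto_at_iff_sequentially
  proof (intro allI impI)
    fix X assume X: "\<forall>i. X i \<in> {a<..<b} - {t0}" "X \<longlonglongrightarrow> t0"
    have intX: "integrable M (f (X i))" "integrable M (f t0)" for i using X int t0 by auto
    have "(\<lambda>i. LINT x|M. (1 / (X i - t0)) *\<^sub>R (f (X i) x - f t0 x)) \<longlonglongrightarrow> (LINT x|M. f' t0 x)"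
    proof (rule integral_dominated_convergence[OF meas _ g])
      show "(\<lambda>x. (1 / (X i - t0)) *\<^sub>R (f (X i) x - f t0 x)) \<in> borel_measurable M" for i
        using intX[THEN borel_measurable_integrable] by measurable
      show "AE x in M. (\<lambda>i. (1 / (X i - t0)) *\<^sub>R (f (X i) x - f t0 x)) \<longlonglongrightarrow> f' t0 x"
      proof (rule AE_I2)
        fix x assume "x \<in> space M"
        from has_vector_derivative_tendsto_quotient[OF deriv[OF t0 this]]
        show "(\<lambda>i. (1 / (X i - t0)) *\<^sub>R (f (X i) x - f t0 x)) \<longlonglongrightarrow> f' t0 x"
          using X unfolding at tendsto_at_iff_sequentially by (auto simp: o_def)
      qed
      show "AE x in M. norm ((1 / (X i - t0)) *\<^sub>R (f (X i) x - f t0 x)) \<le> g x" for i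
      proof (rule AE_I2)
        fix x assume x: "x \<in> space M"
        have "norm (f (X i) x - f t0 x) \<le> g x * norm (X i - t0)"
        proof (rule differentiable_bound[where S = "{a<..<b}" and f' = "\<lambda>t h. h *\<^sub>R f' t x"])
          show "((\<lambda>t. f t x) has_derivative (\<lambda>h. h *\<^sub>R f' t x)) (at t within {a<..<b})" if "t \<in> {a<..<b}" for t
            using deriv[OF that x] by (auto simp: has_vector_derivative_def intro: has_derivative_at_withinI)
          show "onorm (\<lambda>h. h *\<^sub>R f' t x) \<le> g x" if "t \<in> {a<..<b}" for t
            using bound[OF that x] by (intro onorm_le) (simp add: mult.commute[of "g x"] mult_left_mono)
        qed (use X t0 in auto)
        moreover have "X i \<noteq> t0" using X by auto
        ultimately show "norm ((1 / (X i - t0)) *\<^sub>R (f (X i) x - f t0 x)) \<le> g x"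
          by (simp add: divide_le_eq)
      qed
    qed
    then show "((\<lambda>t. (1 / (t - t0)) *\<^sub>R ((LINT x|M. f t x) - (LINT x|M. f t0 x))) \<circ> X) \<longlonglongrightarrow> (LINT x|M. f' t0 x)"
      using intX by (simp add: o_def)
  qed
qed

lemma ennreal_norm_integral_le:
  fixes f :: "'a \<Rightarrow> 'b::{banach, second_countable_topology}"
  shows "ennreal (norm (LINT x|M. f x)) \<le> (\<integral>\<^sup>+x. ennreal (norm (f x)) \<partial>M)"
  by (cases "integrable M f") (auto simp: integral_norm_bound_ennreal not_integrable_integral_eq)

text \<open>
  Minkowski's inequality for integrals in a form without square roots: Cauchy-Schwarz in \<open>t\<close>,
  followed by Tonelli's theorem.
\<close>

lemma energy_integral_le:
  fixes F :: "real \<Rightarrow> 'a::euclidean_space \<Rightarrow> complex"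
  assumes [measurable]: "(\<lambda>(t, x). F t x) \<in> borel_measurable borel" and ab: "a \<le> b"
    and le: "\<And>t. t \<in> {a..b} \<Longrightarrow> energy (F t) \<le> c"
  shows "energy (\<lambda>x. LINT t|lborel. indicator {a..b} t *\<^sub>R F t x) \<le> ennreal ((b - a)\<^sup>2) * c"
proof -
  have m[measurable]: "(\<lambda>(t, x). F t x) \<in> borel_measurable (lborel \<Otimes>\<^sub>M lborel)"
    by (simp add: lborel_prod)
  have "(ennreal ((norm (LINT t|lborel. indicator {a..b} t *\<^sub>R F t x))\<^sup>2)) \<le> 
      ennreal (b - a) * (\<integral>\<^sup>+t. indicator {a..b} t * ennreal ((norm (F t x))\<^sup>2) \<partial>lborel)" for x
  proof -
    have "ennreal ((norm (LINT t|lborel. indicator {a..b} t *\<^sub>R F t x))\<^sup>2) = (ennreal (norm (LINT t|lborel. indicator {a..b} t *\<^sub>R F t x)))\<^sup>2"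
      by (simp add: ennreal_power)
    also have "\<dots> \<le> (\<integral>\<^sup>+t. ennreal (norm (indicator {a..b} t *\<^sub>R F t x)) \<partial>lborel)\<^sup>2"
      by (intro power_mono ennreal_norm_integral_le) auto
    also have "(\<integral>\<^sup>+t. ennreal (norm (indicator {a..b} t *\<^sub>R F t x)) \<partial>lborel) = (\<integral>\<^sup>+t. indicator {a..b} t * (indicator {a..b} t * ennreal (norm (F t x))) \<partial>lborel)"
      by (intro nn_integral_cong) (auto split: split_indicator)
    also have "\<dots>\<^sup>2 \<le> (\<integral>\<^sup>+t. (indicator {a..b} t)\<^sup>2 \<partial>lborel) * (\<integral>\<^sup>+t. (indicator {a..b} t * ennreal (norm (F t x)))\<^sup>2 \<partial>lborel)"
      by (rule Cauchy_Schwarz_nn_integral) measurable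
    also have "(\<integral>\<^sup>+t. (indicator {a..b} t)\<^sup>2 \<partial>lborel) = (\<integral>\<^sup>+t. indicator {a..b} t \<partial>lborel)"
      by (intro nn_integral_cong) (auto split: split_indicator)
    also have "\<dots> = ennreal (b - a)" using ab by simp
    also have "(\<integral>\<^sup>+t. (indicator {a..b} t * ennreal (norm (F t x)))\<^sup>2 \<partial>lborel) = (\<integral>\<^sup>+t. indicator {a..b} t * ennreal ((norm (F t x))\<^sup>2) \<partial>lborel)"
      by (intro nn_integral_cong) (auto simp: ennreal_power split: split_indicator)
    finally show ?thesis .
  qed
  note pt = this
  let ?K = "\<integral>\<^sup>+x. (\<integral>\<^sup>+t. indicator {a..b} t * ennreal ((norm (F t x))\<^sup>2) \<partial>lborel) \<partial>lborel"
  from pt have "energy (\<lambda>x. LINT t|lborel. indicator {a..b} t *\<^sub>R F t x) \<le> 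
    (\<integral>\<^sup>+x. ennreal (b - a) * (\<integral>\<^sup>+t. indicator {a..b} t * ennreal ((norm (F t x))\<^sup>2) \<partial>lborel) \<partial>lborel)"
    unfolding energy_def by (intro nn_integral_mono)
  also have "\<dots> = ennreal (b - a) * (\<integral>\<^sup>+x. (\<integral>\<^sup>+t. indicator {a..b} t * ennreal ((norm (F t x))\<^sup>2) \<partial>lborel) \<partial>lborel)"
    by (rule nn_integral_cmult) measurable
  finally have le1: "energy (\<lambda>x. LINT t|lborel. indicator {a..b} t *\<^sub>R F t x) \<le> ennreal (b - a) * ?K" .
  have K: "?K \<le> c * ennreal (b - a)"
  proof -
  have "(\<integral>\<^sup>+x. (\<integral>\<^sup>+t. indicator {a..b} t * ennreal ((norm (F t x))\<^sup>2) \<partial>lborel) \<partial>lborel) = 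
     (\<integral>\<^sup>+t. (\<integral>\<^sup>+x. indicator {a..b} t * ennreal ((norm (F t x))\<^sup>2) \<partial>lborel) \<partial>lborel)"
    by (rule lborel_pair.Fubini'[symmetric]) measurable
  also have "\<dots> = (\<integral>\<^sup>+t. indicator {a..b} t * energy (F t) \<partial>lborel)"
    unfolding energy_def by (intro nn_integral_cong nn_integral_cmult) measurable
  also have "\<dots> \<le> (\<integral>\<^sup>+t. c * indicator {a..b} t \<partial>lborel)"
    by (intro nn_integral_mono) (auto simp: le split: split_indicator)
  also have "\<dots> = c * ennreal (b - a)" using ab by (simp add: nn_integral_cmult_indicator)
  finally show ?thesis .
  qed
  have "ennreal (b - a) * ?K \<le> ennreal (b - a) * (c * ennreal (b - a))"
    using K by (rule mult_left_mono) simp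
  also have "\<dots> = ennreal ((b - a)\<^sup>2) * c"
    using ab by (simp add: power2_eq_square ennreal_mult mult_ac)
  finally show ?thesis using le1 by (rule order_trans[rotated])
qed

text \<open>
  The operator \<open>1 - c d\<^sup>2/ds\<^sup>2\<close> is bounded below by \<open>1\<close>, because \<open>\<integral> q \<bullet> q'' = - \<integral> |q'|\<^sup>2 \<le> 0\<close>.
\<close>

lemma nn_integral_le_second_difference:
  fixes q q' q'' :: "real \<Rightarrow> complex"
  assumes d1: "\<And>s. (q has_vector_derivative q' s) (at s)" and d2: "\<And>s. (q' has_vector_derivative q'' s) (at s)"
    and c2: "continuous_on UNIV q''" and supp: "\<And>s. s \<notin> {a..b} \<Longrightarrow> q s = 0" and c: "c \<ge> 0"
  shows "(\<integral>\<^sup>+s. ennreal ((norm (q s))\<^sup>2) \<partial>lborel) \<le> (\<integral>\<^sup>+s. ennreal ((norm (q s - c *\<^sub>R q'' s))\<^sup>2) \<partial>lborel)"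
proof -
  have c0: "continuous_on UNIV q" "continuous_on UNIV q'"
    using d1 d2 by (auto intro!: continuous_at_imp_continuous_on has_vector_derivative_continuous)
  have supp1: "q' s = 0" if "s \<notin> {a..b}" for s
  proof -
    have "(q has_vector_derivative 0) (at s)"
      by (rule has_vector_derivative_transform_within_open[where f = "\<lambda>_. 0" and S = "- {a..b}"])
         (use that supp in auto)
    then show ?thesis using d1 vector_derivative_unique_at by blast
  qed
  have supp2: "q'' s = 0" if "s \<notin> {a..b}" for s
  proof -
    have "(q' has_vector_derivative 0) (at s)"
      by (rule has_vector_derivative_transform_within_open[where f = "\<lambda>_. 0" and S = "- {a..b}"])
         (use that supp1 in auto)
    then show ?thesis using d2 vector_derivative_unique_at by blast
  qed
  have int: "integrable lborel h" if "continuous_on UNIV h" "\<And>s. s \<notin> {a..b} \<Longrightarrow> h s = 0" for h :: "real \<Rightarrow> real"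
  proof -
    have "integrable lborel (\<lambda>s. indicator {a..b} s *\<^sub>R h s)"
      by (rule borel_integrable_compact) (auto intro: continuous_on_subset[OF that(1)])
    also have "(\<lambda>s. indicator {a..b} s *\<^sub>R h s) = h" using that(2) by (auto simp: fun_eq_iff split: split_indicator)
    finally show ?thesis .
  qed
  have i1: "integrable lborel (\<lambda>s. q s \<bullet> q' s)" "integrable lborel (\<lambda>s. q s \<bullet> q'' s)"
    "integrable lborel (\<lambda>s. (norm (q' s))\<^sup>2)" "integrable lborel (\<lambda>s. (norm (q s))\<^sup>2)"
    "integrable lborel (\<lambda>s. (norm (q s - c *\<^sub>R q'' s))\<^sup>2)"
    by (intro int; auto intro!: continuous_intros c0 c2 simp: supp supp1 supp2)+
  have "(LINT s|lborel. q s \<bullet> q'' s + (norm (q' s))\<^sup>2) = 0"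
  proof (rule integral_directional_derivative_zero[where H = "\<lambda>s. q s \<bullet> q' s" and u = 1])
    show "((\<lambda>t. q (x + t *\<^sub>R 1) \<bullet> q' (x + t *\<^sub>R 1)) has_vector_derivative
            q (x + t *\<^sub>R 1) \<bullet> q'' (x + t *\<^sub>R 1) + (norm (q' (x + t *\<^sub>R 1)))\<^sup>2) (at t)" for x t
    proof -
      have shift: "((\<lambda>t. x + t) has_vector_derivative 1) (at t)" by (auto intro!: derivative_eq_intros)
      have q: "((\<lambda>t. q (x + t)) has_vector_derivative q' (x + t)) (at t)"
        "((\<lambda>t. q' (x + t)) has_vector_derivative q'' (x + t)) (at t)"
        using vector_diff_chain_at[OF shift d1] vector_diff_chain_at[OF shift d2] by (simp_all add: o_def)
      show ?thesis
        using bounded_bilinear.has_vector_derivative[OF bounded_bilinear_inner q]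
        by (simp add: power2_norm_eq_inner)
    qed
    show "continuous_on UNIV (\<lambda>t. q (x + t *\<^sub>R 1) \<bullet> q'' (x + t *\<^sub>R 1) + (norm (q' (x + t *\<^sub>R 1)))\<^sup>2)" for x
      by (intro continuous_intros continuous_on_compose2[OF c0(1)] continuous_on_compose2[OF c0(2)] continuous_on_compose2[OF c2]) auto
  qed (use i1 in auto)
  then have neg: "(LINT s|lborel. q s \<bullet> q'' s) \<le> 0"
    using i1 Bochner_Integration.integral_nonneg[of lborel "\<lambda>s. (norm (q' s))\<^sup>2"]
    by (simp add: eq_neg_iff_add_eq_0[symmetric])
  have "(LINT s|lborel. (norm (q s))\<^sup>2) \<le> (LINT s|lborel. (norm (q s))\<^sup>2) - 2 * c * (LINT s|lborel. q s \<bullet> q'' s)"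
    using neg c by (simp add: mult_nonneg_nonpos)
  also have "\<dots> = (LINT s|lborel. (norm (q s))\<^sup>2 - 2 * c * (q s \<bullet> q'' s))" using i1 by simp
  also have "\<dots> \<le> (LINT s|lborel. (norm (q s - c *\<^sub>R q'' s))\<^sup>2)"
  proof (rule integral_mono)
    fix s show "(norm (q s))\<^sup>2 - 2 * c * (q s \<bullet> q'' s) \<le> (norm (q s - c *\<^sub>R q'' s))\<^sup>2"
      unfolding power2_norm_eq_inner using c by (simp add: algebra_simps inner_commute)
  qed (use i1 in auto)
  finally show ?thesis using i1 by (simp add: nn_integral_eq_integral ennreal_leI)
qed

section \<open>Gaussian integrals\<close>

abbreviation gauss_weight :: "real \<Rightarrow> 'a::real_normed_vector \<Rightarrow> real" where
  "gauss_weight a x \<equiv> exp (- (a * (norm x)\<^sup>2 / 2))"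

lemma nn_integral_gaussian_real:
  assumes a: "a > (0::real)"
  shows "(\<integral>\<^sup>+y. ennreal (exp (- (a * y\<^sup>2 / 2))) \<partial>lborel) = ennreal (sqrt (2 * pi / a))"
proof -
  have s: "1 / sqrt a > 0" using a by simp
  have "exp (- (a * y\<^sup>2 / 2)) = sqrt (2 * pi / a) * normal_density 0 (1 / sqrt a) y" for y
    using a by (simp add: normal_density_def real_sqrt_divide real_sqrt_mult power_divide field_simps)
  then have "(\<integral>\<^sup>+y. ennreal (exp (- (a * y\<^sup>2 / 2))) \<partial>lborel) = ennreal (sqrt (2 * pi / a)) * (\<integral>\<^sup>+y. ennreal (normal_density 0 (1 / sqrt a) y) \<partial>lborel)"
    using a by (simp add: ennreal_mult nn_integral_cmult)
  also have "(\<integral>\<^sup>+y. ennreal (normal_density 0 (1 / sqrt a) y) \<partial>lborel) = 1"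
    using s by (subst nn_integral_eq_integral) auto
  finally show ?thesis by simp
qed

lemma nn_integral_gaussian:
  assumes a: "a > (0::real)"
  shows "(\<integral>\<^sup>+x. ennreal (gauss_weight a (x::'a::euclidean_space)) \<partial>lborel) = ennreal (sqrt (2 * pi / a) ^ DIM('a))"
proof -
  have "gauss_weight a x = (\<Prod>b\<in>Basis. exp (- (a * (x \<bullet> b)\<^sup>2 / 2)))" for x :: 'a
    unfolding power2_norm_eq_inner
    by (subst euclidean_inner) (simp add: exp_sum[symmetric] sum_distrib_left sum_divide_distrib sum_negf power2_eq_square)
  then have "(\<integral>\<^sup>+x. ennreal (gauss_weight a (x::'a)) \<partial>lborel) = (\<integral>\<^sup>+x. (\<Prod>b\<in>Basis. ennreal (exp (- (a * ((x::'a) \<bullet> b)\<^sup>2 / 2)))) \<partial>lborel)"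
    by (simp add: prod_ennreal)
  also have "\<dots> = ennreal (sqrt (2 * pi / a) ^ DIM('a))"
    using a by (subst nn_integral_lborel_prod) (simp_all add: nn_integral_gaussian_real prod_ennreal ennreal_power)
  finally show ?thesis .
qed

text \<open>
  Half of the Gaussian decay absorbs the quadratic factor.
\<close>

lemma integrable_gaussian_bound:
  fixes f :: "'a::euclidean_space \<Rightarrow> 'b::{banach, second_countable_topology}"
  assumes [measurable]: "f \<in> borel_measurable borel" and a: "a > 0"
    and le: "\<And>x. norm (f x) \<le> C * (1 + (norm x)\<^sup>2) * gauss_weight a x"
  shows "integrable lborel f"
proof -
  have int: "integrable lborel (\<lambda>x::'a. gauss_weight b x)" if "b > 0" for b :: real
    using nn_integral_gaussian[OF that, where 'a = 'a] by (intro integrableI_bounded) auto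
  have "integrable lborel (\<lambda>x::'a. \<bar>C\<bar> * (1 + 4 / a) * gauss_weight (a/2) x)"
    using a by (intro integrable_mult_right int) auto
  then show ?thesis
  proof (rule Bochner_Integration.integrable_bound)
    show "AE x in lborel. norm (f x) \<le> norm (\<bar>C\<bar> * (1 + 4 / a) * gauss_weight (a/2) x)"
    proof (rule AE_I2)
      fix x :: 'a
      let ?u = "(a/2) * (norm x)\<^sup>2 / 2"
      have u: "?u \<ge> 0" using a by simp
      have "(norm x)\<^sup>2 = (4/a) * ?u" using a by simp
      also have "\<dots> \<le> (4/a) * exp ?u" using a exp_ge_add_one_self[of ?u] by (intro mult_left_mono, linarith) auto
      finally have "1 + (norm x)\<^sup>2 \<le> exp ?u + (4/a) * exp ?u" using u by (intro add_mono) auto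
      then have "(1 + (norm x)\<^sup>2) * gauss_weight a x \<le> ((1 + 4/a) * exp ?u) * gauss_weight a x"
        by (intro mult_right_mono) (auto simp: algebra_simps)
      also have "\<dots> = (1 + 4/a) * exp (- ?u)"
        by (simp add: mult.assoc mult_exp_exp) 
      finally have *: "(1 + (norm x)\<^sup>2) * gauss_weight a x \<le> (1 + 4/a) * exp (- ?u)" .
      have "norm (f x) \<le> \<bar>C\<bar> * ((1 + (norm x)\<^sup>2) * gauss_weight a x)"
        using le[of x] by (rule order_trans) (simp add: mult.assoc mult_right_mono)
      also have "\<dots> \<le> \<bar>C\<bar> * ((1 + 4/a) * exp (- ?u))" using * by (intro mult_left_mono) auto
      finally show "norm (f x) \<le> norm (\<bar>C\<bar> * (1 + 4 / a) * exp (- ?u))" using a by (simp add: abs_mult mult.assoc)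
    qed
  qed simp
qed

lemma norm_le_one_plus_power2: "(x::real) \<le> 1 + x\<^sup>2"
  using zero_le_power2[of "x - 1/2"] by (simp add: power2_eq_square algebra_simps)

lemma constant_if_derivative_zero:
  fixes f :: "real \<Rightarrow> 'a::real_normed_vector"
  assumes "\<And>t. (f has_vector_derivative 0) (at t)" shows "f a = f b"
proof -
  obtain c where "\<And>x. x \<in> UNIV \<Longrightarrow> f x = c"
    by (rule has_vector_derivative_zero_constant[of UNIV f]) (use assms in auto)
  then show ?thesis by auto
qed

lemma has_vector_derivative_exp:
  fixes f :: "real \<Rightarrow> complex"
  assumes "(f has_vector_derivative f') (at t)"
  shows "((\<lambda>t. exp (f t)) has_vector_derivative f' * exp (f t)) (at t)"
  using field_vector_diff_chain_at[OF assms DERIV_exp] by (simp add: o_def)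

lemma has_vector_derivative_complex_of_real:
  assumes "(f has_real_derivative f') (at t)"
  shows "((\<lambda>t. complex_of_real (f t)) has_vector_derivative complex_of_real f') (at t)"
  using has_vector_derivative_of_real[of f f' "at t"] assms
  by (simp add: has_real_derivative_iff_has_vector_derivative)

text \<open>
  Integration by parts in the direction \<open>b\<close>, applied to \<open>(x \<bullet> b) exp (- c |x|\<^sup>2 / 2)\<close>.
\<close>

lemma integral_gaussian_moment:
  fixes b :: "'a::euclidean_space" and c :: complex
  assumes c: "Re c > 0" and b: "b \<in> Basis"
  shows "c * (LINT x|lborel. complex_of_real ((x \<bullet> b)\<^sup>2) * exp (- (c * complex_of_real ((norm x)\<^sup>2) / 2)))
    = (LINT x::'a|lborel. exp (- (c * complex_of_real ((norm x)\<^sup>2) / 2)))"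
proof -
  let ?E = "\<lambda>x::'a. exp (- (c * complex_of_real ((norm x)\<^sup>2) / 2))"
  have nE: "norm (?E x) = gauss_weight (Re c) x" for x by simp
  have bx: "\<bar>x \<bullet> b\<bar> \<le> norm x" for x using Basis_le_norm[OF b] .
  have i0: "integrable lborel ?E"
    by (rule integrable_gaussian_bound[where a = "Re c" and C = 1]) (auto simp: nE c mult_le_cancel_right1)
  have i1: "integrable lborel (\<lambda>x. complex_of_real (x \<bullet> b) * ?E x)"
  proof (rule integrable_gaussian_bound[where a = "Re c" and C = 1])
    fix x
    have "\<bar>x \<bullet> b\<bar> \<le> 1 + (norm x)\<^sup>2" using bx[of x] norm_le_one_plus_power2[of "norm x"] by linarith
    then show "norm (complex_of_real (x \<bullet> b) * ?E x) \<le> 1 * (1 + (norm x)\<^sup>2) * gauss_weight (Re c) x"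
      unfolding norm_mult nE by (simp add: mult_right_mono norm_power)
  qed (use c in auto)
  have i2: "integrable lborel (\<lambda>x. complex_of_real ((x \<bullet> b)\<^sup>2) * ?E x)"
  proof (rule integrable_gaussian_bound[where a = "Re c" and C = 1])
    fix x
    have "(x \<bullet> b)\<^sup>2 \<le> 1 + (norm x)\<^sup>2" using power_mono[OF bx[of x], of 2] by simp
    then show "norm (complex_of_real ((x \<bullet> b)\<^sup>2) * ?E x) \<le> 1 * (1 + (norm x)\<^sup>2) * gauss_weight (Re c) x"
      unfolding norm_mult nE by (simp add: mult_right_mono norm_power)
  qed (use c in auto)
  have "(LINT x|lborel. ?E x - c * (complex_of_real ((x \<bullet> b)\<^sup>2) * ?E x)) = 0"
  proof (rule integral_directional_derivative_zero[where u = b and H = "\<lambda>x. complex_of_real (x \<bullet> b) * ?E x"])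
    fix x t
    have n: "((norm (x + t *\<^sub>R b))\<^sup>2) = (norm x)\<^sup>2 + 2 * t * (x \<bullet> b) + t\<^sup>2" for t
      unfolding power2_norm_eq_inner using b by (simp add: algebra_simps inner_commute power2_eq_square)
    have ip: "(x + t *\<^sub>R b) \<bullet> b = x \<bullet> b + t" for t using b by (simp add: inner_add_left)
    show "((\<lambda>t. complex_of_real ((x + t *\<^sub>R b) \<bullet> b) * ?E (x + t *\<^sub>R b)) has_vector_derivative
      ?E (x + t *\<^sub>R b) - c * (complex_of_real (((x + t *\<^sub>R b) \<bullet> b)\<^sup>2) * ?E (x + t *\<^sub>R b))) (at t)"
      unfolding n ip
      by (rule has_vector_derivative_eq_rhs,
          (rule has_vector_derivative_mult has_vector_derivative_exp has_vector_derivative_complex_of_real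
            has_vector_derivative_minus has_vector_derivative_divide has_vector_derivative_mult_right
           | (rule derivative_eq_intros refl)+)+)
         (simp add: algebra_simps power2_eq_square)
    show "continuous_on UNIV (\<lambda>t. ?E (x + t *\<^sub>R b) - c * (complex_of_real (((x + t *\<^sub>R b) \<bullet> b)\<^sup>2) * ?E (x + t *\<^sub>R b)))"
      by (intro continuous_intros) auto
  qed (use i0 i1 i2 in auto)
  then show ?thesis using i0 i2 by simp
qed


text \<open>
  Along the segment \<open>k\<close> from \<open>Re c\<close> to \<open>c\<close> the second moments show that \<open>k\<^sup>m\<close> times the integral is
  constant, so the formula for real \<open>c\<close> extends to the half plane. The dimension is even, so no
  branch of the square root has to be chosen.
\<close>

theorem integral_gaussian_complex:
  fixes c :: complex
  assumes c: "Re c > 0" and m: "DIM('a::euclidean_space) = 2 * m"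
  shows "(LINT x::'a|lborel. exp (- (c * complex_of_real ((norm x)\<^sup>2) / 2))) = (2 * pi / c) ^ m"
proof -
  define p q where "p = Re c" and "q = Im c"
  have p: "p > 0" using c by (simp add: p_def)
  define k where "k t = complex_of_real p + \<i> * of_real (t * q)" for t
  have Rek: "Re (k t) = p" for t by (simp add: k_def)
  have k0: "k t \<noteq> 0" for t using Rek[of t] p by auto
  have k1: "k 1 = c" by (simp add: k_def p_def q_def complex_eq[symmetric])
  define E where "E t = (\<lambda>x::'a. exp (- (k t * complex_of_real ((norm x)\<^sup>2) / 2)))" for t
  define K where "K t = (LINT x|lborel. E t x)" for t
  have nE: "norm (E t x) = gauss_weight p x" for x t by (simp add: E_def Rek)
  have [measurable]: "E t \<in> borel_measurable borel" for t unfolding E_def by measurable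
  have intE: "integrable lborel (E t)" for t
    by (rule integrable_gaussian_bound[where a = p and C = 1]) (auto simp: nE p mult_le_cancel_right1)
  have intE2: "integrable lborel (\<lambda>x. complex_of_real ((x \<bullet> b)\<^sup>2) * E t x)" if b: "b \<in> Basis" for t b
  proof (rule integrable_gaussian_bound[where a = p and C = 1])
    fix x :: 'a
    have "(x \<bullet> b)\<^sup>2 \<le> 1 + (norm x)\<^sup>2" using power_mono[OF Basis_le_norm[OF b, of x], of 2] by simp
    then show "norm (complex_of_real ((x \<bullet> b)\<^sup>2) * E t x) \<le> 1 * (1 + (norm x)\<^sup>2) * gauss_weight p x"
      unfolding norm_mult nE by (simp add: mult_right_mono norm_power)
  qed (use p in auto)
  have dK: "(K has_vector_derivative (- (\<i> * q * m / k t) * K t)) (at t)" for t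
  proof -
    have "(K has_vector_derivative (LINT x|lborel. - (\<i> * q / 2) * of_real ((norm x)\<^sup>2) * E t x)) (at t)"
      unfolding K_def
    proof (rule has_vector_derivative_integral[where a = "t - 1" and b = "t + 1"])
      show "((\<lambda>t. E t x) has_vector_derivative - (\<i> * q / 2) * of_real ((norm x)\<^sup>2) * E t x) (at t)" for t x
        unfolding E_def k_def
        by (rule has_vector_derivative_eq_rhs, rule has_vector_derivative_exp)
           (auto intro!: derivative_eq_intros has_vector_derivative_complex_of_real simp: algebra_simps)
      show "norm (- (\<i> * q / 2) * of_real ((norm x)\<^sup>2) * E t x) \<le> \<bar>q\<bar> * ((norm x)\<^sup>2 * gauss_weight p x)" for t x
        by (simp add: norm_mult nE norm_power)
      show "integrable lborel (\<lambda>x::'a. \<bar>q\<bar> * ((norm x)\<^sup>2 * gauss_weight p x))"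
        by (intro integrable_mult_right integrable_gaussian_bound[where a = p and C = 1]) (auto simp: p mult_right_mono)
    qed (auto simp: intE)
    also have "(LINT x|lborel. - (\<i> * q / 2) * of_real ((norm x)\<^sup>2) * E t x)
        = (LINT x|lborel. - (\<i> * q / 2) * (\<Sum>b\<in>Basis. complex_of_real ((x \<bullet> b)\<^sup>2) * E t x))"
    proof (rule Bochner_Integration.integral_cong)
      fix x :: 'a
      have "(norm x)\<^sup>2 = (\<Sum>b\<in>Basis. (x \<bullet> b)\<^sup>2)"
        unfolding power2_norm_eq_inner by (subst euclidean_inner) (simp add: power2_eq_square)
      then show "- (\<i> * q / 2) * of_real ((norm x)\<^sup>2) * E t x = - (\<i> * q / 2) * (\<Sum>b\<in>Basis. complex_of_real ((x \<bullet> b)\<^sup>2) * E t x)"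
        by (simp only: of_real_sum sum_distrib_right mult.assoc)
    qed simp
    also have "\<dots> = - (\<i> * q / 2) * (\<Sum>b\<in>Basis. LINT x|lborel. complex_of_real ((x \<bullet> b)\<^sup>2) * E t x)"
      by (subst integral_mult_right_zero, subst Bochner_Integration.integral_sum) (rule intE2, assumption, rule refl)
    also have "(\<Sum>b\<in>Basis. LINT x|lborel. complex_of_real ((x \<bullet> b)\<^sup>2) * E t x) = (\<Sum>b\<in>(Basis::'a set). K t / k t)"
      using integral_gaussian_moment[where 'a = 'a, of "k t"] k0 p
      by (intro sum.cong) (auto simp: E_def K_def Rek field_simps)
    also have "- (\<i> * q / 2) * (\<Sum>b\<in>(Basis::'a set). K t / k t) = - (\<i> * q * m / k t) * K t"
      by (simp add: m)
    finally show ?thesis .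
  qed
  have dk: "(k has_vector_derivative \<i> * q) (at t)" for t
    unfolding k_def by (auto intro!: derivative_eq_intros has_vector_derivative_complex_of_real)
  have "((\<lambda>t. k t ^ m * K t) has_vector_derivative 0) (at t)" for t
  proof -
    have dp: "((\<lambda>z::complex. z ^ m) has_field_derivative of_nat m * z ^ (m - 1)) (at z)" for z
      by (auto intro!: derivative_eq_intros)
    have "((\<lambda>t. k t ^ m) has_vector_derivative (\<i> * q) * (of_nat m * k t ^ (m - 1))) (at t)"
      using field_vector_diff_chain_at[OF dk dp] by (simp add: o_def)
    from has_vector_derivative_mult[OF this dK]
    show ?thesis
      by (rule has_vector_derivative_eq_rhs) (cases m, auto simp: k0 field_simps)
  qed
  then have "k 1 ^ m * K 1 = k 0 ^ m * K 0" by (rule constant_if_derivative_zero)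
  also have "K 0 = of_real (LINT x::'a|lborel. gauss_weight p x)"
    unfolding K_def E_def k_def integral_complex_of_real[symmetric]
    by (rule Bochner_Integration.integral_cong) (simp_all flip: exp_of_real)
  also have "(LINT x::'a|lborel. gauss_weight p x) = sqrt (2 * pi / p) ^ (2 * m)"
    using nn_integral_gaussian[OF p, where 'a = 'a] p by (subst integral_eq_nn_integral) (auto simp: m)
  also have "\<dots> = (2 * pi / p) ^ m" using p by (simp add: power_mult)
  also have "k 0 ^ m * of_real ((2 * pi / p) ^ m) = (2 * pi) ^ m"
    using p by (simp add: k_def power_divide)
  finally show ?thesis using k0[of 1] unfolding k1 K_def E_def by (simp add: field_simps power_divide)
qed

text \<open>
  Under a Gaussian weight, functions of the components along orthogonal vectors are independent. As a
  function of \<open>a\<close> the integral satisfies \<open>\<Phi>' = - (a |u|\<^sup>2 / \<delta>) \<Phi>\<close>: differentiation brings down a factor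
  \<open>z \<bullet> u\<close>, which integration by parts in the direction \<open>u\<close> removes without touching \<open>F (z \<bullet> v)\<close>.
\<close>

theorem integral_gaussian_character_orthogonal:
  fixes u v :: "'a::euclidean_space" and F :: "real \<Rightarrow> complex"
  assumes \<delta>: "\<delta> > 0" and orth: "u \<bullet> v = 0" and [measurable]: "F \<in> borel_measurable borel"
    and F: "\<And>x. norm (F x) \<le> B"
  shows "(LINT z|lborel. gauss_weight \<delta> z *\<^sub>R (exp (- (\<i> * of_real (a * (z \<bullet> u)))) * F (z \<bullet> v)))
    = exp (- (a\<^sup>2 * (norm u)\<^sup>2 / (2 * \<delta>))) *\<^sub>R (LINT z|lborel. gauss_weight \<delta> z *\<^sub>R F (z \<bullet> v))"
proof -
  have B: "B \<ge> 0" using F[of 0] norm_ge_zero order_trans by blast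
  define H where "H a z = gauss_weight \<delta> z *\<^sub>R (exp (- (\<i> * of_real (a * (z \<bullet> u)))) * F (z \<bullet> v))" for a z
  have nH: "norm (H a z) \<le> B * gauss_weight \<delta> z" for a z
    using F[of "z \<bullet> v"] by (simp add: H_def norm_mult mult.commute mult_right_mono)
  have [measurable]: "H a \<in> borel_measurable borel" for a unfolding H_def by measurable
  have poly: "\<bar>z \<bullet> u\<bar> \<le> norm u * (1 + (norm z)\<^sup>2)" for z
    using Cauchy_Schwarz_ineq2[of z u] mult_right_mono[OF norm_le_one_plus_power2[of "norm z"], of "norm u"] by (simp add: mult.commute)
  have i0: "integrable lborel (H a)" for a
  proof (rule integrable_gaussian_bound[where a = \<delta> and C = B])
    show "norm (H a z) \<le> B * (1 + (norm z)\<^sup>2) * gauss_weight \<delta> z" for z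
      by (rule order_trans[OF nH]) (use B in \<open>auto intro!: mult_right_mono simp: mult_le_cancel_left1\<close>)
  qed (use \<delta> in auto)
  have nH1: "norm (of_real (z \<bullet> u) * H a z) \<le> (norm u * B) * (1 + (norm z)\<^sup>2) * gauss_weight \<delta> z" for a z
  proof -
    have "norm (of_real (z \<bullet> u) * H a z) \<le> (norm u * (1 + (norm z)\<^sup>2)) * (B * gauss_weight \<delta> z)"
      unfolding norm_mult norm_of_real by (intro mult_mono poly nH) auto
    then show ?thesis by (simp add: mult_ac)
  qed
  have i1: "integrable lborel (\<lambda>z. of_real (z \<bullet> u) * H a z)" for a
    by (rule integrable_gaussian_bound[OF _ \<delta> nH1]) measurable
  have ibp: "\<delta> * (LINT z|lborel. of_real (z \<bullet> u) * H a z) = - (\<i> * of_real (a * (norm u)\<^sup>2)) * (LINT z|lborel. H a z)" for a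
  proof -
    have "(LINT z|lborel. - (\<delta> * (of_real (z \<bullet> u) * H a z)) - (\<i> * of_real (a * (norm u)\<^sup>2)) * H a z) = 0"
    proof (rule integral_directional_derivative_zero[where u = u and H = "H a"])
      fix z t
      have n: "((norm (z + t *\<^sub>R u))\<^sup>2) = (norm z)\<^sup>2 + 2 * t * (z \<bullet> u) + t\<^sup>2 * (norm u)\<^sup>2" for t
        unfolding power2_norm_eq_inner by (simp add: algebra_simps inner_commute power2_eq_square)
      have ip: "(z + t *\<^sub>R u) \<bullet> v = z \<bullet> v" "(z + t *\<^sub>R u) \<bullet> u = z \<bullet> u + t * (norm u)\<^sup>2" for t 
        using orth by (simp_all add: inner_add_left power2_norm_eq_inner)
      have H_eq: "H a (z + t *\<^sub>R u) = exp (of_real (- (\<delta> * ((norm z)\<^sup>2 + 2 * t * (z \<bullet> u) + t\<^sup>2 * (norm u)\<^sup>2) / 2)) - \<i> * of_real (a * (z \<bullet> u + t * (norm u)\<^sup>2))) * F (z \<bullet> v)" for t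
        unfolding H_def n ip scaleR_conv_of_real exp_of_real[symmetric] mult.assoc[symmetric] mult_exp_exp by simp
      show "((\<lambda>t. H a (z + t *\<^sub>R u)) has_vector_derivative
         - (\<delta> * (of_real ((z + t *\<^sub>R u) \<bullet> u) * H a (z + t *\<^sub>R u))) - (\<i> * of_real (a * (norm u)\<^sup>2)) * H a (z + t *\<^sub>R u)) (at t)"
      proof -
        have "((\<lambda>t. - (\<delta> * ((norm z)\<^sup>2 + 2 * t * (z \<bullet> u) + t\<^sup>2 * (norm u)\<^sup>2) / 2)) has_real_derivative - \<delta> * (z \<bullet> u + t * (norm u)\<^sup>2)) (at t)"
          "((\<lambda>t. a * (z \<bullet> u + t * (norm u)\<^sup>2)) has_real_derivative a * (norm u)\<^sup>2) (at t)"
          by (auto intro!: derivative_eq_intros simp: algebra_simps)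
        note d = this[THEN has_vector_derivative_complex_of_real]
        show ?thesis
          unfolding H_eq ip
          by (rule has_vector_derivative_eq_rhs[OF has_vector_derivative_mult_left[OF has_vector_derivative_exp[OF
                has_vector_derivative_diff[OF d(1) has_vector_derivative_mult_right[OF d(2)]]]]])
             (simp add: algebra_simps)
      qed
      show "continuous_on UNIV (\<lambda>t. - (\<delta> * (of_real ((z + t *\<^sub>R u) \<bullet> u) * H a (z + t *\<^sub>R u))) - (\<i> * of_real (a * (norm u)\<^sup>2)) * H a (z + t *\<^sub>R u))"
        unfolding H_eq by (intro continuous_intros) auto
    qed (use i0 i1 in auto)
    then have "- (\<delta> * (LINT z|lborel. of_real (z \<bullet> u) * H a z)) - (\<i> * of_real (a * (norm u)\<^sup>2)) * (LINT z|lborel. H a z) = 0"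
      using i0 i1 by simp
    moreover have "X = - Y" if "- X - Y = 0" for X Y :: complex using that by algebra
    ultimately show ?thesis by (simp only: mult_minus_left)
  qed
  define \<Phi> where "\<Phi> a = (LINT z|lborel. H a z)" for a
  have d\<Phi>: "(\<Phi> has_vector_derivative (- of_real (a * (norm u)\<^sup>2 / \<delta>)) * \<Phi> a) (at a)" for a
  proof -
    have "(\<Phi> has_vector_derivative (LINT z|lborel. - \<i> * (of_real (z \<bullet> u) * H a z))) (at a)"
      unfolding \<Phi>_def
    proof (rule has_vector_derivative_integral[where a = "a - 1" and b = "a + 1"])
      show "((\<lambda>a. H a z) has_vector_derivative - \<i> * (of_real (z \<bullet> u) * H a z)) (at a)" for a z
      proof -
        have "((\<lambda>a. a * (z \<bullet> u)) has_real_derivative (z \<bullet> u)) (at a)" by (auto intro!: derivative_eq_intros)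
        note d = has_vector_derivative_mult_left[OF has_vector_derivative_exp[OF has_vector_derivative_minus[OF
              has_vector_derivative_mult_right[OF has_vector_derivative_complex_of_real[OF this]]]]]
        show ?thesis
          unfolding H_def
          by (rule has_vector_derivative_eq_rhs[OF bounded_linear.has_vector_derivative[OF bounded_linear_scaleR_right d]])
             (simp add: scaleR_conv_of_real algebra_simps)
      qed
      show "norm (- \<i> * (of_real (z \<bullet> u) * H a z)) \<le> (norm u * B) * (1 + (norm z)\<^sup>2) * gauss_weight \<delta> z" for a z
        using nH1[of z a] by (simp add: norm_mult)
      show "integrable lborel (\<lambda>z::'a. (norm u * B) * (1 + (norm z)\<^sup>2) * gauss_weight \<delta> z)"
        by (rule integrable_gaussian_bound[where a = \<delta> and C = "norm u * B"]) (use \<delta> B in auto)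
    qed (auto simp: i0)
    also have "(LINT z|lborel. - \<i> * (of_real (z \<bullet> u) * H a z)) = - \<i> * (LINT z|lborel. of_real (z \<bullet> u) * H a z)"
      by (rule integral_mult_right_zero)
    also have "(LINT z|lborel. of_real (z \<bullet> u) * H a z) = - (\<i> * of_real (a * (norm u)\<^sup>2)) * \<Phi> a / \<delta>"
      using ibp[of a] \<delta> by (simp add: \<Phi>_def field_simps)
    also have "- \<i> * \<dots> = (- of_real (a * (norm u)\<^sup>2 / \<delta>)) * \<Phi> a" by (simp add: algebra_simps)
    finally show ?thesis .
  qed
  have "((\<lambda>a. exp (of_real (a\<^sup>2 * (norm u)\<^sup>2 / (2 * \<delta>))) * \<Phi> a) has_vector_derivative 0) (at a)" for a
    using \<delta> by (intro has_vector_derivative_eq_rhs[OF has_vector_derivative_mult[OF has_vector_derivative_exp[OF has_vector_derivative_complex_of_real] d\<Phi>]])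
      (auto intro!: derivative_eq_intros simp: field_simps)
  then have "exp (of_real (a\<^sup>2 * (norm u)\<^sup>2 / (2 * \<delta>))) * \<Phi> a = exp (of_real (0\<^sup>2 * (norm u)\<^sup>2 / (2 * \<delta>))) * \<Phi> 0"
    by (rule constant_if_derivative_zero)
  then have "\<Phi> a = exp (- (a\<^sup>2 * (norm u)\<^sup>2 / (2 * \<delta>))) *\<^sub>R \<Phi> 0"
    by (simp add: exp_minus scaleR_conv_of_real field_simps flip: exp_of_real)
  then show ?thesis by (simp add: \<Phi>_def H_def)
qed

section \<open>Continuous functions with compact support\<close>

definition compactly_supported :: "('a::real_normed_vector \<Rightarrow> 'b::real_normed_vector) \<Rightarrow> bool" where
  "compactly_supported f \<longleftrightarrow> continuous_on UNIV f \<and> (\<exists>R. \<forall>x. f x \<noteq> 0 \<longrightarrow> norm x \<le> R)"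

lemma compactly_supportedI: "continuous_on UNIV f \<Longrightarrow> (\<And>x. f x \<noteq> 0 \<Longrightarrow> norm x \<le> R) \<Longrightarrow> compactly_supported f"
  by (auto simp: compactly_supported_def)

lemma borel_measurable_compactly_supported [measurable_dest]: "compactly_supported f \<Longrightarrow> f \<in> borel_measurable borel"
  by (auto simp: compactly_supported_def intro: borel_measurable_continuous_onI)

lemma integrable_compactly_supported:
  fixes f :: "'a::euclidean_space \<Rightarrow> 'b::{banach, second_countable_topology}"
  assumes "compactly_supported f" shows "integrable lborel f"
proof -
  obtain R where R: "\<And>x. f x \<noteq> 0 \<Longrightarrow> norm x \<le> R" and c: "continuous_on UNIV f"
    using assms by (auto simp: compactly_supported_def)
  have "integrable lborel (\<lambda>x. indicator (cball 0 R) x *\<^sub>R f x)"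
    by (rule borel_integrable_compact) (auto intro: continuous_on_subset[OF c])
  also have "(\<lambda>x. indicator (cball 0 R) x *\<^sub>R f x) = f"
    using R by (force simp: fun_eq_iff indicator_def)
  finally show ?thesis .
qed

lemma square_integrable_compactly_supported:
  assumes "compactly_supported f" shows "square_integrable f"
proof -
  have "compactly_supported (\<lambda>x. (norm (f x))\<^sup>2)"
    using assms by (auto simp: compactly_supported_def intro!: continuous_intros)
  from integrable_compactly_supported[OF this] show ?thesis
    using assms by (auto simp: square_integrable_def)
qed

lemma nn_integral_lborel_pair:
  fixes f :: "'a::euclidean_space \<times> 'b::euclidean_space \<Rightarrow> ennreal"
  assumes "f \<in> borel_measurable borel"
  shows "(\<integral>\<^sup>+x. f x \<partial>lborel) = (\<integral>\<^sup>+a. \<integral>\<^sup>+b. f (a, b) \<partial>lborel \<partial>lborel)"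
  using assms by (subst lborel_prod[symmetric], subst lborel.nn_integral_fst) (auto simp: lborel_prod)

lemma integral_lborel_pair:
  fixes f :: "'a::euclidean_space \<times> 'b::euclidean_space \<Rightarrow> 'c::{banach, second_countable_topology}"
  assumes "integrable lborel f"
  shows "(LINT x|lborel. f x) = (LINT a|lborel. LINT b|lborel. f (a, b))"
  using assms by (subst lborel_prod[symmetric], subst lborel_pair.integral_fst'[symmetric]) (auto simp: lborel_prod)

section \<open>The symplectic form\<close>

lemma symp_prod_simps:
  "z \<bullet>\<^sub>\<sigma> (a + b) = z \<bullet>\<^sub>\<sigma> a + z \<bullet>\<^sub>\<sigma> b" "z \<bullet>\<^sub>\<sigma> (a - b) = z \<bullet>\<^sub>\<sigma> a - z \<bullet>\<^sub>\<sigma> b"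
  "(a + b) \<bullet>\<^sub>\<sigma> z = a \<bullet>\<^sub>\<sigma> z + b \<bullet>\<^sub>\<sigma> z"
  "z \<bullet>\<^sub>\<sigma> (r *\<^sub>R a) = r * (z \<bullet>\<^sub>\<sigma> a)" "(r *\<^sub>R a) \<bullet>\<^sub>\<sigma> z = r * (a \<bullet>\<^sub>\<sigma> z)" "z \<bullet>\<^sub>\<sigma> z = 0" "z \<bullet>\<^sub>\<sigma> 0 = 0" "0 \<bullet>\<^sub>\<sigma> z = 0"
  by (auto simp: symp_prod_def algebra_simps inner_commute)

text \<open>The complex structure that expresses the symplectic form through the scalar product.\<close>

definition rot :: "'d::finite phase \<Rightarrow> 'd phase" where
  "rot u = (- snd u, fst u)"

lemma symp_prod_eq_inner_rot: "z \<bullet>\<^sub>\<sigma> u = z \<bullet> rot u"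
  by (simp add: symp_prod_def rot_def inner_prod_def inner_commute)

lemma inner_rot_self [simp]: "u \<bullet> rot u = 0"
  by (simp add: rot_def inner_prod_def inner_commute)

lemma rot_rot [simp]: "rot (rot u) = - u"
  by (simp add: rot_def prod_eq_iff)

lemma rot_linear: "rot (a - b) = rot a - rot b" "rot (a + b) = rot a + rot b" "rot (r *\<^sub>R a) = r *\<^sub>R rot a"
  by (simp_all add: rot_def prod_eq_iff)

lemma continuous_on_symp_prod [continuous_intros]:
  "continuous_on S f \<Longrightarrow> continuous_on S g \<Longrightarrow> continuous_on S (\<lambda>x. f x \<bullet>\<^sub>\<sigma> g x)"
  unfolding symp_prod_def by (intro continuous_intros)

lemma DIM_phase: "DIM('d::finite phase) = 2 * CARD('d)" by simp

abbreviation phase_factor :: "'a::euclidean_space \<Rightarrow> complex" where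
  "phase_factor \<zeta> \<equiv> exp (\<i> * complex_of_real ((norm \<zeta>)\<^sup>2 / 2))"

text \<open>
  For \<open>p = 1\<close> this is \<open>(2 \<pi> i)\<^sup>d S(r\<^sup>2) \<eta>\<close>. Linear weights \<open>p\<close> appear when it is differentiated in
  \<open>r\<close> or integrated by parts.
\<close>

definition osc :: "('d::finite phase \<Rightarrow> complex) \<Rightarrow> ('d heis \<Rightarrow> complex) \<Rightarrow> real \<Rightarrow> 'd heis \<Rightarrow> complex" where
  "osc p \<eta> r g = (LINT \<zeta>|lborel. phase_factor \<zeta> * p \<zeta> *
     \<eta> (fst g + r *\<^sub>R \<zeta>, snd g + r * (fst g \<bullet>\<^sub>\<sigma> \<zeta>)))"

abbreviation osc1 :: "('d::finite heis \<Rightarrow> complex) \<Rightarrow> real \<Rightarrow> 'd heis \<Rightarrow> complex" where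
  "osc1 \<equiv> osc (\<lambda>_. 1)"

abbreviation osc_lin :: "'d::finite phase \<Rightarrow> ('d heis \<Rightarrow> complex) \<Rightarrow> real \<Rightarrow> 'd heis \<Rightarrow> complex" where
  "osc_lin e \<equiv> osc (\<lambda>\<zeta>. complex_of_real (\<zeta> \<bullet> e))"

lemma borel_measurable_osc:
  fixes p :: "'d::finite phase \<Rightarrow> complex"
  assumes p: "continuous_on UNIV p" and \<eta>: "continuous_on UNIV \<eta>"
  shows "(\<lambda>(r, g). osc p \<eta> r g) \<in> borel_measurable borel"
proof -
  have "(\<lambda>(x, \<zeta>). phase_factor \<zeta> * p \<zeta> *
     \<eta> (fst (snd x) + fst x *\<^sub>R \<zeta>, snd (snd x) + fst x * (fst (snd x) \<bullet>\<^sub>\<sigma> \<zeta>))) \<in> borel_measurable (borel :: ((real \<times> 'd heis) \<times> 'd phase) measure)"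
    unfolding case_prod_beta
    by (intro borel_measurable_continuous_onI continuous_intros continuous_on_compose2[OF \<eta>] continuous_on_compose2[OF p]) auto
  then have "(\<lambda>(x, \<zeta>). phase_factor \<zeta> * p \<zeta> *
     \<eta> (fst (snd x) + fst x *\<^sub>R \<zeta>, snd (snd x) + fst x * (fst (snd x) \<bullet>\<^sub>\<sigma> \<zeta>))) \<in> borel_measurable (lborel \<Otimes>\<^sub>M (lborel :: 'd phase measure))"
    by (simp add: lborel_prod)
  from lborel.borel_measurable_lebesgue_integral[OF this]
  show ?thesis unfolding osc_def by (simp add: case_prod_beta)
qed

lemma borel_measurable_osc_at:
  assumes "continuous_on UNIV p" "continuous_on UNIV \<eta>"
  shows "osc p \<eta> r \<in> borel_measurable borel"
  using measurable_compose[OF borel_measurable_continuous_onI borel_measurable_osc[OF assms], of "\<lambda>g. (r, g)"]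
  by (simp add: continuous_intros)

section \<open>Contractivity\<close>

lemma borel_measurable_cnj [measurable (raw)]:
  "f \<in> borel_measurable M \<Longrightarrow> (\<lambda>x. cnj (f x)) \<in> borel_measurable M"
  by (rule borel_measurable_continuous_on[of cnj, OF continuous_on_cnj[OF continuous_on_id]])

text \<open>
  In the integration variable \<open>w = z + r \<zeta>\<close> the integral is \<open>r\<^bsup>-2d\<^esup> V\<close>, where \<open>V\<close> has the kernel \<open>k\<close> of
  modulus \<open>1\<close>; here \<open>z \<bullet>\<^sub>\<sigma> r \<zeta> = z \<bullet>\<^sub>\<sigma> w\<close>. The function \<open>\<Psi>\<close> is the integrand of the expanded
  square of \<open>V\<close> with its Gaussian weight, and \<open>fib w\<close> is the squared norm of \<open>\<eta>\<close> on the line over \<open>w\<close>.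
\<close>

context
  fixes \<eta> :: "'d::finite heis \<Rightarrow> complex" and r \<delta> :: real
  assumes \<eta>: "compactly_supported \<eta>" and r: "r > 0" and \<delta>: "\<delta> > 0"
begin

private definition k :: "'d phase \<Rightarrow> 'd phase \<Rightarrow> complex" where
  "k z w = exp (\<i> * complex_of_real ((norm (w - z))\<^sup>2 / (2 * r\<^sup>2)))"
private definition V :: "'d heis \<Rightarrow> complex" where
  "V = (\<lambda>(z, s). LINT w|lborel. k z w * \<eta> (w, s + z \<bullet>\<^sub>\<sigma> w))"
private definition fib :: "'d phase \<Rightarrow> real" where
  "fib w = (LINT s|lborel. (norm (\<eta> (w, s)))\<^sup>2)"
private definition \<Psi> :: "('d phase \<times> 'd phase) \<times> 'd heis \<Rightarrow> complex" where
  "\<Psi> = (\<lambda>((w, w'), (z, s)). gauss_weight \<delta> z *\<^sub>R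
     ((k z w * \<eta> (w, s + z \<bullet>\<^sub>\<sigma> w)) * cnj (k z w' * \<eta> (w', s + z \<bullet>\<^sub>\<sigma> w'))))"

private lemma cont: "continuous_on UNIV \<eta>" using \<eta> by (simp add: compactly_supported_def)

private lemma supp: obtains R where "\<And>w s. \<eta> (w, s) \<noteq> 0 \<Longrightarrow> norm w \<le> R \<and> \<bar>s\<bar> \<le> R"
proof -
  obtain R where "\<And>x. \<eta> x \<noteq> 0 \<Longrightarrow> norm x \<le> R" using \<eta> by (auto simp: compactly_supported_def)
  then show ?thesis using that[of R]
    by (metis norm_fst_le norm_snd_le order_trans real_norm_def)
qed

private lemma meas [measurable]: "\<eta> \<in> borel_measurable borel" using \<eta> by measurable

private lemma norm_k [simp]: "norm (k z w) = 1" by (simp add: k_def)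

private lemma cont_shift: "continuous_on UNIV (\<lambda>x. \<eta> (f x, g x))" if "continuous_on UNIV f" "continuous_on UNIV g" for f :: "'x::topological_space \<Rightarrow> _" and g
  by (rule continuous_on_compose2[OF cont]) (auto intro!: continuous_intros that)

private lemma meas_\<Psi> [measurable]: "\<Psi> \<in> borel_measurable borel"
  unfolding \<Psi>_def case_prod_beta k_def
  by (intro borel_measurable_continuous_onI continuous_intros cont_shift) (use r in auto)

private lemma cs_fibre: "compactly_supported (\<lambda>s. \<eta> (w, s))"
proof -
  obtain R where R: "\<And>w s. \<eta> (w, s) \<noteq> 0 \<Longrightarrow> norm w \<le> R \<and> \<bar>s\<bar> \<le> R" using supp by blast
  then show ?thesis by (intro compactly_supportedI[of _ R] cont_shift continuous_intros) auto
qed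

private lemma nn_fib: "(\<integral>\<^sup>+s. ennreal ((norm (\<eta> (w, s + c)))\<^sup>2) \<partial>lborel) = ennreal (fib w)"
proof -
  have "(\<integral>\<^sup>+s. ennreal ((norm (\<eta> (w, s + c)))\<^sup>2) \<partial>lborel) = (\<integral>\<^sup>+s. ennreal ((norm (\<eta> (w, s)))\<^sup>2) \<partial>lborel)"
    by (rule nn_integral_lborel_translate) measurable
  also have "\<dots> = ennreal (fib w)"
    using square_integrable_compactly_supported[OF cs_fibre, of w]
    by (simp add: square_integrable_def fib_def nn_integral_eq_integral)
  finally show ?thesis .
qed

private lemma fib_nonneg: "fib w \<ge> 0" by (simp add: fib_def)

private lemma meas_fib [measurable]: "fib \<in> borel_measurable borel"
  unfolding fib_def by measurable

private lemma fib_energy: "(\<integral>\<^sup>+w. ennreal (fib w) \<partial>lborel) = energy \<eta>"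
  unfolding energy_def by (subst nn_integral_lborel_pair) (simp_all add: nn_fib[where c = 0, simplified])

private lemma norm_mult_le_half: "norm (a * b) \<le> ((norm a)\<^sup>2 + (norm b)\<^sup>2) / 2" for a b :: complex
  using zero_le_power2[of "norm a - norm b"] by (simp add: norm_mult power2_eq_square algebra_simps)

private lemma ennreal_half_sum: "a \<ge> 0 \<Longrightarrow> b \<ge> 0 \<Longrightarrow> ennreal (1/2) * (ennreal a + ennreal b) = ennreal ((a + b) / 2)"
  by (subst ennreal_plus[symmetric], simp, simp, subst ennreal_mult[symmetric]) simp_all

private lemma ennreal_norm_mult_le_half:
  "ennreal (norm (a * b)) \<le> ennreal (1/2) * (ennreal ((norm a)\<^sup>2) + ennreal ((norm b)\<^sup>2))" for a b :: complex
proof -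
  have "ennreal (1/2) * (ennreal ((norm a)\<^sup>2) + ennreal ((norm b)\<^sup>2)) = ennreal (1/2 * ((norm a)\<^sup>2 + (norm b)\<^sup>2))"
    by (subst ennreal_mult, simp, simp, subst ennreal_plus) simp_all
  then show ?thesis using norm_mult_le_half[of a b] by (simp add: ennreal_leI)
qed

private lemma norm_\<Psi>_le: "norm (\<Psi> ((w, w'), (z, s))) \<le> gauss_weight \<delta> z *
   (((norm (\<eta> (w, s + z \<bullet>\<^sub>\<sigma> w)))\<^sup>2 + (norm (\<eta> (w', s + z \<bullet>\<^sub>\<sigma> w')))\<^sup>2) / 2)"
  using norm_mult_le_half[of "k z w * \<eta> (w, s + z \<bullet>\<^sub>\<sigma> w)" "cnj (k z w' * \<eta> (w', s + z \<bullet>\<^sub>\<sigma> w'))"]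
  by (simp add: \<Psi>_def norm_mult)

private definition gauss_mass :: ennreal where
  "gauss_mass = (\<integral>\<^sup>+z. ennreal (gauss_weight \<delta> (z::'d phase)) \<partial>lborel)"

private lemma gauss_mass_eq: "gauss_mass = ennreal ((2 * pi / \<delta>) ^ CARD('d))"
  unfolding gauss_mass_def nn_integral_gaussian[OF \<delta>] DIM_phase using \<delta> by (simp add: power_mult)

private lemma nn_bound: "(\<integral>\<^sup>+g. ennreal (norm (\<Psi> ((w, w'), g))) \<partial>lborel) \<le> gauss_mass * ennreal ((fib w + fib w') / 2)"
proof -
  have "(\<integral>\<^sup>+g. ennreal (norm (\<Psi> ((w, w'), g))) \<partial>lborel) = (\<integral>\<^sup>+z. \<integral>\<^sup>+s. ennreal (norm (\<Psi> ((w, w'), (z, s)))) \<partial>lborel \<partial>lborel)"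
    by (subst nn_integral_lborel_pair) measurable
  also have "\<dots> \<le> (\<integral>\<^sup>+z. \<integral>\<^sup>+s. ennreal (gauss_weight \<delta> z / 2) *
     (ennreal ((norm (\<eta> (w, s + z \<bullet>\<^sub>\<sigma> w)))\<^sup>2) + ennreal ((norm (\<eta> (w', s + z \<bullet>\<^sub>\<sigma> w')))\<^sup>2)) \<partial>lborel \<partial>lborel)"
    using norm_\<Psi>_le by (intro nn_integral_mono)
      (simp add: ennreal_mult[symmetric] ennreal_plus[symmetric] ennreal_leI del: ennreal_plus)
  also have "\<dots> = (\<integral>\<^sup>+z. ennreal (gauss_weight \<delta> (z::'d phase)) * ennreal ((fib w + fib w') / 2) \<partial>lborel)"
    by (intro nn_integral_cong, subst nn_integral_cmult, measurable, subst nn_integral_add, measurable)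
       (simp add: nn_fib fib_nonneg ennreal_mult[symmetric] ennreal_plus[symmetric] del: ennreal_plus)
  also have "\<dots> = gauss_mass * ennreal ((fib w + fib w') / 2)"
    unfolding gauss_mass_def by (rule nn_integral_multc) measurable
  finally show ?thesis .
qed

private lemma energy_finite: "energy \<eta> < \<infinity>"
  using square_integrable_compactly_supported[OF \<eta>] by (simp add: square_integrable_iff_energy)

private lemma integrable_\<Psi>: "integrable lborel \<Psi>"
proof (rule integrableI_bounded)
  obtain R where R: "\<And>w s. \<eta> (w, s) \<noteq> 0 \<Longrightarrow> norm w \<le> R \<and> \<bar>s\<bar> \<le> R" using supp by blast
  let ?I = "\<lambda>w::'d phase. indicator (cball 0 R) w :: ennreal"
  have z: "\<Psi> ((w, w'), g) = 0" if "norm w > R \<or> norm w' > R" for w w' g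
  proof -
    have "\<eta> (w, s) = 0 \<or> \<eta> (w', s') = 0" for s s' using that R[of w s] R[of w' s'] by fastforce
    then show ?thesis by (auto simp: \<Psi>_def split: prod.split)
  qed
  have "(\<integral>\<^sup>+x. ennreal (norm (\<Psi> x)) \<partial>lborel) = (\<integral>\<^sup>+w. \<integral>\<^sup>+w'. \<integral>\<^sup>+g. ennreal (norm (\<Psi> ((w, w'), g))) \<partial>lborel \<partial>lborel \<partial>lborel)"
    by (subst nn_integral_lborel_pair, measurable, subst nn_integral_lborel_pair) measurable
  also have "\<dots> \<le> (\<integral>\<^sup>+w. \<integral>\<^sup>+w'. gauss_mass * (ennreal (fib w) * ?I w' + ?I w * ennreal (fib w')) \<partial>lborel \<partial>lborel)"
  proof (intro nn_integral_mono)
    fix w w' :: "'d phase"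
    show "(\<integral>\<^sup>+g. ennreal (norm (\<Psi> ((w, w'), g))) \<partial>lborel) \<le> gauss_mass * (ennreal (fib w) * ?I w' + ?I w * ennreal (fib w'))"
    proof (cases "norm w > R \<or> norm w' > R")
      case True then show ?thesis by (simp add: z)
    next
      case False
      have "ennreal ((fib w + fib w') / 2) \<le> ennreal (fib w) + ennreal (fib w')"
        using fib_nonneg by (simp add: ennreal_plus[symmetric] ennreal_leI del: ennreal_plus)
      from order_trans[OF nn_bound mult_left_mono[OF this]]
      show ?thesis using False by simp
    qed
  qed
  also have "\<dots> = gauss_mass * (energy \<eta> * emeasure lborel (cball (0::'d phase) R) + emeasure lborel (cball (0::'d phase) R) * energy \<eta>)"
  proof -
    have [measurable]: "?I \<in> borel_measurable borel" by (intro borel_measurable_indicator) simp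
    have I: "(\<integral>\<^sup>+w. ?I w \<partial>lborel) = emeasure lborel (cball (0::'d phase) R)" by simp
    have "(\<integral>\<^sup>+w'. gauss_mass * (ennreal (fib w) * ?I w' + ?I w * ennreal (fib w')) \<partial>lborel) =
      gauss_mass * (ennreal (fib w) * emeasure lborel (cball (0::'d phase) R) + ?I w * energy \<eta>)" for w
      by (subst nn_integral_cmult, measurable, subst nn_integral_add, measurable, subst nn_integral_cmult, measurable,
          subst nn_integral_cmult, measurable, simp only: I fib_energy)
    moreover have "(\<integral>\<^sup>+w. gauss_mass * (ennreal (fib w) * emeasure lborel (cball (0::'d phase) R) + ?I w * energy \<eta>) \<partial>lborel) =
      gauss_mass * (energy \<eta> * emeasure lborel (cball (0::'d phase) R) + emeasure lborel (cball (0::'d phase) R) * energy \<eta>)"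
      by (subst nn_integral_cmult, measurable, subst nn_integral_add, measurable, subst nn_integral_multc, measurable,
          subst nn_integral_multc, measurable, simp only: I fib_energy)
    ultimately show ?thesis by simp
  qed
  also have "\<dots> < \<infinity>"
    using energy_finite emeasure_lborel_cball_finite[of "0::'d phase" R]
    by (simp add: gauss_mass_eq ennreal_mult_less_top)
  finally show "(\<integral>\<^sup>+x. ennreal (norm (\<Psi> x)) \<partial>lborel) < \<infinity>" .
qed simp

private lemma cs_w: "compactly_supported (\<lambda>w. k z w * \<eta> (w, s + z \<bullet>\<^sub>\<sigma> w))"
proof -
  obtain R where R: "\<And>w s. \<eta> (w, s) \<noteq> 0 \<Longrightarrow> norm w \<le> R \<and> \<bar>s\<bar> \<le> R" using supp by blast
  then show ?thesis unfolding k_def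
    by (intro compactly_supportedI[of _ R] cont_shift continuous_intros) (use r in auto)
qed

private lemma cs_ww: "compactly_supported (\<lambda>ww. \<Psi> (ww, (z, s)))"
proof -
  obtain R where R: "\<And>w s. \<eta> (w, s) \<noteq> 0 \<Longrightarrow> norm w \<le> R \<and> \<bar>s\<bar> \<le> R" using supp by blast
  show ?thesis
  proof (rule compactly_supportedI[of _ "R + R"])
    show "continuous_on UNIV (\<lambda>ww. \<Psi> (ww, (z, s)))" unfolding \<Psi>_def case_prod_beta k_def
      by (intro cont_shift continuous_intros) (use r in auto)
    fix ww assume "\<Psi> (ww, (z, s)) \<noteq> 0"
    then have "\<eta> (fst ww, s + z \<bullet>\<^sub>\<sigma> fst ww) \<noteq> 0" "\<eta> (snd ww, s + z \<bullet>\<^sub>\<sigma> snd ww) \<noteq> 0"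
      by (auto simp: \<Psi>_def case_prod_beta)
    then have "norm (fst ww) \<le> R" "norm (snd ww) \<le> R" using R by blast+
    then show "norm ww \<le> R + R" using norm_Pair_le[of "fst ww" "snd ww"] by simp
  qed
qed

private lemma expand_square: "(LINT ww|lborel. \<Psi> (ww, (z, s))) = gauss_weight \<delta> z *\<^sub>R of_real ((norm (V (z, s)))\<^sup>2)"
proof -
  have "(LINT ww|lborel. \<Psi> (ww, (z, s))) = (LINT w|lborel. LINT w'|lborel. \<Psi> ((w, w'), (z, s)))"
    by (rule integral_lborel_pair[OF integrable_compactly_supported[OF cs_ww]])
  also have "\<dots> = gauss_weight \<delta> z *\<^sub>R (V (z, s) * cnj (V (z, s)))"
  proof -
    have "(LINT w'|lborel. cnj (k z w' * \<eta> (w', s + z \<bullet>\<^sub>\<sigma> w'))) = cnj (V (z, s))"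
      unfolding V_def prod.case by (simp del: complex_cnj_mult)
    moreover have "(LINT w|lborel. k z w * \<eta> (w, s + z \<bullet>\<^sub>\<sigma> w)) = V (z, s)" by (simp add: V_def)
    ultimately show ?thesis
      unfolding \<Psi>_def prod.case by (simp only: integral_scaleR_right integral_mult_right_zero integral_mult_left_zero)
  qed
  also have "V (z, s) * cnj (V (z, s)) = of_real ((norm (V (z, s)))\<^sup>2)"
    by (rule complex_norm_square[symmetric])
  finally show ?thesis .
qed

text \<open>
  For fixed \<open>w\<close> and \<open>w'\<close> the integral over \<open>s\<close> is a function \<open>F\<close> of \<open>z \<bullet> rot (w - w')\<close>, bounded by the
  mean of the two fibre energies, while the kernels contribute a character of \<open>z \<bullet> (w - w')\<close>. The two
  vectors are orthogonal, so the character integrates to a Gaussian in \<open>w - w'\<close>.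
\<close>

private lemma kernel_bound:
  assumes int: "integrable lborel (\<lambda>g. \<Psi> ((w, w'), g))"
  shows "ennreal (norm (LINT g|lborel. \<Psi> ((w, w'), g))) \<le>
    ennreal ((fib w + fib w') / 2 * exp (- ((norm (w - w'))\<^sup>2 / (2 * \<delta> * r ^ 4)))) * gauss_mass"
proof -
  define F where "F t = (LINT s|lborel. \<eta> (w, s + t) * cnj (\<eta> (w', s)))" for t
  have Fm [measurable]: "F \<in> borel_measurable borel" unfolding F_def by measurable
  have F: "norm (F t) \<le> (fib w + fib w') / 2" for t
  proof -
    have "ennreal (norm (F t)) \<le> (\<integral>\<^sup>+s. ennreal (norm (\<eta> (w, s + t) * cnj (\<eta> (w', s)))) \<partial>lborel)"
      unfolding F_def by (rule ennreal_norm_integral_le)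
    also have "\<dots> \<le> (\<integral>\<^sup>+s. ennreal (1/2) * (ennreal ((norm (\<eta> (w, s + t)))\<^sup>2) + ennreal ((norm (\<eta> (w', s + 0)))\<^sup>2)) \<partial>lborel)"
      by (intro nn_integral_mono) (use ennreal_norm_mult_le_half[of "\<eta> _" "cnj (\<eta> _)"] in simp)
    also have "\<dots> = ennreal ((fib w + fib w') / 2)"
      by (subst nn_integral_cmult, measurable, subst nn_integral_add, measurable)
         (simp only: nn_fib ennreal_half_sum[OF fib_nonneg fib_nonneg])
    finally show ?thesis using fib_nonneg by (simp add: ennreal_le_iff)
  qed
  define c where "c = exp (\<i> * complex_of_real (((norm w)\<^sup>2 - (norm w')\<^sup>2) / (2 * r\<^sup>2)))"
  have kk: "k z w * cnj (k z w') = c * exp (- (\<i> * complex_of_real ((1 / r\<^sup>2) * (z \<bullet> (w - w')))))" for z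
  proof -
    have "cnj (k z w') = exp (- (\<i> * complex_of_real ((norm (w' - z))\<^sup>2 / (2 * r\<^sup>2))))"
      by (simp add: k_def exp_cnj)
    moreover have "(norm (w - z))\<^sup>2 / (2 * r\<^sup>2) - (norm (w' - z))\<^sup>2 / (2 * r\<^sup>2) = ((norm w)\<^sup>2 - (norm w')\<^sup>2) / (2 * r\<^sup>2) - (1 / r\<^sup>2) * (z \<bullet> (w - w'))"
      unfolding power2_norm_eq_inner using r by (simp add: field_simps inner_diff_left inner_diff_right inner_commute)
    then have "\<i> * complex_of_real ((norm (w - z))\<^sup>2 / (2 * r\<^sup>2)) + - (\<i> * complex_of_real ((norm (w' - z))\<^sup>2 / (2 * r\<^sup>2))) =
      \<i> * complex_of_real (((norm w)\<^sup>2 - (norm w')\<^sup>2) / (2 * r\<^sup>2)) + - (\<i> * complex_of_real ((1 / r\<^sup>2) * (z \<bullet> (w - w'))))"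
      by (metis (no_types, opaque_lifting) diff_conv_add_uminus of_real_diff right_diff_distrib)
    ultimately show ?thesis unfolding k_def c_def by (simp only: mult_exp_exp)
  qed
  have sint: "(LINT s|lborel. \<eta> (w, s + z \<bullet>\<^sub>\<sigma> w) * cnj (\<eta> (w', s + z \<bullet>\<^sub>\<sigma> w'))) = F (z \<bullet> rot (w - w'))" for z
  proof -
    have "(LINT s|lborel. \<eta> (w, s + z \<bullet>\<^sub>\<sigma> w) * cnj (\<eta> (w', s + z \<bullet>\<^sub>\<sigma> w'))) = 
       (LINT s|lborel. (\<lambda>s. \<eta> (w, s + z \<bullet> rot (w - w')) * cnj (\<eta> (w', s))) (s + z \<bullet>\<^sub>\<sigma> w'))"
      by (simp add: symp_prod_eq_inner_rot rot_linear inner_diff_right algebra_simps)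
    also have "\<dots> = F (z \<bullet> rot (w - w'))" unfolding F_def by (rule integral_lborel_translate) measurable
    finally show ?thesis .
  qed
  have "(LINT g|lborel. \<Psi> ((w, w'), g)) = (LINT z|lborel. LINT s|lborel. \<Psi> ((w, w'), (z, s)))"
    by (rule integral_lborel_pair[OF int])
  also have "\<dots> = (LINT z|lborel. c * (gauss_weight \<delta> z *\<^sub>R (exp (- (\<i> * of_real ((1 / r\<^sup>2) * (z \<bullet> (w - w'))))) * F (z \<bullet> rot (w - w')))))"
  proof (rule Bochner_Integration.integral_cong)
    fix z :: "'d phase"
    have "\<Psi> ((w, w'), (z, s)) = (gauss_weight \<delta> z *\<^sub>R (k z w * cnj (k z w'))) * (\<eta> (w, s + z \<bullet>\<^sub>\<sigma> w) * cnj (\<eta> (w', s + z \<bullet>\<^sub>\<sigma> w')))" for s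
      by (simp add: \<Psi>_def mult_ac)
    then show "(LINT s|lborel. \<Psi> ((w, w'), (z, s))) = c * (gauss_weight \<delta> z *\<^sub>R (exp (- (\<i> * of_real ((1 / r\<^sup>2) * (z \<bullet> (w - w'))))) * F (z \<bullet> rot (w - w'))))"
      by (simp only: integral_mult_right_zero sint kk) (simp add: mult.assoc)
  qed simp
  also have "\<dots> = c * (exp (- ((1 / r\<^sup>2)\<^sup>2 * (norm (w - w'))\<^sup>2 / (2 * \<delta>))) *\<^sub>R (LINT z|lborel. gauss_weight \<delta> z *\<^sub>R F (z \<bullet> rot (w - w'))))"
    by (simp only: integral_mult_right_zero integral_gaussian_character_orthogonal[OF \<delta> inner_rot_self Fm F])
  also have "norm \<dots> = exp (- ((norm (w - w'))\<^sup>2 / (2 * \<delta> * r ^ 4))) * norm (LINT z|lborel. gauss_weight \<delta> z *\<^sub>R F (z \<bullet> rot (w - w')))"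
    by (simp add: norm_mult c_def power_divide mult.commute)
  finally have eq: "ennreal (norm (LINT g|lborel. \<Psi> ((w, w'), g))) =
     ennreal (exp (- ((norm (w - w'))\<^sup>2 / (2 * \<delta> * r ^ 4)))) * ennreal (norm (LINT z|lborel. gauss_weight \<delta> z *\<^sub>R F (z \<bullet> rot (w - w'))))"
    by (simp add: ennreal_mult)
  have "ennreal (norm (LINT z|lborel. gauss_weight \<delta> z *\<^sub>R F (z \<bullet> rot (w - w')))) \<le>
     (\<integral>\<^sup>+z. ennreal (norm (gauss_weight \<delta> z *\<^sub>R F (z \<bullet> rot (w - w')))) \<partial>lborel)"
    by (rule ennreal_norm_integral_le)
  also have "\<dots> \<le> (\<integral>\<^sup>+z. ennreal (gauss_weight \<delta> (z::'d phase)) * ennreal ((fib w + fib w') / 2) \<partial>lborel)"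
    using F fib_nonneg by (intro nn_integral_mono) (simp add: ennreal_mult[symmetric] ennreal_leI mult_left_mono)
  also have "\<dots> = gauss_mass * ennreal ((fib w + fib w') / 2)"
    unfolding gauss_mass_def by (rule nn_integral_multc) measurable
  finally have bnd: "ennreal (norm (LINT z|lborel. gauss_weight \<delta> z *\<^sub>R F (z \<bullet> rot (w - w')))) \<le> gauss_mass * ennreal ((fib w + fib w') / 2)" .
  have "0 \<le> (fib w + fib w') / 2" using fib_nonneg[of w] fib_nonneg[of w'] by simp
  then have "ennreal ((fib w + fib w') / 2 * exp (- ((norm (w - w'))\<^sup>2 / (2 * \<delta> * r ^ 4)))) * gauss_mass =
    ennreal (exp (- ((norm (w - w'))\<^sup>2 / (2 * \<delta> * r ^ 4)))) * (gauss_mass * ennreal ((fib w + fib w') / 2))"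
    by (subst ennreal_mult) (auto simp: mult_ac)
  then show ?thesis unfolding eq using mult_left_mono[OF bnd] by simp
qed

text \<open>
  The Schur test: the Gaussian kernel in \<open>w - w'\<close> has the same total mass \<open>(2 \<pi> \<delta> r\<^sup>4)\<^sup>d\<close> in either
  variable, and the mass \<open>(2 \<pi> / \<delta>)\<^sup>d\<close> of the weight cancels the dependence on \<open>\<delta>\<close>.
\<close>

private lemma weighted_bound:
  "(\<integral>\<^sup>+g. ennreal (gauss_weight \<delta> (fst g) * (norm (V g))\<^sup>2) \<partial>lborel) \<le> ennreal ((2 * pi) ^ (2 * CARD('d)) * r ^ (4 * CARD('d))) * energy \<eta>"
proof -
  define X where "X ww = exp (- ((norm (fst ww - snd ww))\<^sup>2 / (2 * \<delta> * r ^ 4)))" for ww :: "'d phase \<times> 'd phase"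
  define A B where "A ww = ennreal (fib (fst ww) * X ww)" and "B ww = ennreal (fib (snd ww) * X ww)" for ww
  have mX: "X \<in> borel_measurable borel"
    unfolding X_def by (intro borel_measurable_continuous_onI continuous_intros) (use \<delta> r in auto)
  have mf: "(\<lambda>x. fib (fst x)) \<in> borel_measurable (borel :: ('d phase \<times> 'd phase) measure)"
      "(\<lambda>x. fib (snd x)) \<in> borel_measurable (borel :: ('d phase \<times> 'd phase) measure)"
    by (rule measurable_compose[OF borel_measurable_continuous_onI meas_fib]; intro continuous_intros)+
  have [measurable]: "A \<in> borel_measurable borel" "B \<in> borel_measurable borel"
    unfolding A_def B_def using mX mf by (auto intro!: measurable_compose[OF _ measurable_ennreal] borel_measurable_times)
  let ?W = "\<lambda>g. gauss_weight \<delta> (fst g) * (norm (V g))\<^sup>2"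
  have int': "integrable (lborel \<Otimes>\<^sub>M lborel) (\<lambda>(a, b). \<Psi> (a, b))"
    using integrable_\<Psi> by (simp add: lborel_prod)
  have eq: "(LINT ww|lborel. \<Psi> (ww, g)) = of_real (?W g)" for g
    using expand_square[of "fst g" "snd g"] by (simp add: scaleR_conv_of_real)
  have intW: "integrable lborel ?W"
    using integrable_norm[OF lborel_pair.integrable_snd[OF int']] unfolding eq norm_of_real by (simp add: abs_of_nonneg)
  have "(\<integral>\<^sup>+g. ennreal (?W g) \<partial>lborel) = ennreal (LINT g|lborel. ?W g)"
    by (rule nn_integral_eq_integral[OF intW]) simp
  also have "\<dots> = ennreal (norm (LINT g|lborel. LINT ww|lborel. \<Psi> (ww, g)))"
    unfolding eq integral_complex_of_real norm_of_real by (simp add: abs_of_nonneg)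
  also have "(LINT g|lborel. LINT ww|lborel. \<Psi> (ww, g)) = (LINT ww|lborel. LINT g|lborel. \<Psi> (ww, g))"
    by (rule lborel_pair.Fubini_integral[OF int'])
  also have "ennreal (norm \<dots>) \<le> (\<integral>\<^sup>+ww. ennreal (norm (LINT g|lborel. \<Psi> (ww, g))) \<partial>lborel)"
    by (rule ennreal_norm_integral_le)
  also have "\<dots> \<le> (\<integral>\<^sup>+ww. (A ww + B ww) * (ennreal (1 / 2) * gauss_mass) \<partial>lborel)"
    using lborel_pair.AE_integrable_fst[OF int']
  proof (intro nn_integral_mono_AE, eventually_elim)
    case (elim ww)
    have "ennreal ((fib (fst ww) + fib (snd ww)) / 2 * X ww) = ennreal (1/2) * (A ww + B ww)"
      unfolding A_def B_def by (subst ennreal_half_sum) (auto simp: fib_nonneg X_def algebra_simps add_divide_distrib)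
    then show ?case using kernel_bound[of "fst ww" "snd ww"] elim by (simp add: X_def mult_ac)
  qed
  also have "\<dots> = (\<integral>\<^sup>+ww. A ww + B ww \<partial>lborel) * (ennreal (1 / 2) * gauss_mass)"
    by (rule nn_integral_multc) measurable
  also have "(\<integral>\<^sup>+ww. A ww + B ww \<partial>lborel) = 2 * (energy \<eta> * ennreal ((2 * pi * (\<delta> * r ^ 4)) ^ CARD('d)))"
  proof -
    have pos: "1 / (\<delta> * r ^ 4) > 0" using \<delta> r by simp
    have g: "(\<integral>\<^sup>+w'. ennreal (exp (- ((norm (w - w'))\<^sup>2 / (2 * \<delta> * r ^ 4)))) \<partial>lborel) = ennreal ((2 * pi * (\<delta> * r ^ 4)) ^ CARD('d))"
      for w :: "'d phase"
    proof -
      have "(\<integral>\<^sup>+w'. ennreal (exp (- ((norm (w - w'))\<^sup>2 / (2 * \<delta> * r ^ 4)))) \<partial>lborel) = (\<integral>\<^sup>+w'. (\<lambda>u. ennreal (gauss_weight (1 / (\<delta> * r ^ 4)) u)) (w' + - w) \<partial>lborel)"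
        by (simp add: norm_minus_commute field_simps)
      also have "\<dots> = ennreal (sqrt (2 * pi / (1 / (\<delta> * r ^ 4))) ^ DIM('d phase))"
        by (subst nn_integral_lborel_translate, measurable) (rule nn_integral_gaussian[OF pos])
      also have "\<dots> = ennreal ((2 * pi * (\<delta> * r ^ 4)) ^ CARD('d))"
        unfolding DIM_phase power_mult using \<delta> r by simp
      finally show ?thesis .
    qed
    have X: "X (w, w') = exp (- ((norm (w - w'))\<^sup>2 / (2 * \<delta> * r ^ 4)))" for w w' by (simp add: X_def)
    have 1: "(\<integral>\<^sup>+ww. A ww \<partial>lborel) = energy \<eta> * ennreal ((2 * pi * (\<delta> * r ^ 4)) ^ CARD('d))"
      by (subst nn_integral_lborel_pair, measurable)
         (simp add: A_def X ennreal_mult fib_nonneg nn_integral_cmult g nn_integral_multc fib_energy)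
    have "(\<integral>\<^sup>+ww. B ww \<partial>lborel) = (\<integral>\<^sup>+w. \<integral>\<^sup>+w'. B (w, w') \<partial>lborel \<partial>lborel)"
      by (subst nn_integral_lborel_pair) measurable
    also have "\<dots> = (\<integral>\<^sup>+w'. \<integral>\<^sup>+w. B (w, w') \<partial>lborel \<partial>lborel)"
    proof (rule lborel_pair.Fubini')
      have "(\<lambda>x. B (snd x, fst x)) \<in> borel_measurable borel"
        by (rule measurable_compose[of "\<lambda>x. (snd x, fst x)" _ borel]) (auto intro!: borel_measurable_continuous_onI continuous_intros)
      then show "(\<lambda>(w', w). B (w, w')) \<in> borel_measurable (lborel \<Otimes>\<^sub>M lborel)"
        by (simp add: lborel_prod case_prod_beta)
    qed
    also have "\<dots> = energy \<eta> * ennreal ((2 * pi * (\<delta> * r ^ 4)) ^ CARD('d))"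
    proof -
      have "(\<integral>\<^sup>+w. ennreal (exp (- ((norm (w - w'))\<^sup>2 / (2 * \<delta> * r ^ 4)))) \<partial>lborel) = ennreal ((2 * pi * (\<delta> * r ^ 4)) ^ CARD('d))"
        for w' :: "'d phase"
        unfolding norm_minus_commute[of _ w'] by (rule g)
      then show ?thesis
        by (simp add: B_def X ennreal_mult fib_nonneg nn_integral_cmult nn_integral_multc fib_energy)
    qed
    finally have 2: "(\<integral>\<^sup>+ww. B ww \<partial>lborel) = energy \<eta> * ennreal ((2 * pi * (\<delta> * r ^ 4)) ^ CARD('d))" .
    show ?thesis by (subst nn_integral_add, measurable, simp only: 1 2 mult_2)
  qed
  also have "2 * (energy \<eta> * ennreal ((2 * pi * (\<delta> * r ^ 4)) ^ CARD('d))) * (ennreal (1 / 2) * gauss_mass)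
     = (2 * ennreal (1/2)) * (energy \<eta> * (ennreal ((2 * pi * (\<delta> * r ^ 4)) ^ CARD('d)) * ennreal ((2 * pi / \<delta>) ^ CARD('d))))"
    unfolding gauss_mass_eq by (simp only: mult_ac)
  also have "2 * ennreal (1/2) = 1"
    unfolding ennreal_numeral[symmetric] by (subst ennreal_mult[symmetric]) simp_all
  also have "ennreal ((2 * pi * (\<delta> * r ^ 4)) ^ CARD('d)) * ennreal ((2 * pi / \<delta>) ^ CARD('d)) = ennreal ((2 * pi * (\<delta> * r ^ 4)) ^ CARD('d) * (2 * pi / \<delta>) ^ CARD('d))"
    using \<delta> r by (intro ennreal_mult[symmetric]) auto
  also have "(2 * pi * (\<delta> * r ^ 4)) ^ CARD('d) * (2 * pi / \<delta>) ^ CARD('d) = (2 * pi) ^ (2 * CARD('d)) * r ^ (4 * CARD('d))"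
  proof -
    have "(2 * pi * (\<delta> * r ^ 4)) * (2 * pi / \<delta>) = (2 * pi)\<^sup>2 * r ^ 4"
      using \<delta> by (simp add: power2_eq_square)
    then show ?thesis by (metis power_mult power_mult_distrib)
  qed
  finally show ?thesis by (simp add: mult.commute)
qed

private lemma osc_eq_V: "V g = r ^ (2 * CARD('d)) *\<^sub>R osc1 \<eta> r g"
proof -
  obtain z s where g: "g = (z, s)" by (cases g)
  have "V g = r ^ DIM('d phase) *\<^sub>R (LINT \<zeta>|lborel. k z (z + r *\<^sub>R \<zeta>) * \<eta> (z + r *\<^sub>R \<zeta>, s + z \<bullet>\<^sub>\<sigma> (z + r *\<^sub>R \<zeta>)))"
    unfolding V_def g prod.case
    by (rule integral_lborel_affine[OF borel_measurable_compactly_supported[OF cs_w] r])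
  also have "(LINT \<zeta>|lborel. k z (z + r *\<^sub>R \<zeta>) * \<eta> (z + r *\<^sub>R \<zeta>, s + z \<bullet>\<^sub>\<sigma> (z + r *\<^sub>R \<zeta>))) = osc1 \<eta> r g"
    unfolding osc_def k_def g using r by (simp add: symp_prod_simps power_mult_distrib)
  finally show ?thesis unfolding DIM_phase .
qed

lemma weighted_energy_osc_le:
  "(\<integral>\<^sup>+g. ennreal (gauss_weight \<delta> (fst g) * (norm (osc1 \<eta> r g))\<^sup>2) \<partial>lborel) \<le> ennreal ((2 * pi) ^ (2 * CARD('d))) * energy \<eta>"
proof -
  let ?c = "r ^ (4 * CARD('d))"
  have c: "?c > 0" using r by simp
  have "osc1 \<eta> r g = V g /\<^sub>R r ^ (2 * CARD('d))" for g
    using r by (simp add: osc_eq_V)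
  then have "(norm (osc1 \<eta> r g))\<^sup>2 = (norm (V g))\<^sup>2 / ?c" for g
    using r by (simp add: power_mult_distrib divide_simps power_mult[symmetric] mult.commute)
  then have "(\<integral>\<^sup>+g. ennreal (gauss_weight \<delta> (fst g) * (norm (osc1 \<eta> r g))\<^sup>2) \<partial>lborel)
    = (\<integral>\<^sup>+g. ennreal (gauss_weight \<delta> (fst g) * (norm (V g))\<^sup>2) * ennreal (1 / ?c) \<partial>lborel)"
    using c by (simp add: ennreal_mult[symmetric])
  also have "\<dots> = (\<integral>\<^sup>+g. ennreal (gauss_weight \<delta> (fst g) * (norm (V g))\<^sup>2) \<partial>lborel) * ennreal (1 / ?c)"
  proof (rule nn_integral_multc)
    have [measurable]: "V \<in> borel_measurable borel"
      unfolding osc_eq_V[abs_def]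
      by (intro borel_measurable_scaleR borel_measurable_const borel_measurable_osc_at cont continuous_on_const)
    have [measurable]: "(\<lambda>g. gauss_weight \<delta> (fst g)) \<in> borel_measurable (borel :: 'd heis measure)"
      by (intro borel_measurable_continuous_onI continuous_intros) auto
    show "(\<lambda>g. ennreal (gauss_weight \<delta> (fst g) * (norm (V g))\<^sup>2)) \<in> borel_measurable lborel"
      by measurable
  qed
  also have "\<dots> \<le> (ennreal ((2 * pi) ^ (2 * CARD('d)) * ?c) * energy \<eta>) * ennreal (1 / ?c)"
    by (rule mult_right_mono[OF weighted_bound]) simp
  also have "\<dots> = ennreal ((2 * pi) ^ (2 * CARD('d))) * energy \<eta>"
  proof -
    have "ennreal ((2 * pi) ^ (2 * CARD('d)) * ?c) * ennreal (1 / ?c) = ennreal ((2 * pi) ^ (2 * CARD('d)))"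
      using c r by (simp add: ennreal_mult[symmetric])
    moreover have "(ennreal ((2 * pi) ^ (2 * CARD('d)) * ?c) * energy \<eta>) * ennreal (1 / ?c) =
      (ennreal ((2 * pi) ^ (2 * CARD('d)) * ?c) * ennreal (1 / ?c)) * energy \<eta>" by (simp only: mult_ac)
    ultimately show ?thesis by simp
  qed
  finally show ?thesis .
qed

end


text \<open>
  Since \<open>|(2 \<pi> i)\<^sup>d|\<^sup>2 = (2 \<pi>)\<^bsup>2d\<^esup>\<close>, this says that \<open>S(r\<^sup>2)\<close> is a contraction. The weight is removed by
  letting \<open>\<delta>\<close> tend to \<open>0\<close>.
\<close>

theorem energy_osc_le:
  fixes \<eta> :: "'d::finite heis \<Rightarrow> complex"
  assumes \<eta>: "compactly_supported \<eta>" and r: "r > 0"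
  shows "energy (osc1 \<eta> r) \<le> ennreal ((2 * pi) ^ (2 * CARD('d))) * energy \<eta>"
proof -
  have c: "continuous_on UNIV \<eta>" using \<eta> by (simp add: compactly_supported_def)
  define f where "f n g = complex_of_real (exp (- (inverse (real (Suc n)) * (norm (fst g))\<^sup>2 / 4))) * osc1 \<eta> r g" for n and g :: "'d heis"
  show ?thesis
  proof (rule energy_limit_le[of f])
    show "f n \<in> borel_measurable lborel" for n
    proof -
      have "(\<lambda>g::'d heis. complex_of_real (exp (- (inverse (real (Suc n)) * (norm (fst g))\<^sup>2 / 4)))) \<in> borel_measurable borel"
        by (intro borel_measurable_continuous_onI continuous_intros) auto
      then show ?thesis unfolding f_def using borel_measurable_osc_at[OF continuous_on_const c, of 1 r]
        by (simp add: borel_measurable_times)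
    qed
    have "(\<lambda>n. f n g) \<longlonglongrightarrow> complex_of_real (exp (- (0 * (norm (fst g))\<^sup>2 / 4))) * osc1 \<eta> r g" for g
      unfolding f_def by (intro tendsto_intros LIMSEQ_inverse_real_of_nat) auto
    then show "AE g in lborel. (\<lambda>n. f n g) \<longlonglongrightarrow> osc1 \<eta> r g" by simp
    have "energy (f n) \<le> ennreal ((2 * pi) ^ (2 * CARD('d))) * energy \<eta>" for n
    proof -
      have "(norm (f n g))\<^sup>2 = exp (- (inverse (real (Suc n)) * (norm (fst g))\<^sup>2 / 2)) * (norm (osc1 \<eta> r g))\<^sup>2" for g
        using exp_double[of "- (inverse (real (Suc n)) * (norm (fst g))\<^sup>2 / 4)"]
        by (simp add: f_def norm_mult power_mult_distrib del: of_nat_Suc)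
      then show ?thesis
        using weighted_energy_osc_le[OF \<eta> r, of "inverse (real (Suc n))"] by (simp add: energy_def)
    qed
    then show "\<forall>\<^sub>F n in sequentially. energy (f n) \<le> ennreal ((2 * pi) ^ (2 * CARD('d))) * energy \<eta>" by simp
  qed
qed

section \<open>Smooth functions\<close>

lemma pderiv_dir_eq: "(f has_derivative D) (at p) \<Longrightarrow> pderiv_dir v f p = D v"
  unfolding pderiv_dir_def using frechet_derivative_at by metis

lemma iterated_pderiv_Cons: "iterated_pderiv (v # vs) f = pderiv_dir v (iterated_pderiv vs f)"
  by (simp add: iterated_pderiv_def)

lemma iterated_pderiv_snoc: "iterated_pderiv (vs @ [v]) f = iterated_pderiv vs (pderiv_dir v f)"
  by (simp add: iterated_pderiv_def)

lemma smooth_differentiable: "smooth f \<Longrightarrow> f differentiable (at p)"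
  unfolding smooth_def by (metis empty_subsetI foldr.simps(1) id_apply iterated_pderiv_def list.set(1))

lemma smooth_has_derivative: "smooth f \<Longrightarrow> (f has_derivative (\<lambda>v. pderiv_dir v f p)) (at p)"
  unfolding pderiv_dir_def using smooth_differentiable frechet_derivative_works by (metis eta_contract_eq)

lemma smooth_continuous: "smooth f \<Longrightarrow> continuous_on A f"
  by (meson continuous_at_imp_continuous_on differentiable_imp_continuous_within smooth_differentiable)

lemma smooth_pderiv_dir_Basis: "smooth f \<Longrightarrow> b \<in> Basis \<Longrightarrow> smooth (pderiv_dir b f)"
  unfolding smooth_def iterated_pderiv_snoc[symmetric] by auto

text \<open>
  A class of differentiable functions that is closed under the partial derivatives consists of smooth
  functions. The closure properties below are instances for suitable classes.
\<close>

lemma smooth_coinduct: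
  assumes "P f"
    and step: "\<And>f. P f \<Longrightarrow> (\<forall>p. f differentiable (at p)) \<and> (\<forall>b\<in>Basis. P (pderiv_dir b f))"
  shows "smooth f"
proof -
  have "P (iterated_pderiv vs f)" if "set vs \<subseteq> Basis" for vs
    using that by (induction vs) (auto simp: iterated_pderiv_Cons \<open>P f\<close> step, simp add: iterated_pderiv_def \<open>P f\<close>)
  then show ?thesis using step unfolding smooth_def by blast
qed

lemma smooth_zero: "smooth (\<lambda>_::'a::euclidean_space. 0)"
proof (rule smooth_coinduct[of "\<lambda>f. f = (\<lambda>_. 0)"])
  have "pderiv_dir b (\<lambda>_. 0) = (\<lambda>_. 0)" for b :: 'a
    by (rule ext, rule pderiv_dir_eq[OF has_derivative_const])
  then show "(\<forall>p. f differentiable at p) \<and> (\<forall>b\<in>Basis. pderiv_dir b f = (\<lambda>_. 0))" if "f = (\<lambda>_. 0)" for f :: "'a \<Rightarrow> complex"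
    using that by simp
qed simp

lemma smooth_add:
  assumes "smooth f" "smooth g" shows "smooth (\<lambda>x. f x + g x)"
proof (rule smooth_coinduct[of "\<lambda>h. \<exists>f g. smooth f \<and> smooth g \<and> h = (\<lambda>x. f x + g x)"])
  show "\<exists>f' g'. smooth f' \<and> smooth g' \<and> (\<lambda>x. f x + g x) = (\<lambda>x. f' x + g' x)" using assms by blast
next
  fix h assume "\<exists>f g. smooth f \<and> smooth g \<and> h = (\<lambda>x. f x + g x)"
  then obtain f g where fg: "smooth f" "smooth g" and h: "h = (\<lambda>x. f x + g x)" by blast
  have d: "(h has_derivative (\<lambda>v. pderiv_dir v f p + pderiv_dir v g p)) (at p)" for p
    unfolding h by (intro has_derivative_add smooth_has_derivative fg)
  have "pderiv_dir b h = (\<lambda>x. pderiv_dir b f x + pderiv_dir b g x)" for b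
    using pderiv_dir_eq[OF d] by blast
  then show "(\<forall>p. h differentiable (at p)) \<and> (\<forall>b\<in>Basis. \<exists>f g. smooth f \<and> smooth g \<and> pderiv_dir b h = (\<lambda>x. f x + g x))"
    using d fg smooth_pderiv_dir_Basis unfolding differentiable_def by blast
qed

lemma smooth_cmult:
  assumes "smooth f" shows "smooth (\<lambda>x. c * f x)"
proof (rule smooth_coinduct[of "\<lambda>h. \<exists>f. smooth f \<and> h = (\<lambda>x. c * f x)"])
  show "\<exists>f'. smooth f' \<and> (\<lambda>x. c * f x) = (\<lambda>x. c * f' x)" using assms by blast
next
  fix h assume "\<exists>f. smooth f \<and> h = (\<lambda>x. c * f x)"
  then obtain f where f: "smooth f" and h: "h = (\<lambda>x. c * f x)" by blast
  have d: "(h has_derivative (\<lambda>v. c * pderiv_dir v f p)) (at p)" for p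
    unfolding h by (intro has_derivative_mult_right smooth_has_derivative f)
  have "pderiv_dir b h = (\<lambda>x. c * pderiv_dir b f x)" for b
    using pderiv_dir_eq[OF d] by blast
  then show "(\<forall>p. h differentiable (at p)) \<and> (\<forall>b\<in>Basis. \<exists>f. smooth f \<and> pderiv_dir b h = (\<lambda>x. c * f x))"
    using d f smooth_pderiv_dir_Basis unfolding differentiable_def by blast
qed

lemma smooth_scaleR: "smooth f \<Longrightarrow> smooth (\<lambda>x. r *\<^sub>R f x)"
  using smooth_cmult[of f "of_real r"] by (simp add: scaleR_conv_of_real)

lemma smooth_sum: "(\<And>i. i \<in> I \<Longrightarrow> smooth (f i)) \<Longrightarrow> smooth (\<lambda>x. \<Sum>i\<in>I. f i x)"
  by (induction I rule: infinite_finite_induct) (auto simp: smooth_zero smooth_add)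

text \<open>
  The functions \<open>l f\<close> alone are not closed under derivatives, but the functions \<open>g + l f\<close> are.
\<close>

lemma smooth_linear_mult:
  fixes l :: "'a::euclidean_space \<Rightarrow> real"
  assumes f: "smooth f" and l: "bounded_linear l" shows "smooth (\<lambda>x. l x *\<^sub>R f x)"
proof (rule smooth_coinduct[of "\<lambda>h. \<exists>f g. smooth f \<and> smooth g \<and> h = (\<lambda>x. g x + l x *\<^sub>R f x)"])
  show "\<exists>f' g. smooth f' \<and> smooth g \<and> (\<lambda>x. l x *\<^sub>R f x) = (\<lambda>x. g x + l x *\<^sub>R f' x)"
    using f by (intro exI[of _ f] exI[of _ "\<lambda>_. 0"]) (auto simp: smooth_zero)
next
  fix h assume "\<exists>f g. smooth f \<and> smooth g \<and> h = (\<lambda>x. g x + l x *\<^sub>R f x)"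
  then obtain f g where fg: "smooth f" "smooth g" and h: "h = (\<lambda>x. g x + l x *\<^sub>R f x)" by blast
  have d: "(h has_derivative (\<lambda>v. pderiv_dir v g p + (l p *\<^sub>R pderiv_dir v f p + l v *\<^sub>R f p))) (at p)" for p
    unfolding h by (intro has_derivative_add has_derivative_scaleR smooth_has_derivative fg bounded_linear_imp_has_derivative l)
  have "pderiv_dir b h = (\<lambda>x. (pderiv_dir b g x + l b *\<^sub>R f x) + l x *\<^sub>R pderiv_dir b f x)" for b
    using pderiv_dir_eq[OF d] by (auto simp: fun_eq_iff)
  note eq = this
  show "(\<forall>p. h differentiable (at p)) \<and> (\<forall>b\<in>Basis. \<exists>f g. smooth f \<and> smooth g \<and> pderiv_dir b h = (\<lambda>x. g x + l x *\<^sub>R f x))"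
  proof (intro conjI allI ballI)
    show "h differentiable (at p)" for p using d unfolding differentiable_def by blast
    fix b :: 'a assume b: "b \<in> Basis"
    show "\<exists>f g. smooth f \<and> smooth g \<and> pderiv_dir b h = (\<lambda>x. g x + l x *\<^sub>R f x)"
      unfolding eq using fg b
      by (intro exI[of _ "pderiv_dir b f"] exI[of _ "\<lambda>x. pderiv_dir b g x + l b *\<^sub>R f x"] conjI)
         (auto intro: smooth_pderiv_dir_Basis smooth_add smooth_scaleR)
  qed
qed

lemma pderiv_dir_linear:
  assumes "smooth f"
  shows "pderiv_dir (a + b) f p = pderiv_dir a f p + pderiv_dir b f p" "pderiv_dir (r *\<^sub>R a) f p = r *\<^sub>R pderiv_dir a f p"
proof -
  interpret bounded_linear "\<lambda>v. pderiv_dir v f p" by (rule has_derivative_bounded_linear[OF smooth_has_derivative[OF assms]])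
  show "pderiv_dir (a + b) f p = pderiv_dir a f p + pderiv_dir b f p" "pderiv_dir (r *\<^sub>R a) f p = r *\<^sub>R pderiv_dir a f p"
    by (rule add, rule scaleR)
qed

lemma pderiv_dir_eq_sum:
  assumes "smooth f"
  shows "pderiv_dir v f p = (\<Sum>b\<in>Basis. (v \<bullet> b) *\<^sub>R pderiv_dir b f p)"
proof -
  interpret bounded_linear "\<lambda>v. pderiv_dir v f p" by (rule has_derivative_bounded_linear[OF smooth_has_derivative[OF assms]])
  show ?thesis by (subst euclidean_representation[of v, symmetric]) (simp only: sum scaleR)
qed

lemma smooth_pderiv_dir:
  assumes f: "smooth f" shows "smooth (pderiv_dir v f)"
proof -
  have "pderiv_dir v f = (\<lambda>p. \<Sum>b\<in>Basis. (v \<bullet> b) *\<^sub>R pderiv_dir b f p)"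
    using pderiv_dir_eq_sum[OF f] by blast
  then show ?thesis using f by (simp add: smooth_sum smooth_scaleR smooth_pderiv_dir_Basis)
qed

lemma smooth_affine_compose:
  assumes f: "smooth f" and l: "bounded_linear l" shows "smooth (\<lambda>x. f (c + l x))"
proof (rule smooth_coinduct[of "\<lambda>h. \<exists>f. smooth f \<and> h = (\<lambda>x. f (c + l x))"])
  show "\<exists>f'. smooth f' \<and> (\<lambda>x. f (c + l x)) = (\<lambda>x. f' (c + l x))" using f by blast
next
  fix h assume "\<exists>f. smooth f \<and> h = (\<lambda>x. f (c + l x))"
  then obtain f where f: "smooth f" and h: "h = (\<lambda>x. f (c + l x))" by blast
  have d: "(h has_derivative (\<lambda>v. pderiv_dir (l v) f (c + l p))) (at p)" for p
  proof -
    have "((\<lambda>x. c + l x) has_derivative l) (at p)"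
      using has_derivative_add[OF has_derivative_const bounded_linear_imp_has_derivative[OF l]] by simp
    from diff_chain_at[OF this smooth_has_derivative[OF f]] show ?thesis unfolding h by (simp add: o_def)
  qed
  have "pderiv_dir b h = (\<lambda>x. pderiv_dir (l b) f (c + l x))" for b
    using pderiv_dir_eq[OF d] by blast
  then show "(\<forall>p. h differentiable (at p)) \<and> (\<forall>b\<in>Basis. \<exists>f. smooth f \<and> pderiv_dir b h = (\<lambda>x. f (c + l x)))"
    using d f smooth_pderiv_dir unfolding differentiable_def by blast
qed

lemma smooth_compact_support_iff:
  "smooth_compact_support f \<longleftrightarrow> smooth f \<and> (\<exists>R. \<forall>x. f x \<noteq> 0 \<longrightarrow> norm x \<le> R)"
  unfolding smooth_compact_support_def compact_closure by (auto simp: bounded_iff)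

lemma smooth_compact_supportD:
  assumes "smooth_compact_support f"
  shows "smooth f" "compactly_supported f" "square_integrable f" "continuous_on A f"
  using assms smooth_continuous square_integrable_compactly_supported
  by (auto simp: smooth_compact_support_iff compactly_supported_def)

lemma pderiv_dir_support:
  assumes "\<And>x. f x \<noteq> 0 \<Longrightarrow> norm x \<le> R" "pderiv_dir v f x \<noteq> 0" shows "norm x \<le> R"
proof (rule ccontr)
  assume x: "\<not> norm x \<le> R"
  have "(f has_derivative (\<lambda>_. 0)) (at x)"
  proof (rule has_derivative_transform_within_open[OF has_derivative_const[of 0]])
    show "open (- cball 0 R)" by auto
    show "x \<in> - cball 0 R" using x by simp
    show "0 = f y" if "y \<in> - cball 0 R" for y using assms(1)[of y] that by auto
  qed
  then show False using assms(2) pderiv_dir_eq by blast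
qed

lemma smooth_compact_support_pderiv_dir:
  "smooth_compact_support f \<Longrightarrow> smooth_compact_support (pderiv_dir v f)"
  unfolding smooth_compact_support_iff using smooth_pderiv_dir pderiv_dir_support by metis

lemma smooth_compact_support_add:
  assumes "smooth_compact_support f" "smooth_compact_support g"
  shows "smooth_compact_support (\<lambda>x. f x + g x)"
proof -
  obtain R1 R2 where "\<And>x. f x \<noteq> 0 \<Longrightarrow> norm x \<le> R1" "\<And>x. g x \<noteq> 0 \<Longrightarrow> norm x \<le> R2"
    using assms unfolding smooth_compact_support_iff by auto
  then have "norm x \<le> max R1 R2" if "f x + g x \<noteq> 0" for x
    using that by (metis add_0 max.coboundedI1 max.coboundedI2)
  then show ?thesis using assms smooth_add unfolding smooth_compact_support_iff by blast
qed

lemma smooth_compact_support_linear_mult: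
  "smooth_compact_support f \<Longrightarrow> bounded_linear l \<Longrightarrow> smooth_compact_support (\<lambda>x. l x *\<^sub>R f x)"
  unfolding smooth_compact_support_iff using smooth_linear_mult by (metis scaleR_zero_right)

lemma smooth_compact_support_sum:
  assumes "finite I" "\<And>i. i \<in> I \<Longrightarrow> smooth_compact_support (f i)"
  shows "smooth_compact_support (\<lambda>x. \<Sum>i\<in>I. f i x)"
  using assms by (induction I rule: finite_induct) (auto simp: smooth_compact_support_add, auto simp: smooth_compact_support_iff smooth_zero)

lemma smooth_compact_support_iterated:
  "smooth_compact_support f \<Longrightarrow> smooth_compact_support (iterated_pderiv vs f)"
  by (induction vs) (auto simp: iterated_pderiv_Cons smooth_compact_support_pderiv_dir, simp add: iterated_pderiv_def)

lemma schwartz_smooth_compact_support: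
  assumes f: "smooth_compact_support f" shows "schwartz f"
  unfolding schwartz_def
proof (intro conjI allI impI)
  show "smooth f" using f by (simp add: smooth_compact_support_iff)
  fix k and vs :: "'a list"
  let ?h = "\<lambda>p. norm p ^ k *\<^sub>R iterated_pderiv vs f p"
  obtain R where R: "\<And>x. iterated_pderiv vs f x \<noteq> 0 \<Longrightarrow> norm x \<le> R" and c: "continuous_on UNIV (iterated_pderiv vs f)"
    using smooth_compact_support_iterated[OF f, of vs] smooth_compact_supportD(4)[OF smooth_compact_support_iterated[OF f]]
    unfolding smooth_compact_support_iff by blast
  have "compact (?h ` cball 0 R)"
    by (intro compact_continuous_image continuous_intros continuous_on_subset[OF c]) auto
  then have "bounded (insert 0 (?h ` cball 0 R))" by (simp add: compact_imp_bounded)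
  moreover have "range ?h \<subseteq> insert 0 (?h ` cball 0 R)" using R by force
  ultimately show "bounded (range ?h)" by (rule bounded_subset)
qed

subsection \<open>The Gaussian is a Schwartz function\<close>

text \<open>
  Polynomials times the Gaussian, generated so that closure under directional derivatives and rapid
  decay follow by rule induction.
\<close>

inductive gauss_poly :: "('a::euclidean_space \<Rightarrow> complex) \<Rightarrow> bool" where
  gauss: "gauss_poly (\<lambda>x. complex_of_real (exp (- ((norm x)\<^sup>2 / 2))))"
| scale: "gauss_poly f \<Longrightarrow> gauss_poly (\<lambda>x. c * f x)"
| add: "gauss_poly f \<Longrightarrow> gauss_poly g \<Longrightarrow> gauss_poly (\<lambda>x. f x + g x)"
| coord: "gauss_poly f \<Longrightarrow> gauss_poly (\<lambda>x. complex_of_real (x \<bullet> v) * f x)"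

lemma gauss_poly_derivative:
  assumes "gauss_poly f"
  shows "\<exists>D. (\<forall>p. (f has_derivative (\<lambda>v. D v p)) (at p)) \<and> (\<forall>v. gauss_poly (D v))"
  using assms
proof induction
  case gauss
  have "((\<lambda>x::'a. complex_of_real (exp (- ((norm x)\<^sup>2 / 2)))) has_derivative
    (\<lambda>v. - 1 * (complex_of_real (p \<bullet> v) * complex_of_real (exp (- ((norm p)\<^sup>2 / 2)))))) (at p)" for p
    unfolding power2_norm_eq_inner
    by (rule has_derivative_eq_rhs, (rule derivative_intros has_derivative_of_real)+)
       (auto simp: fun_eq_iff inner_commute algebra_simps)
  moreover have "gauss_poly (\<lambda>p::'a. - 1 * (complex_of_real (p \<bullet> v) * complex_of_real (exp (- ((norm p)\<^sup>2 / 2)))))" for v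
    by (intro gauss_poly.intros)
  ultimately show ?case
    by (intro exI[of _ "\<lambda>v p. - 1 * (complex_of_real (p \<bullet> v) * complex_of_real (exp (- ((norm p)\<^sup>2 / 2))))"] conjI allI)
next
  case (scale f c)
  then obtain D where "\<forall>p. (f has_derivative (\<lambda>v. D v p)) (at p)" "\<forall>v. gauss_poly (D v)" by blast
  then show ?case by (intro exI[of _ "\<lambda>v p. c * D v p"]) (auto intro: gauss_poly.intros has_derivative_mult_right)
next
  case (add f g)
  then obtain D E where "\<forall>p. (f has_derivative (\<lambda>v. D v p)) (at p)" "\<forall>v. gauss_poly (D v)" 
    "\<forall>p. (g has_derivative (\<lambda>v. E v p)) (at p)" "\<forall>v. gauss_poly (E v)" by blast
  then show ?case by (intro exI[of _ "\<lambda>v p. D v p + E v p"]) (auto intro: gauss_poly.intros has_derivative_add)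
next
  case (coord f w)
  then obtain D where D: "\<And>p. (f has_derivative (\<lambda>v. D v p)) (at p)" "\<And>v. gauss_poly (D v)" by blast
  have "((\<lambda>x. complex_of_real (x \<bullet> w) * f x) has_derivative (\<lambda>v. complex_of_real (p \<bullet> w) * D v p + complex_of_real (v \<bullet> w) * f p)) (at p)" for p
    by (rule has_derivative_eq_rhs, (rule derivative_intros has_derivative_of_real D)+) auto
  moreover have "gauss_poly (\<lambda>p. complex_of_real (p \<bullet> w) * D v p + complex_of_real (v \<bullet> w) * f p)" for v
    by (intro gauss_poly.intros D coord)
  ultimately show ?case
    by (intro exI[of _ "\<lambda>v p. complex_of_real (p \<bullet> w) * D v p + complex_of_real (v \<bullet> w) * f p"] conjI allI)
qed

lemma power_gaussian_bounded: "\<exists>B. \<forall>x::'a::real_normed_vector. norm x ^ k * exp (- ((norm x)\<^sup>2 / 2)) \<le> B"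
proof (cases "k = 0")
  case True then show ?thesis by (intro exI[of _ 1]) auto
next
  case False
  \<comment> \<open>From \<open>(u / k)\<^sup>k \<le> exp u\<close> for \<open>u = |x|\<^sup>2 / 2\<close>.\<close>
  have "norm x ^ k * exp (- ((norm x)\<^sup>2 / 2)) \<le> 1 + (2 * real k) ^ k" for x :: 'a
  proof -
    let ?u = "(norm x)\<^sup>2 / 2"
    have "norm x ^ k \<le> 1 + norm x ^ (2 * k)"
      using norm_le_one_plus_power2[of "norm x ^ k"] by (simp add: power_mult[symmetric] mult.commute)
    also have "norm x ^ (2 * k) = (2 * real k) ^ k * (?u / k) ^ k"
    proof -
      have "(norm x)\<^sup>2 = (2 * real k) * (?u / k)" using False by simp
      then show ?thesis unfolding power_mult power_mult_distrib[symmetric] by (rule arg_cong)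
    qed
    also have "(?u / k) ^ k \<le> (1 + ?u / k) ^ k" by (intro power_mono) auto
    also have "\<dots> \<le> exp ?u" using False by (intro exp_ge_one_plus_x_over_n_power_n) (auto intro: order_trans[of _ 0])
    finally have "norm x ^ k \<le> 1 + (2 * real k) ^ k * exp ?u" by (simp add: mult_left_mono)
    then have "norm x ^ k * exp (- ?u) \<le> (1 + (2 * real k) ^ k * exp ?u) * exp (- ?u)" by (intro mult_right_mono) auto
    also have "\<dots> = exp (- ?u) + (2 * real k) ^ k" by (simp add: algebra_simps mult_exp_exp)
    also have "\<dots> \<le> 1 + (2 * real k) ^ k" by simp
    finally show ?thesis .
  qed
  then show ?thesis by blast
qed

lemma gauss_poly_decay:
  assumes "gauss_poly f" shows "\<exists>B. \<forall>x. norm x ^ k * norm (f x) \<le> B"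
  using assms
proof (induction arbitrary: k)
  case gauss then show ?case using power_gaussian_bounded[of k] by simp
next
  case (scale f c)
  from scale.IH[of k] obtain B where B: "\<And>x. norm x ^ k * norm (f x) \<le> B" by blast
  have "norm x ^ k * norm (c * f x) \<le> norm c * B" for x
    using mult_left_mono[OF B[of x], of "norm c"] by (simp add: norm_mult mult_ac)
  then show ?case by blast
next
  case (add f g)
  from add.IH(1)[of k] add.IH(2)[of k] obtain A B where A: "\<And>x. norm x ^ k * norm (f x) \<le> A" and B: "\<And>x. norm x ^ k * norm (g x) \<le> B" by blast
  have "norm x ^ k * norm (f x + g x) \<le> A + B" for x
    using mult_left_mono[OF norm_triangle_ineq[of "f x" "g x"], of "norm x ^ k"] A[of x] B[of x]
    by (simp add: distrib_left)
  then show ?case by blast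
next
  case (coord f v)
  from coord.IH[of "Suc k"] obtain B where B: "\<And>x. norm x ^ Suc k * norm (f x) \<le> B" by blast
  have "norm x ^ k * norm (complex_of_real (x \<bullet> v) * f x) \<le> norm v * B" for x
  proof -
    have "norm x ^ k * norm (complex_of_real (x \<bullet> v) * f x) \<le> norm x ^ k * ((norm x * norm v) * norm (f x))"
      unfolding norm_mult norm_of_real by (intro mult_left_mono mult_right_mono Cauchy_Schwarz_ineq2) auto
    also have "\<dots> = norm v * (norm x ^ Suc k * norm (f x))" by (simp add: mult_ac)
    also have "\<dots> \<le> norm v * B" by (intro mult_left_mono B) simp
    finally show ?thesis .
  qed
  then show ?case by blast
qed

lemma schwartz_gauss_poly:
  assumes "gauss_poly f" shows "schwartz f"
proof -
  have deriv: "(\<forall>p. f differentiable (at p)) \<and> (\<forall>b\<in>Basis. gauss_poly (pderiv_dir b f))" if g: "gauss_poly f" for f :: "'a \<Rightarrow> complex"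
  proof -
    obtain D where D: "\<And>p. (f has_derivative (\<lambda>v. D v p)) (at p)" "\<And>v. gauss_poly (D v)"
      using gauss_poly_derivative[OF g] by blast
    have "pderiv_dir b f = D b" for b using pderiv_dir_eq[OF D(1)] by blast
    then show ?thesis using D unfolding differentiable_def by auto
  qed
  have it: "gauss_poly (iterated_pderiv vs f)" if "set vs \<subseteq> Basis" for vs
    using that by (induction vs) (auto simp: iterated_pderiv_Cons deriv, simp add: iterated_pderiv_def assms)
  have "smooth f" by (rule smooth_coinduct[of gauss_poly, OF assms deriv])
  moreover have "bounded (range (\<lambda>p. norm p ^ k *\<^sub>R iterated_pderiv vs f p))" if "set vs \<subseteq> Basis" for k vs
    using gauss_poly_decay[OF it[OF that], of k] by (auto simp: bounded_iff)
  ultimately show ?thesis by (simp add: schwartz_def)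
qed

section \<open>Left-invariant fields\<close>

text \<open>
  The left-invariant field with value \<open>(e, 0)\<close> at the origin: \<open>X\<^sub>i\<close> and \<open>Y\<^sub>i\<close> for the elements of the
  standard basis. Indexing by \<open>e\<close> treats both families at once.
\<close>

definition lfield :: "'d::finite phase \<Rightarrow> ('d heis \<Rightarrow> complex) \<Rightarrow> 'd heis \<Rightarrow> complex" where
  "lfield e f g = pderiv_dir (e, 0) f g + (fst g \<bullet>\<^sub>\<sigma> e) *\<^sub>R pderiv_dir (0, 1) f g"

lemma smooth_compact_support_lfield:
  assumes "smooth_compact_support f" shows "smooth_compact_support (lfield e f)"
proof -
  have "bounded_linear (\<lambda>g :: 'a heis. fst g \<bullet>\<^sub>\<sigma> e)"
    unfolding symp_prod_eq_inner_rot by (intro bounded_linear_intros)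
  then show ?thesis
    unfolding lfield_def[abs_def]
    by (intro smooth_compact_support_add smooth_compact_support_linear_mult smooth_compact_support_pderiv_dir assms)
qed

lemma sum_Basis_phase:
  "(\<Sum>e\<in>(Basis :: 'd::finite phase set). F e) = (\<Sum>i\<in>UNIV. F (axis i 1, 0) + F (0, axis i 1))"
proof -
  have vec: "(Basis :: (real ^ 'd) set) = range (\<lambda>i. axis i 1)" by (auto simp: Basis_vec_def)
  have inj: "inj (\<lambda>i::'d. axis i (1::real))" by (auto simp: inj_on_def axis_eq_axis)
  have "(\<Sum>e\<in>(Basis :: 'd phase set). F e) = (\<Sum>u\<in>Basis. F (u, 0)) + (\<Sum>v\<in>Basis. F (0, v))"
    unfolding Basis_prod_def
    by (subst sum.union_disjoint) (auto simp: sum.reindex inj_on_def nonzero_Basis)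
  then show ?thesis unfolding vec by (simp add: sum.reindex[OF inj] sum.distrib)
qed

lemma sublaplacian_eq: "sublaplacian f = (\<lambda>g. \<Sum>e\<in>Basis. lfield e (lfield e f) g)"
proof -
  have X: "X_field i h = lfield (axis i 1, 0) h" for i and h :: "'a heis \<Rightarrow> complex"
    unfolding X_field_def lfield_def symp_prod_def
    by (rule ext) (simp add: case_prod_beta inner_axis' zero_prod_def)
  have Y: "Y_field i h = lfield (0, axis i 1) h" for i and h :: "'a heis \<Rightarrow> complex"
    unfolding Y_field_def lfield_def symp_prod_def
    by (rule ext) (simp add: case_prod_beta inner_axis zero_prod_def)
  from X Y show ?thesis unfolding sublaplacian_def sum_Basis_phase by simp
qed

lemma smooth_compact_support_sublaplacian:
  "smooth_compact_support f \<Longrightarrow> smooth_compact_support (sublaplacian f)"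
  unfolding sublaplacian_eq by (intro smooth_compact_support_sum smooth_compact_support_lfield) auto

lemma pderiv_dir_Pair:
  assumes "smooth f"
  shows "pderiv_dir (v, c) f p = pderiv_dir (v, 0) f p + c *\<^sub>R pderiv_dir (0, 1) f p"
proof -
  have "(v, c) = (v, 0) + c *\<^sub>R (0, 1)" by simp
  then show ?thesis by (metis pderiv_dir_linear[OF assms])
qed

lemma has_vector_derivative_smooth_compose:
  assumes "smooth f" "(c has_vector_derivative c') (at t)"
  shows "((\<lambda>t. f (c t)) has_vector_derivative pderiv_dir c' f (c t)) (at t)"
  using vector_derivative_diff_chain_within[OF assms(2) has_derivative_at_withinI[OF smooth_has_derivative[OF assms(1)]]]
  by (simp add: o_def)

text \<open>
  The group product \<open>g \<cdot> (r \<zeta>, 0)\<close>.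
\<close>

abbreviation ray :: "'d::finite heis \<Rightarrow> real \<Rightarrow> 'd phase \<Rightarrow> 'd heis" where
  "ray g r \<zeta> \<equiv> (fst g + r *\<^sub>R \<zeta>, snd g + r * (fst g \<bullet>\<^sub>\<sigma> \<zeta>))"

lemma ray_support:
  assumes "norm (ray g r \<zeta>) \<le> R" "r \<ge> r0" "r0 > 0"
  shows "norm \<zeta> \<le> (R + norm (fst g)) / r0"
proof -
  have "norm (fst g + r *\<^sub>R \<zeta>) \<le> R" using norm_fst_le assms(1) order_trans by blast
  then have "norm (r *\<^sub>R \<zeta>) \<le> R + norm (fst g)"
    using norm_triangle_ineq4[of "fst g + r *\<^sub>R \<zeta>" "fst g"] by simp
  moreover have "r0 * norm \<zeta> \<le> norm (r *\<^sub>R \<zeta>)" using assms by (simp add: mult_right_mono)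
  ultimately show ?thesis using assms(3) by (simp add: pos_le_divide_eq mult.commute)
qed

section \<open>Derivatives of the oscillatory integral\<close>

lemma has_vector_derivative_integral_compact:
  fixes F F' :: "real \<Rightarrow> 'a::euclidean_space \<Rightarrow> complex"
  assumes cF: "\<And>t. continuous_on UNIV (F t)" and cF': "continuous_on ({a..b} \<times> UNIV) (\<lambda>(t, x). F' t x)"
    and deriv: "\<And>t x. t \<in> {a..b} \<Longrightarrow> ((\<lambda>t. F t x) has_vector_derivative F' t x) (at t)"
    and supp: "\<And>t x. t \<in> {a..b} \<Longrightarrow> F t x \<noteq> 0 \<Longrightarrow> norm x \<le> C"
    and supp': "\<And>t x. t \<in> {a..b} \<Longrightarrow> F' t x \<noteq> 0 \<Longrightarrow> norm x \<le> C"
    and t0: "t0 \<in> {a<..<b}"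
  shows "((\<lambda>t. LINT x|lborel. F t x) has_vector_derivative (LINT x|lborel. F' t0 x)) (at t0)"
proof -
  have "compact ((\<lambda>(t, x). F' t x) ` ({a..b} \<times> cball 0 C))"
    by (intro compact_continuous_image continuous_on_subset[OF cF'] compact_Times) auto
  from compact_imp_bounded[OF this]
  obtain M where "\<forall>y\<in>(\<lambda>(t, x). F' t x) ` ({a..b} \<times> cball 0 C). norm y \<le> M"
    unfolding bounded_iff by blast
  then have M: "norm (F' t x) \<le> M" if "t \<in> {a..b}" "norm x \<le> C" for t x
    using that by force
  show ?thesis
  proof (rule has_vector_derivative_integral[where g = "\<lambda>x. indicator (cball 0 C) x *\<^sub>R M"])
    show "integrable lborel (F t)" if "t \<in> {a<..<b}" for t
      using that supp[of t] cF[of t] by (intro integrable_compactly_supported compactly_supportedI[of _ C]) auto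
    show "norm (F' t x) \<le> indicator (cball 0 C) x *\<^sub>R M" if "t \<in> {a<..<b}" for t x
      using that M[of t x] supp'[of t x] by (cases "F' t x = 0") (auto simp: indicator_def)
    show "integrable lborel (\<lambda>x. indicator (cball 0 C) x *\<^sub>R M)"
      by (rule borel_integrable_compact) auto
    have "continuous_on UNIV (\<lambda>x. F' t0 x)"
      using t0 by (intro continuous_on_compose2[OF cF', of _ "\<lambda>x. (t0, x)", simplified] continuous_intros) auto
    then show "F' t0 \<in> borel_measurable lborel" by (simp add: borel_measurable_continuous_onI)
  qed (use t0 deriv in auto)
qed

lemma continuous_on_ray_compose:
  assumes "continuous_on UNIV \<eta>" "continuous_on A f" "continuous_on A h" "continuous_on A k"
  shows "continuous_on A (\<lambda>x. \<eta> (ray (f x) (h x) (k x)))"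
  by (rule continuous_on_compose2[OF assms(1)]) (auto intro!: continuous_intros assms)

lemma compactly_supported_osc_integrand:
  assumes "compactly_supported \<eta>" "continuous_on UNIV p" "r > 0"
  shows "compactly_supported (\<lambda>\<zeta>. phase_factor \<zeta> * p \<zeta> * \<eta> (ray g r \<zeta>))"
proof -
  obtain R where R: "\<And>x. \<eta> x \<noteq> 0 \<Longrightarrow> norm x \<le> R" and c: "continuous_on UNIV \<eta>"
    using assms(1) by (auto simp: compactly_supported_def)
  show ?thesis
    by (rule compactly_supportedI[where R = "(R + norm (fst g)) / r"])
       (use R assms ray_support[of g r _ R r] in \<open>auto intro!: continuous_intros continuous_on_ray_compose[OF c] continuous_on_subset[OF assms(2)]\<close>)
qed

lemmas integrable_osc_integrand = integrable_compactly_supported[OF compactly_supported_osc_integrand]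

lemma osc_has_vector_derivative_central:
  assumes \<eta>: "smooth_compact_support \<eta>" and p: "continuous_on UNIV p" and r: "r > 0"
  shows "((\<lambda>s. osc p \<eta> r (z, s)) has_vector_derivative osc p (pderiv_dir (0, 1) \<eta>) r (z, s)) (at s)"
proof -
  let ?T = "pderiv_dir (0, 1) \<eta>"
  note sm = smooth_compact_supportD[OF \<eta>]
  note smT = smooth_compact_supportD[OF smooth_compact_support_pderiv_dir[OF \<eta>]]
  obtain R where R: "\<And>x. \<eta> x \<noteq> 0 \<Longrightarrow> norm x \<le> R" using \<eta> by (auto simp: smooth_compact_support_iff)
  have RT: "norm x \<le> R" if "?T x \<noteq> 0" for x using pderiv_dir_support[OF R that] .
  have p': "continuous_on A (\<lambda>x. p (f x))" if "continuous_on A f" for A :: "'x::topological_space set" and f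
    using continuous_on_compose2[OF p that] by simp
  show ?thesis
    unfolding osc_def fst_conv snd_conv
  proof (rule has_vector_derivative_integral_compact[where a = "s - 1" and b = "s + 1" and C = "(R + norm z) / r"])
    show "continuous_on UNIV (\<lambda>\<zeta>. phase_factor \<zeta> * p \<zeta> * \<eta> (z + r *\<^sub>R \<zeta>, t + r * (z \<bullet>\<^sub>\<sigma> \<zeta>)))" for t
      by (intro continuous_intros p continuous_on_compose2[OF sm(4)]) auto
    show "continuous_on ({s - 1..s + 1} \<times> UNIV) (\<lambda>(t, \<zeta>). phase_factor \<zeta> * p \<zeta> * ?T (z + r *\<^sub>R \<zeta>, t + r * (z \<bullet>\<^sub>\<sigma> \<zeta>)))"
      unfolding case_prod_beta by (intro continuous_intros p' continuous_on_compose2[OF smT(4)]) auto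
    show "((\<lambda>t. phase_factor \<zeta> * p \<zeta> * \<eta> (z + r *\<^sub>R \<zeta>, t + r * (z \<bullet>\<^sub>\<sigma> \<zeta>))) has_vector_derivative
       phase_factor \<zeta> * p \<zeta> * ?T (z + r *\<^sub>R \<zeta>, t + r * (z \<bullet>\<^sub>\<sigma> \<zeta>))) (at t)" for t \<zeta>
    proof (intro has_vector_derivative_mult_right has_vector_derivative_smooth_compose sm)
      have "((\<lambda>t. t + r * (z \<bullet>\<^sub>\<sigma> \<zeta>)) has_vector_derivative 1) (at t)"
        by (auto intro!: derivative_eq_intros)
      from has_vector_derivative_Pair[OF has_vector_derivative_const this]
      show "((\<lambda>t. (z + r *\<^sub>R \<zeta>, t + r * (z \<bullet>\<^sub>\<sigma> \<zeta>))) has_vector_derivative (0, 1)) (at t)" .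
    qed
    show "norm \<zeta> \<le> (R + norm z) / r" if "phase_factor \<zeta> * p \<zeta> * \<eta> (z + r *\<^sub>R \<zeta>, t + r * (z \<bullet>\<^sub>\<sigma> \<zeta>)) \<noteq> 0" for t \<zeta>
      using ray_support[of "(z, t)" r \<zeta> R r] R that r by auto
    show "norm \<zeta> \<le> (R + norm z) / r" if "phase_factor \<zeta> * p \<zeta> * ?T (z + r *\<^sub>R \<zeta>, t + r * (z \<bullet>\<^sub>\<sigma> \<zeta>)) \<noteq> 0" for t \<zeta>
      using ray_support[of "(z, t)" r \<zeta> R r] RT that r by auto
  qed auto
qed

text \<open>
  The derivative of \<open>\<eta>\<close> along a ray uses the symplectic form at the base point \<open>fst g\<close>, the
  left-invariant field the one at the end point; the last term is the difference.
\<close>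

lemma pderiv_dir_ray:
  assumes "smooth \<eta>"
  shows "pderiv_dir (e, fst g \<bullet>\<^sub>\<sigma> e) \<eta> (ray g r \<zeta>) =
    lfield e \<eta> (ray g r \<zeta>) - (r * (\<zeta> \<bullet> rot e)) *\<^sub>R pderiv_dir (0, 1) \<eta> (ray g r \<zeta>)"
  unfolding lfield_def
  by (subst pderiv_dir_Pair[OF assms, of e "fst g \<bullet>\<^sub>\<sigma> e"]) (simp add: symp_prod_simps symp_prod_eq_inner_rot[symmetric] scaleR_add_left)

text \<open>
  In the direction \<open>\<zeta>\<close> itself the two forms compared in the preceding lemma agree, since
  \<open>\<zeta> \<bullet>\<^sub>\<sigma> \<zeta> = 0\<close>; hence only left-invariant fields appear.
\<close>

lemma osc_has_vector_derivative_radius: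
  assumes \<eta>: "smooth_compact_support \<eta>" and p: "continuous_on UNIV p" and r: "r > 0"
  shows "((\<lambda>r. osc p \<eta> r g) has_vector_derivative
    (\<Sum>e\<in>Basis. osc (\<lambda>\<zeta>. p \<zeta> * complex_of_real (\<zeta> \<bullet> e)) (lfield e \<eta>) r g)) (at r)"
proof -
  note sm = smooth_compact_supportD[OF \<eta>]
  define D where "D t \<zeta> = (\<Sum>e\<in>Basis. (\<zeta> \<bullet> e) *\<^sub>R lfield e \<eta> (ray g t \<zeta>))" for t \<zeta>
  obtain R where R: "\<And>x. \<eta> x \<noteq> 0 \<Longrightarrow> norm x \<le> R" using \<eta> by (auto simp: smooth_compact_support_iff)
  have RT: "norm x \<le> R" if "lfield e \<eta> x \<noteq> 0" for x e
    using that pderiv_dir_support[where f = \<eta> and v = "(e, 0)" and x = x, OF R]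
      pderiv_dir_support[where f = \<eta> and v = "(0, 1)" and x = x, OF R]
    unfolding lfield_def by (metis add_0 scaleR_zero_right)
  have p': "continuous_on A (\<lambda>x. p (f x))" if "continuous_on A f" for A :: "'x::topological_space set" and f
    using continuous_on_compose2[OF p that] by simp
  have "((\<lambda>r. LINT \<zeta>|lborel. phase_factor \<zeta> * p \<zeta> * \<eta> (ray g r \<zeta>)) has_vector_derivative
     (LINT \<zeta>|lborel. phase_factor \<zeta> * p \<zeta> * D r \<zeta>)) (at r)"
  proof (rule has_vector_derivative_integral_compact[where a = "r / 2" and b = "2 * r" and C = "(R + norm (fst g)) / (r / 2)"])
    show "continuous_on UNIV (\<lambda>\<zeta>. phase_factor \<zeta> * p \<zeta> * \<eta> (ray g t \<zeta>))" for t
      by (intro continuous_intros p continuous_on_compose2[OF sm(4)]) auto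
    show "continuous_on ({r / 2..2 * r} \<times> UNIV) (\<lambda>(t, \<zeta>). phase_factor \<zeta> * p \<zeta> * D t \<zeta>)"
      unfolding case_prod_beta D_def
      by (intro continuous_intros p' continuous_on_compose2[OF smooth_compact_supportD(4)[OF smooth_compact_support_lfield[OF \<eta>]]]) auto
    show "((\<lambda>t. phase_factor \<zeta> * p \<zeta> * \<eta> (ray g t \<zeta>)) has_vector_derivative phase_factor \<zeta> * p \<zeta> * D t \<zeta>) (at t)" for t \<zeta>
    proof (rule has_vector_derivative_mult_right, rule has_vector_derivative_eq_rhs[OF has_vector_derivative_smooth_compose[OF sm(1)]])
      have "((\<lambda>t. snd g + t * (fst g \<bullet>\<^sub>\<sigma> \<zeta>)) has_vector_derivative fst g \<bullet>\<^sub>\<sigma> \<zeta>) (at t)"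
        "((\<lambda>t. fst g + t *\<^sub>R \<zeta>) has_vector_derivative \<zeta>) (at t)"
        by (auto intro!: derivative_eq_intros)
      from has_vector_derivative_Pair[OF this(2,1)]
      show "((\<lambda>t. ray g t \<zeta>) has_vector_derivative (\<zeta>, fst g \<bullet>\<^sub>\<sigma> \<zeta>)) (at t)" .
      have lin: "linear (\<lambda>e. lfield e \<eta> q)" for q
      proof (rule linearI)
        have "pderiv_dir (a + b, 0) \<eta> q = pderiv_dir (a, 0) \<eta> q + pderiv_dir (b, 0) \<eta> q" for a b
          using pderiv_dir_linear(1)[OF sm(1), of "(a, 0)" "(b, 0)" q] by simp
        then show "lfield (a + b) \<eta> q = lfield a \<eta> q + lfield b \<eta> q" for a b
          by (simp add: lfield_def symp_prod_simps scaleR_add_left)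
        have "pderiv_dir (c *\<^sub>R a, 0) \<eta> q = c *\<^sub>R pderiv_dir (a, 0) \<eta> q" for a c
          using pderiv_dir_linear(2)[OF sm(1), of c "(a, 0)" q] by simp
        then show "lfield (c *\<^sub>R a) \<eta> q = c *\<^sub>R lfield a \<eta> q" for a c
          by (simp add: lfield_def symp_prod_simps scaleR_add_right)
      qed
      have "pderiv_dir (\<zeta>, fst g \<bullet>\<^sub>\<sigma> \<zeta>) \<eta> (ray g t \<zeta>) = lfield \<zeta> \<eta> (ray g t \<zeta>)"
        unfolding pderiv_dir_ray[OF sm(1)] by simp
      also have "\<dots> = D t \<zeta>"
        unfolding D_def by (subst euclidean_representation[of \<zeta>, symmetric]) (simp only: linear_sum[OF lin] linear_scale[OF lin])
      finally show "pderiv_dir (\<zeta>, fst g \<bullet>\<^sub>\<sigma> \<zeta>) \<eta> (ray g t \<zeta>) = D t \<zeta>" .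
    qed
    show "norm \<zeta> \<le> (R + norm (fst g)) / (r / 2)" if "t \<in> {r / 2..2 * r}" "phase_factor \<zeta> * p \<zeta> * \<eta> (ray g t \<zeta>) \<noteq> 0" for t \<zeta>
      using R that r by (intro ray_support[of g t]) auto
    show "norm \<zeta> \<le> (R + norm (fst g)) / (r / 2)" if "t \<in> {r / 2..2 * r}" "phase_factor \<zeta> * p \<zeta> * D t \<zeta> \<noteq> 0" for t \<zeta>
    proof -
      have "\<exists>e. lfield e \<eta> (ray g t \<zeta>) \<noteq> 0"
      proof (rule ccontr)
        assume "\<not> ?thesis"
        then have "lfield e \<eta> (ray g t \<zeta>) = 0" for e by blast
        then have "D t \<zeta> = 0" by (simp add: D_def)
        then show False using that(2) by simp
      qed
      then have "norm (ray g t \<zeta>) \<le> R" using RT by blast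
      then show ?thesis using that(1) r by (intro ray_support[of g t]) auto
    qed
  qed (use r in auto)
  also have "(LINT \<zeta>|lborel. phase_factor \<zeta> * p \<zeta> * D r \<zeta>) = (LINT \<zeta>|lborel. (\<Sum>e\<in>Basis. phase_factor \<zeta> * (p \<zeta> * complex_of_real (\<zeta> \<bullet> e)) * lfield e \<eta> (ray g r \<zeta>)))"
    unfolding D_def by (simp add: sum_distrib_left scaleR_conv_of_real mult.assoc)
  also have "\<dots> = (\<Sum>e\<in>Basis. osc (\<lambda>\<zeta>. p \<zeta> * complex_of_real (\<zeta> \<bullet> e)) (lfield e \<eta>) r g)"
    unfolding osc_def
    by (intro Bochner_Integration.integral_sum integrable_osc_integrand smooth_compact_supportD(2) smooth_compact_support_lfield \<eta> r continuous_intros p)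
  finally show ?thesis unfolding osc_def .
qed

text \<open>
  Integration by parts, starting from \<open>(\<zeta> \<bullet> e) exp (i |\<zeta>|\<^sup>2 / 2) = - i \<partial>\<^sub>e exp (i |\<zeta>|\<^sup>2 / 2)\<close>.
\<close>

lemma osc_linear_weight:
  assumes \<eta>: "smooth_compact_support \<eta>" and r: "r > 0"
  shows "osc_lin e \<eta> r g = \<i> * (r * osc1 (lfield e \<eta>) r g
     - r\<^sup>2 * osc_lin (rot e) (pderiv_dir (0, 1) \<eta>) r g)"
proof -
  let ?T = "pderiv_dir (0, 1) \<eta>"
  note sm = smooth_compact_supportD[OF \<eta>]
  note smT = smooth_compact_supportD[OF smooth_compact_support_pderiv_dir[OF \<eta>]]
  note smL = smooth_compact_supportD[OF smooth_compact_support_lfield[OF \<eta>]]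
  define H' where "H' \<zeta> = \<i> * (phase_factor \<zeta> * complex_of_real (\<zeta> \<bullet> e) * \<eta> (ray g r \<zeta>)) + r * (phase_factor \<zeta> * 1 * lfield e \<eta> (ray g r \<zeta>))
     - r\<^sup>2 * (phase_factor \<zeta> * complex_of_real (\<zeta> \<bullet> rot e) * ?T (ray g r \<zeta>))" for \<zeta>
  have int: "integrable lborel (\<lambda>\<zeta>. phase_factor \<zeta> * complex_of_real (\<zeta> \<bullet> e) * \<eta> (ray g r \<zeta>))"
      "integrable lborel (\<lambda>\<zeta>. phase_factor \<zeta> * 1 * lfield e \<eta> (ray g r \<zeta>))"
      "integrable lborel (\<lambda>\<zeta>. phase_factor \<zeta> * complex_of_real (\<zeta> \<bullet> rot e) * ?T (ray g r \<zeta>))"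
    by (intro integrable_osc_integrand sm smT smL r continuous_intros)+
  have "(LINT \<zeta>|lborel. H' \<zeta>) = 0"
  proof (rule integral_directional_derivative_zero[where H = "\<lambda>\<zeta>. phase_factor \<zeta> * 1 * \<eta> (ray g r \<zeta>)" and u = e])
    show "integrable lborel (\<lambda>\<zeta>. phase_factor \<zeta> * 1 * \<eta> (ray g r \<zeta>))"
      by (intro integrable_osc_integrand sm r continuous_intros)
    show "integrable lborel H'" unfolding H'_def using int by simp
    show "continuous_on UNIV (\<lambda>t. H' (\<zeta> + t *\<^sub>R e))" for \<zeta>
      unfolding H'_def
      by (intro continuous_intros continuous_on_compose2[OF sm(4)] continuous_on_compose2[OF smT(4)] continuous_on_compose2[OF smL(4)]) auto
    show "((\<lambda>t. phase_factor (\<zeta> + t *\<^sub>R e) * 1 * \<eta> (ray g r (\<zeta> + t *\<^sub>R e))) has_vector_derivative H' (\<zeta> + t *\<^sub>R e)) (at t)" for \<zeta> t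
    proof -
      let ?x = "\<zeta> + t *\<^sub>R e"
      have n: "(norm (\<zeta> + t *\<^sub>R e))\<^sup>2 = (norm \<zeta>)\<^sup>2 + 2 * t * (\<zeta> \<bullet> e) + t\<^sup>2 * (norm e)\<^sup>2" for t
        unfolding power2_norm_eq_inner by (simp add: inner_add_left inner_add_right inner_commute power2_eq_square)
      have "((\<lambda>t. (norm (\<zeta> + t *\<^sub>R e))\<^sup>2 / 2) has_real_derivative (?x \<bullet> e)) (at t)"
        unfolding n by (auto intro!: derivative_eq_intros simp: inner_add_left power2_norm_eq_inner)
      then have 1: "((\<lambda>t. phase_factor (\<zeta> + t *\<^sub>R e)) has_vector_derivative (\<i> * complex_of_real (?x \<bullet> e)) * phase_factor ?x) (at t)"
        by (intro has_vector_derivative_exp has_vector_derivative_mult_right has_vector_derivative_complex_of_real)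
      have "((\<lambda>t. snd g + r * (fst g \<bullet>\<^sub>\<sigma> (\<zeta> + t *\<^sub>R e))) has_vector_derivative r * (fst g \<bullet>\<^sub>\<sigma> e)) (at t)"
        "((\<lambda>t. fst g + r *\<^sub>R (\<zeta> + t *\<^sub>R e)) has_vector_derivative r *\<^sub>R e) (at t)"
        unfolding symp_prod_simps by (auto intro!: derivative_eq_intros)
      from has_vector_derivative_smooth_compose[OF sm(1) has_vector_derivative_Pair[OF this(2,1)]]
      have 2: "((\<lambda>t. \<eta> (ray g r (\<zeta> + t *\<^sub>R e))) has_vector_derivative pderiv_dir (r *\<^sub>R e, r * (fst g \<bullet>\<^sub>\<sigma> e)) \<eta> (ray g r ?x)) (at t)" .
      have "(r *\<^sub>R e, r * (fst g \<bullet>\<^sub>\<sigma> e)) = r *\<^sub>R (e, fst g \<bullet>\<^sub>\<sigma> e)" by simp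
      then have 3: "pderiv_dir (r *\<^sub>R e, r * (fst g \<bullet>\<^sub>\<sigma> e)) \<eta> (ray g r ?x) = r *\<^sub>R (lfield e \<eta> (ray g r ?x) - (r * (?x \<bullet> rot e)) *\<^sub>R ?T (ray g r ?x))"
        using pderiv_dir_linear(2)[OF sm(1)] pderiv_dir_ray[OF sm(1)] by metis
      show ?thesis
        unfolding mult_1_right
        by (rule has_vector_derivative_eq_rhs[OF has_vector_derivative_mult[OF 1 2]])
           (simp only: 3 H'_def, simp add: scaleR_conv_of_real algebra_simps power2_eq_square)
    qed
  qed
  then have "\<i> * osc_lin e \<eta> r g + r * osc1 (lfield e \<eta>) r g
     - r\<^sup>2 * osc_lin (rot e) ?T r g = 0"
    unfolding H'_def osc_def using int by simp
  moreover have "A = \<i> * (B - C)" if "\<i> * A + B - C = 0" for A B C :: complex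
  proof -
    have "\<i> * A = - (B - C)" using that by (simp add: algebra_simps eq_neg_iff_add_eq_0)
    then have "\<i> * (\<i> * A) = \<i> * - (B - C)" by simp
    then have "- A = - (\<i> * (B - C))" by (simp only: mult.assoc[symmetric] i_squared mult_minus_right mult_minus1)
    then show ?thesis by simp
  qed
  ultimately show ?thesis unfolding of_real_power by blast
qed

text \<open>
  A second integration by parts brings back the direction \<open>e\<close>, because \<open>rot\<close> squares to \<open>-1\<close>. The
  sign makes the operator \<open>1 - r\<^sup>4 \<partial>\<^sub>s\<^sup>2\<close> on the left positive.
\<close>

lemma osc_linear_weight_elliptic:
  assumes \<eta>: "smooth_compact_support \<eta>" and r: "r > 0"
  defines "T \<equiv> pderiv_dir (0, 1)"
  shows "osc_lin e \<eta> r g - r ^ 4 *\<^sub>R osc_lin e (T (T \<eta>)) r g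
    = \<i> * r * osc1 (lfield e \<eta>) r g + r ^ 3 * osc1 (lfield (rot e) (T \<eta>)) r g"
proof -
  have neg: "osc_lin (rot (rot e)) (T (T \<eta>)) r g = - osc_lin e (T (T \<eta>)) r g"
    unfolding osc_def by simp
  have "osc_lin (rot e) (T \<eta>) r g = \<i> * (r * osc1 (lfield (rot e) (T \<eta>)) r g
     + r\<^sup>2 * osc_lin e (T (T \<eta>)) r g)"
    using osc_linear_weight[OF smooth_compact_support_pderiv_dir[OF \<eta>] r, of "rot e" "(0, 1)" g] neg unfolding T_def by simp
  then show ?thesis
    using osc_linear_weight[OF \<eta> r, of e g] unfolding T_def[symmetric]
    by (simp add: scaleR_conv_of_real algebra_simps power2_eq_square power3_eq_cube power4_eq_xxxx)
qed

section \<open>Powers of the time step in \<open>L\<^sup>2\<close>\<close>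

text \<open>
  The squared \<open>L\<^sup>2\<close> norm of \<open>F t\<close> is \<open>O(t\<^sup>k)\<close> on \<open>(0, 1]\<close>, so the norm itself is \<open>O(t\<^bsup>k/2\<^esup>)\<close>.
\<close>

definition energy_O :: "nat \<Rightarrow> (real \<Rightarrow> 'a::euclidean_space \<Rightarrow> complex) \<Rightarrow> bool" where
  "energy_O k F \<longleftrightarrow> (\<forall>t. F t \<in> borel_measurable borel) \<and>
     (\<exists>C\<ge>0. \<forall>t. 0 < t \<longrightarrow> t \<le> 1 \<longrightarrow> energy (F t) \<le> ennreal (C * t ^ k))"

lemma energy_add_le:
  assumes [measurable]: "f \<in> borel_measurable borel" "g \<in> borel_measurable borel"
  shows "energy (\<lambda>x. f x + g x) \<le> 2 * energy f + 2 * energy g"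
proof -
  have "energy (\<lambda>x. f x + g x) \<le> (\<integral>\<^sup>+x. 2 * ennreal ((norm (f x))\<^sup>2) + 2 * ennreal ((norm (g x))\<^sup>2) \<partial>lborel)"
    unfolding energy_def
  proof (rule nn_integral_mono)
    fix x
    have "(norm (f x + g x))\<^sup>2 \<le> (norm (f x) + norm (g x))\<^sup>2" by (intro power_mono norm_triangle_ineq) auto
    also have "\<dots> \<le> 2 * (norm (f x))\<^sup>2 + 2 * (norm (g x))\<^sup>2"
      using zero_le_power2[of "norm (f x) - norm (g x)"] by (simp add: power2_eq_square algebra_simps)
    finally have "ennreal ((norm (f x + g x))\<^sup>2) \<le> ennreal (2 * (norm (f x))\<^sup>2 + 2 * (norm (g x))\<^sup>2)" by (rule ennreal_leI)
    also have "\<dots> = 2 * ennreal ((norm (f x))\<^sup>2) + 2 * ennreal ((norm (g x))\<^sup>2)"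
      by (subst ennreal_plus) (auto simp: ennreal_mult)
    finally show "ennreal ((norm (f x + g x))\<^sup>2) \<le> 2 * ennreal ((norm (f x))\<^sup>2) + 2 * ennreal ((norm (g x))\<^sup>2)" .
  qed
  also have "\<dots> = 2 * energy f + 2 * energy g"
    unfolding energy_def by (subst nn_integral_add, measurable, subst nn_integral_cmult, measurable, subst nn_integral_cmult) measurable
  finally show ?thesis .
qed

lemma energy_O_measurable: "energy_O k F \<Longrightarrow> F t \<in> borel_measurable borel"
  by (simp add: energy_O_def)

lemma energy_O_add:
  assumes "energy_O k F" "energy_O k G" shows "energy_O k (\<lambda>t x. F t x + G t x)"
proof -
  obtain C1 C2 where C: "C1 \<ge> 0" "C2 \<ge> 0" "\<And>t. 0 < t \<Longrightarrow> t \<le> 1 \<Longrightarrow> energy (F t) \<le> ennreal (C1 * t ^ k)"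
     "\<And>t. 0 < t \<Longrightarrow> t \<le> 1 \<Longrightarrow> energy (G t) \<le> ennreal (C2 * t ^ k)"
    using assms by (auto simp: energy_O_def)
  note m = energy_O_measurable[OF assms(1)] energy_O_measurable[OF assms(2)]
  have "energy (\<lambda>x. F t x + G t x) \<le> ennreal ((2 * C1 + 2 * C2) * t ^ k)" if t: "0 < t" "t \<le> 1" for t
  proof -
    have "energy (\<lambda>x. F t x + G t x) \<le> 2 * energy (F t) + 2 * energy (G t)" by (rule energy_add_le[OF m])
    also have "\<dots> \<le> 2 * ennreal (C1 * t ^ k) + 2 * ennreal (C2 * t ^ k)"
      by (intro add_mono mult_left_mono C t) auto
    also have "\<dots> = ennreal (2 * (C1 * t ^ k) + 2 * (C2 * t ^ k))"
      using C t by (subst ennreal_plus) (auto simp: ennreal_mult)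
    finally show ?thesis by (simp add: algebra_simps)
  qed
  then show ?thesis using C m by (auto simp: energy_O_def intro!: exI[of _ "2 * C1 + 2 * C2"])
qed

lemma energy_O_zero: "energy_O k (\<lambda>_ _. 0)"
  by (auto simp: energy_O_def energy_def intro!: exI[of _ 0])

lemma energy_O_sum: "finite I \<Longrightarrow> (\<And>i. i \<in> I \<Longrightarrow> energy_O k (F i)) \<Longrightarrow> energy_O k (\<lambda>t x. \<Sum>i\<in>I. F i t x)"
  by (induction I rule: finite_induct) (auto simp: energy_O_zero energy_O_add)

lemma energy_O_scale:
  assumes "energy_O k F" shows "energy_O (k + 2 * j) (\<lambda>t x. c * complex_of_real (t ^ j) * F t x)"
proof -
  obtain C where C: "C \<ge> 0" "\<And>t. 0 < t \<Longrightarrow> t \<le> 1 \<Longrightarrow> energy (F t) \<le> ennreal (C * t ^ k)"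
    using assms by (auto simp: energy_O_def)
  note m [measurable] = energy_O_measurable[OF assms(1)]
  have "energy (\<lambda>x. c * complex_of_real (t ^ j) * F t x) \<le> ennreal (((norm c)\<^sup>2 * C) * t ^ (k + 2 * j))" if t: "0 < t" "t \<le> 1" for t
  proof -
    have "energy (\<lambda>x. c * complex_of_real (t ^ j) * F t x) = ennreal ((norm (c * complex_of_real (t ^ j)))\<^sup>2) * energy (F t)"
      by (rule energy_scale) measurable
    also have "\<dots> \<le> ennreal ((norm (c * complex_of_real (t ^ j)))\<^sup>2) * ennreal (C * t ^ k)"
      by (intro mult_left_mono C t) auto
    also have "\<dots> = ennreal ((norm (c * complex_of_real (t ^ j)))\<^sup>2 * (C * t ^ k))"
      using C t by (intro ennreal_mult[symmetric]) auto
    also have "(norm (c * complex_of_real (t ^ j)))\<^sup>2 * (C * t ^ k) = ((norm c)\<^sup>2 * C) * t ^ (k + 2 * j)"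
      using t by (simp add: norm_mult norm_power power_mult_distrib power_add power_mult power2_eq_square)
    finally show ?thesis .
  qed
  then show ?thesis using C(1) unfolding energy_O_def
    by (intro conjI allI exI[of _ "(norm c)\<^sup>2 * C"]) auto
qed

lemma energy_O_mono: "energy_O k F \<Longrightarrow> j \<le> k \<Longrightarrow> energy_O j F"
  unfolding energy_O_def
proof (elim conjE exE, intro conjI)
  fix C assume *: "0 \<le> C" "\<forall>t. 0 < t \<longrightarrow> t \<le> 1 \<longrightarrow> energy (F t) \<le> ennreal (C * t ^ k)" "j \<le> k"
  have "energy (F t) \<le> ennreal (C * t ^ j)" if "0 < t" "t \<le> 1" for t
  proof -
    have "C * t ^ k \<le> C * t ^ j" using * that by (intro mult_left_mono power_decreasing) auto
    then show ?thesis using * that by (meson ennreal_leI order_trans)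
  qed
  with * show "\<exists>C\<ge>0. \<forall>t. 0 < t \<longrightarrow> t \<le> 1 \<longrightarrow> energy (F t) \<le> ennreal (C * t ^ j)" by blast
qed auto

text \<open>
  Integration over \<open>[0, r]\<close> gains a factor \<open>r\<close> in norm. The lower end \<open>0\<close> is reached by Fatou's
  lemma, where pointwise convergence suffices.
\<close>

lemma energy_O_antiderivative:
  fixes H F :: "real \<Rightarrow> 'a::euclidean_space \<Rightarrow> complex"
  assumes F: "energy_O k F" and mF: "(\<lambda>(t, x). F t x) \<in> borel_measurable borel"
    and mH: "\<And>r. H r \<in> borel_measurable borel"
    and diff: "\<And>r r0 x. 0 < r0 \<Longrightarrow> r0 \<le> r \<Longrightarrow> r \<le> 1 \<Longrightarrow> H r x - H r0 x = (LINT t|lborel. indicator {r0..r} t *\<^sub>R F t x)"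
    and lim: "\<And>x. ((\<lambda>r. H r x) \<longlongrightarrow> 0) (at_right 0)"
  shows "energy_O (k + 2) H"
proof -
  obtain C where C: "C \<ge> 0" "\<And>t. 0 < t \<Longrightarrow> t \<le> 1 \<Longrightarrow> energy (F t) \<le> ennreal (C * t ^ k)"
    using F by (auto simp: energy_O_def)
  have "energy (H r) \<le> ennreal (C * r ^ (k + 2))" if r: "0 < r" "r \<le> 1" for r
  proof (rule energy_limit_le[where f = "\<lambda>n x. H r x - H (r * inverse (real (Suc n))) x"])
    show "(\<lambda>x. H r x - H (r * inverse (real (Suc n))) x) \<in> borel_measurable lborel" for n
      using mH by simp
    have "filterlim (\<lambda>n. r * inverse (real (Suc n))) (at_right 0) sequentially"
      using tendsto_mult[OF tendsto_const[of r] LIMSEQ_inverse_real_of_nat] r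
      by (intro filterlim_at[THEN iffD2] conjI) auto
    then have "(\<lambda>n. H r x - H (r * inverse (real (Suc n))) x) \<longlonglongrightarrow> H r x - 0" for x
      by (intro tendsto_intros filterlim_compose[OF lim])
    then show "AE x in lborel. (\<lambda>n. H r x - H (r * inverse (real (Suc n))) x) \<longlonglongrightarrow> H r x" by simp
    have "energy (\<lambda>x. H r x - H (r * inverse (real (Suc n))) x) \<le> ennreal (C * r ^ (k + 2))" for n
    proof -
      let ?r0 = "r * inverse (real (Suc n))"
      have r0: "0 < ?r0" "?r0 \<le> r" using r by (auto simp: field_simps)
      have "energy (\<lambda>x. H r x - H ?r0 x) = energy (\<lambda>x. LINT t|lborel. indicator {?r0..r} t *\<^sub>R F t x)"
        using diff[OF r0 r(2)] by simp
      also have "\<dots> \<le> ennreal ((r - ?r0)\<^sup>2) * ennreal (C * r ^ k)"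
      proof (rule energy_integral_le[OF mF r0(2)])
        fix t assume t: "t \<in> {?r0..r}"
        then have t': "0 < t" "t \<le> r" using r0(1) by (auto simp del: of_nat_Suc intro: less_le_trans)
        then have "C * t ^ k \<le> C * r ^ k" using C(1) by (intro mult_left_mono power_mono) auto
        then show "energy (F t) \<le> ennreal (C * r ^ k)" using C(2)[of t] t' r by (meson ennreal_leI order_trans)
      qed
      also have "\<dots> = ennreal ((r - ?r0)\<^sup>2 * (C * r ^ k))"
        using C r by (intro ennreal_mult[symmetric]) auto
      also have "\<dots> \<le> ennreal (r\<^sup>2 * (C * r ^ k))"
        using C r r0 by (intro ennreal_leI mult_right_mono power_mono) auto
      also have "r\<^sup>2 * (C * r ^ k) = C * r ^ (k + 2)" by (simp only: power_add mult_ac)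
      finally show ?thesis .
    qed
    then show "\<forall>\<^sub>F n in sequentially. energy (\<lambda>x. H r x - H (r * inverse (real (Suc n))) x) \<le> ennreal (C * r ^ (k + 2))" by simp
  qed
  then show ?thesis using C mH by (auto simp: energy_O_def)
qed

lemma energy_le_second_difference:
  fixes Q Q' Q'' :: "'d::finite heis \<Rightarrow> complex"
  assumes [measurable]: "Q \<in> borel_measurable borel" "Q'' \<in> borel_measurable borel"
    and d1: "\<And>z s. ((\<lambda>s. Q (z, s)) has_vector_derivative Q' (z, s)) (at s)"
    and d2: "\<And>z s. ((\<lambda>s. Q' (z, s)) has_vector_derivative Q'' (z, s)) (at s)"
    and cont: "\<And>z. continuous_on UNIV (\<lambda>s. Q'' (z, s))"
    and supp: "\<And>z. \<exists>a b. \<forall>s. s \<notin> {a..b} \<longrightarrow> Q (z, s) = 0" and c: "c \<ge> 0"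
  shows "energy Q \<le> energy (\<lambda>g. Q g - c *\<^sub>R Q'' g)"
proof -
  have "energy Q = (\<integral>\<^sup>+z. \<integral>\<^sup>+s. ennreal ((norm (Q (z, s)))\<^sup>2) \<partial>lborel \<partial>lborel)"
    unfolding energy_def by (rule nn_integral_lborel_pair) measurable
  also have "\<dots> \<le> (\<integral>\<^sup>+z. \<integral>\<^sup>+s. ennreal ((norm (Q (z, s) - c *\<^sub>R Q'' (z, s)))\<^sup>2) \<partial>lborel \<partial>lborel)"
  proof (rule nn_integral_mono)
    fix z
    obtain a b where "\<And>s. s \<notin> {a..b} \<Longrightarrow> Q (z, s) = 0" using supp[of z] by blast
    from nn_integral_le_second_difference[OF d1 d2 cont this c]
    show "(\<integral>\<^sup>+s. ennreal ((norm (Q (z, s)))\<^sup>2) \<partial>lborel) \<le> (\<integral>\<^sup>+s. ennreal ((norm (Q (z, s) - c *\<^sub>R Q'' (z, s)))\<^sup>2) \<partial>lborel)" .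
  qed
  also have "\<dots> = energy (\<lambda>g. Q g - c *\<^sub>R Q'' g)"
    unfolding energy_def by (rule nn_integral_lborel_pair[symmetric]) measurable
  finally show ?thesis .
qed

section \<open>The short-time expansion\<close>

text \<open>
  On the support of the integrand \<open>w = z + r \<zeta>\<close> and \<open>s + r (z \<bullet>\<^sub>\<sigma> \<zeta>) = s + z \<bullet>\<^sub>\<sigma> w\<close> are bounded, and so
  is \<open>s\<close> for fixed \<open>z\<close>.
\<close>

lemma osc_central_support:
  assumes "\<And>x. \<eta> x \<noteq> 0 \<Longrightarrow> norm x \<le> R" and r: "r > 0"
  shows "\<exists>a b. \<forall>s. s \<notin> {a..b} \<longrightarrow> osc p \<eta> r (z, s) = 0"
proof -
  let ?B = "\<bar>R\<bar> + norm z * \<bar>R\<bar>"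
  have "osc p \<eta> r (z, s) = 0" if s: "s \<notin> {- ?B..?B}" for s
  proof -
    have "\<eta> (ray (z, s) r \<zeta>) = 0" for \<zeta>
    proof (rule ccontr)
      let ?w = "z + r *\<^sub>R \<zeta>"
      assume "\<eta> (ray (z, s) r \<zeta>) \<noteq> 0"
      then have "norm (ray (z, s) r \<zeta>) \<le> R" by (rule assms)
      then have R: "norm ?w \<le> R" "\<bar>s + r * (z \<bullet>\<^sub>\<sigma> \<zeta>)\<bar> \<le> R"
        using norm_fst_le[of ?w "s + r * (z \<bullet>\<^sub>\<sigma> \<zeta>)"] norm_snd_le[of "s + r * (z \<bullet>\<^sub>\<sigma> \<zeta>)" ?w] by auto
      have nrot: "norm (rot u) = norm u" for u :: "'a phase"
        by (simp add: rot_def norm_prod_def add.commute)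
      have "\<bar>z \<bullet>\<^sub>\<sigma> ?w\<bar> \<le> norm z * norm ?w"
        using Cauchy_Schwarz_ineq2[of z "rot ?w"] by (simp add: symp_prod_eq_inner_rot nrot)
      also have "\<dots> \<le> norm z * \<bar>R\<bar>" using R by (intro mult_left_mono) auto
      finally have "\<bar>z \<bullet>\<^sub>\<sigma> ?w\<bar> \<le> norm z * \<bar>R\<bar>" .
      then have "\<bar>s\<bar> \<le> ?B" using R(2) by (simp add: symp_prod_simps)
      then show False using s by auto
    qed
    then show ?thesis by (simp add: osc_def)
  qed
  then show ?thesis by blast
qed

lemma energy_O_osc:
  fixes \<eta> :: "'d::finite heis \<Rightarrow> complex"
  assumes \<eta>: "smooth_compact_support \<eta>" shows "energy_O 0 (osc1 \<eta>)"
proof -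
  note sm = smooth_compact_supportD[OF \<eta>]
  have "energy (osc1 \<eta> r) \<le> ennreal ((2 * pi) ^ (2 * CARD('d)) * (norm (abs_L2 \<eta>))\<^sup>2)" if "r > 0" for r
    using energy_osc_le[OF sm(2) that] by (simp add: energy_eq_norm[OF sm(3)] ennreal_mult)
  then show ?thesis
    unfolding energy_O_def
    by (intro conjI allI borel_measurable_osc_at continuous_on_const sm exI[of _ "(2 * pi) ^ (2 * CARD('d)) * (norm (abs_L2 \<eta>))\<^sup>2"]) auto
qed

text \<open>
  The factor \<open>r\<close> gained from the oscillation compensates the unbounded weight. The elliptic identity
  bounds \<open>(1 - r\<^sup>4 \<partial>\<^sub>s\<^sup>2) Q\<close> for the weighted integral \<open>Q\<close>, and this operator is bounded below on
  each line in the direction \<open>s\<close>.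
\<close>

lemma energy_O_osc_linear:
  fixes \<eta> :: "'d::finite heis \<Rightarrow> complex"
  assumes \<eta>: "smooth_compact_support \<eta>" shows "energy_O 2 (osc_lin e \<eta>)"
proof -
  let ?p = "\<lambda>\<zeta>. complex_of_real (\<zeta> \<bullet> e)" and ?T = "pderiv_dir (0, 1)"
  let ?G = "\<lambda>r g. \<i> * complex_of_real (r ^ 1) * osc1 (lfield e \<eta>) r g + 1 * complex_of_real (r ^ 3) * osc1 (lfield (rot e) (?T \<eta>)) r g"
  have p: "continuous_on UNIV ?p" by (intro continuous_intros)
  have T: "smooth_compact_support (?T \<eta>)" "smooth_compact_support (?T (?T \<eta>))"
    using \<eta> smooth_compact_support_pderiv_dir by blast+
  have m: "osc ?p \<eta> r \<in> borel_measurable borel" "osc ?p (?T (?T \<eta>)) r \<in> borel_measurable borel" for r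
    by (intro borel_measurable_osc_at p smooth_compact_supportD[OF \<eta>] smooth_compact_supportD[OF T(2)])+
  obtain R where R: "\<And>x. \<eta> x \<noteq> 0 \<Longrightarrow> norm x \<le> R" using \<eta> by (auto simp: smooth_compact_support_iff)
  have "energy_O 2 ?G"
    using energy_O_scale[OF energy_O_osc[OF smooth_compact_support_lfield[OF \<eta>]], of 1 \<i> e]
      energy_O_scale[OF energy_O_osc[OF smooth_compact_support_lfield[OF T(1)]], of 3 1 "rot e"]
    by (intro energy_O_add) (auto elim: energy_O_mono)
  moreover have "energy (osc ?p \<eta> r) \<le> energy (?G r)" if r: "r > 0" for r
  proof -
    have "energy (osc ?p \<eta> r) \<le> energy (\<lambda>g. osc ?p \<eta> r g - r ^ 4 *\<^sub>R osc ?p (?T (?T \<eta>)) r g)"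
      using r
      by (intro energy_le_second_difference[where Q' = "osc ?p (?T \<eta>) r"] m
          osc_has_vector_derivative_central \<eta> T p osc_central_support[OF R])
        (auto intro!: continuous_at_imp_continuous_on has_vector_derivative_continuous[OF osc_has_vector_derivative_central[OF T(2) p r]])
    also have "(\<lambda>g. osc ?p \<eta> r g - r ^ 4 *\<^sub>R osc ?p (?T (?T \<eta>)) r g) = ?G r"
      using osc_linear_weight_elliptic[OF \<eta> r] by (simp add: fun_eq_iff)
    finally show ?thesis .
  qed
  ultimately show ?thesis using m unfolding energy_O_def by (meson order_trans)
qed

lemma osc_sum:
  assumes "finite I" "\<And>i. i \<in> I \<Longrightarrow> smooth_compact_support (f i)" "continuous_on UNIV p" "r > 0"
  shows "osc p (\<lambda>x. \<Sum>i\<in>I. f i x) r g = (\<Sum>i\<in>I. osc p (f i) r g)"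
  unfolding osc_def sum_distrib_left
  by (intro Bochner_Integration.integral_sum integrable_osc_integrand smooth_compact_supportD assms)

text \<open>
  The initial value at \<open>r = 0\<close>, with \<open>\<kappa> = (2 \<pi> i)\<^sup>d\<close>, is a hypothesis in this context. It is supplied
  later by the existence of an oscillatory integral.
\<close>

context
  fixes \<kappa> :: complex
  assumes lim: "\<And>(\<eta> :: 'd::finite heis \<Rightarrow> complex) g. smooth_compact_support \<eta> \<Longrightarrow> ((\<lambda>r. osc1 \<eta> r g) \<longlongrightarrow> \<kappa> * \<eta> g) (at_right 0)"
begin

private definition D :: "('d heis \<Rightarrow> complex) \<Rightarrow> real \<Rightarrow> 'd heis \<Rightarrow> complex" where
  "D \<eta> t g = (\<Sum>e\<in>Basis. osc_lin e (lfield e \<eta>) t g)"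

private lemma D_derivative:
  assumes "smooth_compact_support (\<eta> :: 'd heis \<Rightarrow> complex)" "r > 0"
  shows "((\<lambda>r. osc1 \<eta> r g) has_vector_derivative D \<eta> r g) (at r)"
  using osc_has_vector_derivative_radius[OF assms(1) continuous_on_const assms(2), of 1 g] by (simp add: D_def)

private lemma D_continuous:
  assumes \<eta>: "smooth_compact_support (\<eta> :: 'd heis \<Rightarrow> complex)" and "r > 0" shows "isCont (\<lambda>r. D \<eta> r g) r"
  unfolding D_def
  by (intro continuous_intros has_vector_derivative_continuous[OF osc_has_vector_derivative_radius]
      smooth_compact_support_lfield assms)

private lemma D_measurable:
  assumes \<eta>: "smooth_compact_support (\<eta> :: 'd heis \<Rightarrow> complex)" shows "(\<lambda>(t, g). D \<eta> t g) \<in> borel_measurable borel"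
proof -
  have "(\<lambda>x. osc_lin e (lfield e \<eta>) (fst x) (snd x)) \<in> borel_measurable borel" for e
    using borel_measurable_osc[of "\<lambda>\<zeta>. complex_of_real (\<zeta> \<bullet> e)" "lfield e \<eta>"] smooth_compact_supportD(4)[OF smooth_compact_support_lfield[OF \<eta>]]
    by (simp add: case_prod_beta' continuous_intros)
  then show ?thesis unfolding D_def case_prod_beta' by (rule borel_measurable_sum)
qed

private lemma D_FTC:
  assumes \<eta>: "smooth_compact_support (\<eta> :: 'd heis \<Rightarrow> complex)" and r: "0 < r0" "r0 \<le> r"
  shows "osc1 \<eta> r g - osc1 \<eta> r0 g = (LINT t|lborel. indicator {r0..r} t *\<^sub>R D \<eta> t g)"
proof (rule integral_FTC_Icc[where F = "\<lambda>r. osc1 \<eta> r g" and f = "\<lambda>t. D \<eta> t g", symmetric, OF r(2)])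
  fix x assume "r0 \<le> x"
  then have "0 < x" using r by linarith
  from has_vector_derivative_at_within[OF D_derivative[OF \<eta> this]]
  show "((\<lambda>r. osc1 \<eta> r g) has_vector_derivative D \<eta> x g) (at x within {r0..r})" .
next
  show "continuous_on {r0..r} (\<lambda>t. D \<eta> t g)"
  proof (rule continuous_at_imp_continuous_on, rule ballI)
    fix x assume "x \<in> {r0..r}"
    then have "0 < x" using r by simp
    then show "isCont (\<lambda>t. D \<eta> t g) x" by (rule D_continuous[OF \<eta>])
  qed
qed

private lemma energy_O_first:
  assumes \<eta>: "smooth_compact_support (\<eta> :: 'd heis \<Rightarrow> complex)" shows "energy_O 4 (\<lambda>r g. osc1 \<eta> r g - \<kappa> * \<eta> g)"
proof -
  note sm = smooth_compact_supportD[OF \<eta>]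
  have "energy_O (2 + 2) (\<lambda>r g. osc1 \<eta> r g - \<kappa> * \<eta> g)"
  proof (rule energy_O_antiderivative[where F = "D \<eta>"])
    show "energy_O 2 (D \<eta>)" unfolding D_def[abs_def]
      by (intro energy_O_sum energy_O_osc_linear smooth_compact_support_lfield \<eta>) auto
    show "(\<lambda>g. osc1 \<eta> r g - \<kappa> * \<eta> g) \<in> borel_measurable borel" for r
      using borel_measurable_osc_at[OF continuous_on_const sm(4), of 1 r] borel_measurable_compactly_supported[OF sm(2)]
      by simp
    show "((\<lambda>r. osc1 \<eta> r g - \<kappa> * \<eta> g) \<longlongrightarrow> 0) (at_right 0)" for g
      using tendsto_diff[OF lim[OF \<eta>, of g] tendsto_const[of "\<kappa> * \<eta> g"]] by simp
  qed (auto simp: D_measurable \<eta> D_FTC[symmetric])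
  then show ?thesis by simp
qed

text \<open>
  The derivative of \<open>osc1 \<eta>\<close> in \<open>r\<close> is \<open>i r osc1 (L \<eta>)\<close> up to \<open>r\<^sup>2\<close> times linearly weighted integrals.
  Replacing \<open>osc1 (L \<eta>)\<close> by its limit \<open>\<kappa> L \<eta>\<close> costs \<open>O(r\<^sup>2)\<close> by the first-order estimate, so the derivative of
  the remainder is \<open>O(r\<^sup>3)\<close> and the remainder \<open>O(r\<^sup>4)\<close>.
\<close>

lemma energy_O_second:
  assumes \<eta>: "smooth_compact_support (\<eta> :: 'd heis \<Rightarrow> complex)"
  shows "energy_O 8 (\<lambda>r g. osc1 \<eta> r g - \<kappa> * (\<eta> g + \<i> / 2 * complex_of_real (r\<^sup>2) * sublaplacian \<eta> g))"
proof -
  note sm = smooth_compact_supportD[OF \<eta>]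
  let ?L = "sublaplacian \<eta>" and ?T = "pderiv_dir (0, 1)"
  have L: "smooth_compact_support ?L" by (rule smooth_compact_support_sublaplacian[OF \<eta>])
  note smL = smooth_compact_supportD[OF L]
  define F where "F t g = D \<eta> t g - \<i> * complex_of_real t * (\<kappa> * ?L g)" for t g
  define E where "E t g = \<i> * complex_of_real (t ^ 1) * (osc1 ?L t g - \<kappa> * ?L g) +
    (- \<i>) * complex_of_real (t\<^sup>2) * (\<Sum>e\<in>Basis. osc_lin (rot e) (?T (lfield e \<eta>)) t g)" for t g
  have "energy_O 6 (\<lambda>t g. \<i> * complex_of_real (t ^ 1) * (osc1 ?L t g - \<kappa> * ?L g))"
    using energy_O_scale[OF energy_O_first[OF L], of 1 \<i>] by simp
  moreover have "energy_O 6 (\<lambda>t g. (- \<i>) * complex_of_real (t\<^sup>2) * (\<Sum>e\<in>Basis. osc_lin (rot e) (?T (lfield e \<eta>)) t g))"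
  proof -
    have "energy_O 2 (\<lambda>t g. \<Sum>e\<in>Basis. osc_lin (rot e) (?T (lfield e \<eta>)) t g)"
      by (intro energy_O_sum finite_Basis energy_O_osc_linear smooth_compact_support_pderiv_dir smooth_compact_support_lfield \<eta>)
    from energy_O_scale[OF this, of 2 "- \<i>"] show ?thesis by simp
  qed
  ultimately have E: "energy_O 6 E" unfolding E_def[abs_def] by (rule energy_O_add)
  have FE: "F t g = E t g" if t: "t > 0" for t g
  proof -
    have "D \<eta> t g = (\<Sum>e\<in>Basis. \<i> * (t * osc1 (lfield e (lfield e \<eta>)) t g
       - t\<^sup>2 * osc_lin (rot e) (?T (lfield e \<eta>)) t g))"
      unfolding D_def of_real_power by (intro sum.cong refl osc_linear_weight smooth_compact_support_lfield \<eta> t)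
    also have "\<dots> = \<i> * t * (\<Sum>e\<in>Basis. osc1 (lfield e (lfield e \<eta>)) t g)
       - \<i> * t\<^sup>2 * (\<Sum>e\<in>Basis. osc_lin (rot e) (?T (lfield e \<eta>)) t g)"
      by (simp add: sum_distrib_left sum_subtractf[symmetric] right_diff_distrib mult.assoc)
    also have "(\<Sum>e\<in>Basis. osc1 (lfield e (lfield e \<eta>)) t g) = osc1 ?L t g"
      unfolding sublaplacian_eq by (intro osc_sum[symmetric] smooth_compact_support_lfield \<eta> t continuous_on_const) auto
    finally show ?thesis unfolding F_def E_def by (simp add: algebra_simps)
  qed
  have mF: "(\<lambda>(t, g). F t g) \<in> borel_measurable borel"
  proof -
    have "(\<lambda>x. \<i> * complex_of_real (fst x) * (\<kappa> * ?L (snd x))) \<in> borel_measurable (borel :: (real \<times> 'd heis) measure)"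
      by (intro borel_measurable_continuous_onI continuous_intros continuous_on_compose2[OF smL(4)]) auto
    then show ?thesis using D_measurable[OF \<eta>] unfolding F_def case_prod_beta by simp
  qed
  have "energy_O 6 F"
    unfolding energy_O_def
  proof (intro conjI allI)
    have c: "continuous_on UNIV (\<lambda>g. (t, g))" for t :: real by (intro continuous_intros)
    show "F t \<in> borel_measurable borel" for t
      using measurable_compose[OF borel_measurable_continuous_onI[OF c] mF, of t] by simp
    show "\<exists>C\<ge>0. \<forall>t>0. t \<le> 1 \<longrightarrow> energy (F t) \<le> ennreal (C * t ^ 6)"
      using E FE unfolding energy_O_def by (metis ext)
  qed
  then have "energy_O (6 + 2) (\<lambda>r g. osc1 \<eta> r g - \<kappa> * (\<eta> g + \<i> / 2 * complex_of_real (r\<^sup>2) * sublaplacian \<eta> g))"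
  proof (rule energy_O_antiderivative[OF _ mF])
    show "(\<lambda>g. osc1 \<eta> r g - \<kappa> * (\<eta> g + \<i> / 2 * complex_of_real (r\<^sup>2) * ?L g)) \<in> borel_measurable borel" for r
      using borel_measurable_osc_at[OF continuous_on_const sm(4), of 1 r] borel_measurable_compactly_supported[OF sm(2)]
       borel_measurable_compactly_supported[OF smL(2)] by simp
    have "((\<lambda>r. osc1 \<eta> r g - \<kappa> * (\<eta> g + \<i> / 2 * complex_of_real (r\<^sup>2) * ?L g)) \<longlongrightarrow> \<kappa> * \<eta> g - \<kappa> * (\<eta> g + \<i> / 2 * complex_of_real (0\<^sup>2) * ?L g)) (at_right 0)" for g
      by (intro tendsto_intros lim[OF \<eta>])
    then show "((\<lambda>r. osc1 \<eta> r g - \<kappa> * (\<eta> g + \<i> / 2 * complex_of_real (r\<^sup>2) * ?L g)) \<longlongrightarrow> 0) (at_right 0)" for g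
      by simp
    fix r r0 g assume r: "0 < r0" "r0 \<le> (r::real)" 
    show "(osc1 \<eta> r g - \<kappa> * (\<eta> g + \<i> / 2 * complex_of_real (r\<^sup>2) * ?L g)) - (osc1 \<eta> r0 g - \<kappa> * (\<eta> g + \<i> / 2 * complex_of_real (r0\<^sup>2) * ?L g))
      = (LINT t|lborel. indicator {r0..r} t *\<^sub>R F t g)"
    proof (rule integral_FTC_Icc[where F = "\<lambda>r. osc1 \<eta> r g - \<kappa> * (\<eta> g + \<i> / 2 * complex_of_real (r\<^sup>2) * ?L g)" and f = "\<lambda>t. F t g", symmetric, OF r(2)])
      fix x assume x: "r0 \<le> x"
      have 1: "((\<lambda>r. complex_of_real (r\<^sup>2)) has_vector_derivative complex_of_real (2 * x)) (at x)"
        by (intro has_vector_derivative_complex_of_real) (auto intro!: derivative_eq_intros)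
      have 2: "((\<lambda>r. osc1 \<eta> r g) has_vector_derivative D \<eta> x g) (at x)" using D_derivative[OF \<eta>] x r by simp
      have "((\<lambda>r. osc1 \<eta> r g - \<kappa> * (\<eta> g + \<i> / 2 * complex_of_real (r\<^sup>2) * ?L g)) has_vector_derivative F x g) (at x)"
        by (rule has_vector_derivative_eq_rhs[OF has_vector_derivative_diff[OF 2 has_vector_derivative_mult_right[OF
            has_vector_derivative_add[OF has_vector_derivative_const has_vector_derivative_mult_left[OF has_vector_derivative_mult_right[OF 1]]]]]])
           (simp add: F_def)
      then show "((\<lambda>r. osc1 \<eta> r g - \<kappa> * (\<eta> g + \<i> / 2 * complex_of_real (r\<^sup>2) * ?L g)) has_vector_derivative F x g) (at x within {r0..r})"
        by (rule has_vector_derivative_at_within)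
    next
      show "continuous_on {r0..r} (\<lambda>t. F t g)"
        unfolding F_def
      proof (rule continuous_at_imp_continuous_on, rule ballI)
        fix x assume "x \<in> {r0..r}"
        then have "0 < x" using r by simp
        from D_continuous[OF \<eta> this, of g]
        show "isCont (\<lambda>t. D \<eta> t g - \<i> * complex_of_real t * (\<kappa> * ?L g)) x"
          by (intro continuous_intros)
      qed
    qed
  qed
  then show ?thesis by simp
qed

end

section \<open>The value of the oscillatory integral\<close>

lemma smooth_iterated_pderiv: "smooth f \<Longrightarrow> smooth (iterated_pderiv vs f)"
  by (induction vs) (auto simp: iterated_pderiv_Cons smooth_pderiv_dir, simp add: iterated_pderiv_def)

lemma iterated_pderiv_lincomb:
  assumes "smooth f" "smooth g"
  shows "iterated_pderiv vs (\<lambda>x. a * f x + g x) = (\<lambda>x. a * iterated_pderiv vs f x + iterated_pderiv vs g x)"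
proof (induction vs)
  case Nil then show ?case by (simp add: iterated_pderiv_def)
next
  case (Cons v vs)
  have "((\<lambda>x. a * iterated_pderiv vs f x + iterated_pderiv vs g x) has_derivative
    (\<lambda>v. a * pderiv_dir v (iterated_pderiv vs f) p + pderiv_dir v (iterated_pderiv vs g) p)) (at p)" for p
    by (intro has_derivative_add has_derivative_mult_right smooth_has_derivative smooth_iterated_pderiv assms)
  from pderiv_dir_eq[OF this] show ?case unfolding iterated_pderiv_Cons Cons by blast
qed

lemma schwartz_lincomb:
  assumes "schwartz f" "schwartz g" shows "schwartz (\<lambda>x. a * f x + g x)"
  unfolding schwartz_def
proof (intro conjI allI impI)
  have sm: "smooth f" "smooth g" using assms by (auto simp: schwartz_def)
  then show "smooth (\<lambda>x. a * f x + g x)" by (intro smooth_add smooth_cmult)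
  fix k and vs :: "'a list" assume "set vs \<subseteq> Basis"
  then have bdd: "bounded (range (\<lambda>p. norm p ^ k *\<^sub>R iterated_pderiv vs f p))" "bounded (range (\<lambda>p. norm p ^ k *\<^sub>R iterated_pderiv vs g p))"
    using assms by (auto simp: schwartz_def)
  obtain A where A: "\<And>p. norm (norm p ^ k *\<^sub>R iterated_pderiv vs f p) \<le> A"
    using bdd(1) unfolding bounded_iff by blast
  obtain B where B: "\<And>p. norm (norm p ^ k *\<^sub>R iterated_pderiv vs g p) \<le> B"
    using bdd(2) unfolding bounded_iff by blast
  have "norm (norm p ^ k *\<^sub>R iterated_pderiv vs (\<lambda>x. a * f x + g x) p) \<le> norm a * A + B" for p
  proof -
    have "norm p ^ k *\<^sub>R iterated_pderiv vs (\<lambda>x. a * f x + g x) p = a * (norm p ^ k *\<^sub>R iterated_pderiv vs f p) + norm p ^ k *\<^sub>R iterated_pderiv vs g p"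
      by (simp add: iterated_pderiv_lincomb[OF sm] scaleR_add_right)
    also have "norm \<dots> \<le> norm (a * (norm p ^ k *\<^sub>R iterated_pderiv vs f p)) + norm (norm p ^ k *\<^sub>R iterated_pderiv vs g p)"
      by (rule norm_triangle_ineq)
    also have "\<dots> \<le> norm a * A + B"
      unfolding norm_mult by (intro add_mono mult_left_mono A B) auto
    finally show ?thesis .
  qed
  then show "bounded (range (\<lambda>p. norm p ^ k *\<^sub>R iterated_pderiv vs (\<lambda>x. a * f x + g x) p))"
    unfolding bounded_iff by blast
qed

definition gaussian :: "'a::euclidean_space \<Rightarrow> complex" where
  "gaussian x = complex_of_real (exp (- ((norm x)\<^sup>2 / 2)))"

lemma gaussian_simps [simp]: "gaussian 0 = 1" "gaussian x \<noteq> 0" "norm (gaussian x) \<le> 1"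
  by (simp_all add: gaussian_def)

lemma schwartz_gaussian: "schwartz gaussian"
  using schwartz_gauss_poly[OF gauss_poly.gauss] unfolding gaussian_def[abs_def] .

lemma has_osc_integral_gaussian:
  assumes "f has_osc_integral J"
  shows "((\<lambda>\<epsilon>. LINT \<zeta>|lborel. gaussian (\<epsilon> *\<^sub>R \<zeta>) * phase_factor \<zeta> * f \<zeta>) \<longlongrightarrow> J) (at_right 0)"
  using mp[OF spec[OF assms[unfolded has_osc_integral_def], of gaussian] conjI[OF schwartz_gaussian gaussian_simps(1)]]
  by (rule conjunct2)

text \<open>
  For integrable amplitudes the Gaussian cut-off disappears by dominated convergence.
\<close>

lemma has_osc_integral_integrable:
  assumes cont: "continuous_on UNIV f" and f: "integrable lborel f" and J: "f has_osc_integral J"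
  shows "J = (LINT \<zeta>|lborel. phase_factor \<zeta> * f \<zeta>)"
proof -
  let ?e = "\<lambda>\<zeta>. phase_factor \<zeta>"
  have cg: "continuous_on UNIV (\<lambda>\<zeta>. gaussian (c *\<^sub>R \<zeta>) :: complex)" for c
    unfolding gaussian_def by (intro continuous_intros) auto
  have "((\<lambda>\<epsilon>. LINT \<zeta>|lborel. gaussian (\<epsilon> *\<^sub>R \<zeta>) * ?e \<zeta> * f \<zeta>) \<longlongrightarrow> (LINT \<zeta>|lborel. ?e \<zeta> * f \<zeta>)) (at_right 0)"
    unfolding tendsto_at_iff_sequentially
  proof (intro allI impI)
    fix X :: "nat \<Rightarrow> real" assume X: "X \<longlonglongrightarrow> 0"
    have "(\<lambda>n. LINT \<zeta>|lborel. gaussian (X n *\<^sub>R \<zeta>) * ?e \<zeta> * f \<zeta>) \<longlonglongrightarrow> (LINT \<zeta>|lborel. ?e \<zeta> * f \<zeta>)"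
    proof (rule integral_dominated_convergence[where w = "\<lambda>\<zeta>. norm (f \<zeta>)"])
      show "(\<lambda>\<zeta>. gaussian (X n *\<^sub>R \<zeta>) * ?e \<zeta> * f \<zeta>) \<in> borel_measurable lborel" for n
        unfolding measurable_lborel2 by (intro borel_measurable_continuous_onI continuous_intros cont cg) auto
      show "(\<lambda>\<zeta>. ?e \<zeta> * f \<zeta>) \<in> borel_measurable lborel"
        unfolding measurable_lborel2 by (intro borel_measurable_continuous_onI continuous_intros cont) auto
      have "(\<lambda>n. gaussian (X n *\<^sub>R \<zeta>) * ?e \<zeta> * f \<zeta>) \<longlonglongrightarrow> complex_of_real (exp (- ((norm (0 *\<^sub>R \<zeta>))\<^sup>2 / 2))) * ?e \<zeta> * f \<zeta>" for \<zeta>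
        unfolding gaussian_def by (intro tendsto_intros X) auto
      then show "AE \<zeta> in lborel. (\<lambda>n. gaussian (X n *\<^sub>R \<zeta>) * ?e \<zeta> * f \<zeta>) \<longlonglongrightarrow> ?e \<zeta> * f \<zeta>" by simp
      have "norm (gaussian (X n *\<^sub>R \<zeta>) * ?e \<zeta> * f \<zeta>) \<le> norm (f \<zeta>)" for n \<zeta>
        using mult_right_mono[OF gaussian_simps(3), of "norm (f \<zeta>)" "X n *\<^sub>R \<zeta>"] by (simp add: norm_mult)
      then show "AE \<zeta> in lborel. norm (gaussian (X n *\<^sub>R \<zeta>) * ?e \<zeta> * f \<zeta>) \<le> norm (f \<zeta>)" for n by simp
    qed (use f in auto)
    then show "((\<lambda>\<epsilon>. LINT \<zeta>|lborel. gaussian (\<epsilon> *\<^sub>R \<zeta>) * ?e \<zeta> * f \<zeta>) \<circ> X) \<longlonglongrightarrow> (LINT \<zeta>|lborel. ?e \<zeta> * f \<zeta>)"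
      by (simp add: o_def)
  qed
  from tendsto_unique[OF trivial_limit_at_right_real has_osc_integral_gaussian[OF J] this] show ?thesis .
qed

text \<open>
  The type argument carries the dimension \<open>d\<close>.
\<close>

definition osc_constant :: "'d::finite itself \<Rightarrow> complex" where
  "osc_constant _ = (2 * pi * \<i>) ^ CARD('d)"

text \<open>
  With the Gaussian as cut-off the integral is a complex Gaussian integral with parameter
  \<open>\<epsilon>\<^sup>2 - i\<close>.
\<close>

lemma gaussian_osc_limit:
  "((\<lambda>\<epsilon>. LINT \<zeta>|lborel. gaussian (\<epsilon> *\<^sub>R \<zeta>) * phase_factor (\<zeta> :: 'd::finite phase)) \<longlongrightarrow> osc_constant TYPE('d)) (at_right 0)"
proof -
  have "(LINT \<zeta>|lborel. gaussian (\<epsilon> *\<^sub>R \<zeta>) * phase_factor (\<zeta> :: 'd phase)) = (2 * pi / (complex_of_real (\<epsilon>\<^sup>2) - \<i>)) ^ CARD('d)"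
    if "\<epsilon> > 0" for \<epsilon>
  proof -
    have "gaussian (\<epsilon> *\<^sub>R \<zeta>) * phase_factor \<zeta> = exp (- ((complex_of_real (\<epsilon>\<^sup>2) - \<i>) * complex_of_real ((norm \<zeta>)\<^sup>2) / 2))" for \<zeta> :: "'d phase"
      unfolding gaussian_def exp_of_real[symmetric] mult_exp_exp
      by (rule arg_cong[where f = exp]) (simp add: power_mult_distrib field_simps)
    then show ?thesis
      using integral_gaussian_complex[where 'a = "'d phase", OF _ DIM_phase, of "complex_of_real (\<epsilon>\<^sup>2) - \<i>"] that by simp
  qed
  then have ev: "\<forall>\<^sub>F \<epsilon> in at_right 0. (2 * pi / (complex_of_real (\<epsilon>\<^sup>2) - \<i>)) ^ CARD('d) = (LINT \<zeta>|lborel. gaussian (\<epsilon> *\<^sub>R \<zeta>) * phase_factor (\<zeta> :: 'd phase))"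
    using eventually_at_right_less[of "0::real"] by (auto elim: eventually_mono)
  have "((\<lambda>\<epsilon>. (2 * pi / (complex_of_real (\<epsilon>\<^sup>2) - \<i>)) ^ CARD('d)) \<longlongrightarrow> (2 * pi / (complex_of_real (0\<^sup>2) - \<i>)) ^ CARD('d)) (at_right 0)"
    by (intro tendsto_intros) auto
  moreover have "(2 * pi / (complex_of_real (0\<^sup>2) - \<i>)) ^ CARD('d) = osc_constant TYPE('d)"
    by (simp add: osc_constant_def mult.commute)
  ultimately show ?thesis using Lim_transform_eventually[OF _ ev] by simp
qed

lemma has_osc_integral_const:
  assumes "(\<lambda>_ :: 'd::finite phase. c) has_osc_integral J" shows "J = osc_constant TYPE('d) * c"
proof -
  have "((\<lambda>\<epsilon>. (LINT \<zeta>|lborel. gaussian (\<epsilon> *\<^sub>R \<zeta>) * phase_factor (\<zeta> :: 'd phase)) * c) \<longlongrightarrow> osc_constant TYPE('d) * c) (at_right 0)"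
    by (intro tendsto_mult_right gaussian_osc_limit)
  then have "((\<lambda>\<epsilon>. LINT \<zeta>|lborel. gaussian (\<epsilon> *\<^sub>R \<zeta>) * phase_factor (\<zeta> :: 'd phase) * c) \<longlongrightarrow> osc_constant TYPE('d) * c) (at_right 0)"
    by simp
  from tendsto_unique[OF trivial_limit_at_right_real has_osc_integral_gaussian[OF assms] this] show ?thesis .
qed

text \<open>
  Existence of the oscillatory integral of one nonzero constant is independence of the cut-off. A
  Schwartz function \<open>\<phi>\<close> with arbitrary value at \<open>0\<close> becomes an admissible cut-off after adding a multiple of
  the Gaussian.
\<close>

lemma has_osc_integral_one:
  assumes c: "(\<lambda>_ :: 'd::finite phase. c) has_osc_integral J" "c \<noteq> 0" and \<phi>: "schwartz \<phi>" 
  shows "((\<lambda>\<epsilon>. LINT \<zeta>|lborel. \<phi> (\<epsilon> *\<^sub>R \<zeta>) * phase_factor (\<zeta> :: 'd phase)) \<longlongrightarrow> osc_constant TYPE('d) * \<phi> 0) (at_right 0)"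
proof -
  let ?e = "\<lambda>\<zeta> :: 'd phase. phase_factor \<zeta>"
  have J: "J = osc_constant TYPE('d) * c" by (rule has_osc_integral_const[OF c(1)])
  have one: "integrable lborel (\<lambda>\<zeta>. \<theta> (\<epsilon> *\<^sub>R \<zeta>) * ?e \<zeta>)" "((\<lambda>\<epsilon>. LINT \<zeta>|lborel. \<theta> (\<epsilon> *\<^sub>R \<zeta>) * ?e \<zeta>) \<longlongrightarrow> osc_constant TYPE('d)) (at_right 0)"
    if \<theta>: "schwartz \<theta>" "\<theta> 0 = 1" and \<epsilon>: "\<epsilon> > 0" for \<theta> and \<epsilon> :: real
  proof -
    have int: "integrable lborel (\<lambda>\<zeta>. \<theta> (\<epsilon> *\<^sub>R \<zeta>) * ?e \<zeta> * c)" and lim: "((\<lambda>\<epsilon>. LINT \<zeta>|lborel. \<theta> (\<epsilon> *\<^sub>R \<zeta>) * ?e \<zeta> * c) \<longlongrightarrow> J) (at_right 0)"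
      using mp[OF spec[OF c(1)[unfolded has_osc_integral_def], of \<theta>] conjI[OF \<theta>]] \<epsilon> by blast+
    have "integrable lborel (\<lambda>\<zeta>. \<theta> (\<epsilon> *\<^sub>R \<zeta>) * ?e \<zeta> * c * (1 / c))" by (rule integrable_mult_left[OF int])
    then show "integrable lborel (\<lambda>\<zeta>. \<theta> (\<epsilon> *\<^sub>R \<zeta>) * ?e \<zeta>)" using c(2) by simp
    have "((\<lambda>\<epsilon>. (LINT \<zeta>|lborel. \<theta> (\<epsilon> *\<^sub>R \<zeta>) * ?e \<zeta> * c) / c) \<longlongrightarrow> J / c) (at_right 0)"
      using lim c(2) by (intro tendsto_divide tendsto_const)
    then show "((\<lambda>\<epsilon>. LINT \<zeta>|lborel. \<theta> (\<epsilon> *\<^sub>R \<zeta>) * ?e \<zeta>) \<longlongrightarrow> osc_constant TYPE('d)) (at_right 0)"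
      using c(2) J by simp
  qed
  define \<theta> where "\<theta> x = (1 - \<phi> 0) * gaussian x + \<phi> x" for x
  have \<theta>: "schwartz \<theta>" "\<theta> 0 = 1"
    unfolding \<theta>_def by (auto intro!: schwartz_lincomb schwartz_gaussian \<phi>)
  have eq: "(LINT \<zeta>|lborel. \<theta> (\<epsilon> *\<^sub>R \<zeta>) * ?e \<zeta>) - (1 - \<phi> 0) * (LINT \<zeta>|lborel. gaussian (\<epsilon> *\<^sub>R \<zeta>) * ?e \<zeta>) = (LINT \<zeta>|lborel. \<phi> (\<epsilon> *\<^sub>R \<zeta>) * ?e \<zeta>)"
    if "\<epsilon> > 0" for \<epsilon>
  proof -
    have i: "integrable lborel (\<lambda>\<zeta>. \<theta> (\<epsilon> *\<^sub>R \<zeta>) * ?e \<zeta>)" "integrable lborel (\<lambda>\<zeta>. gaussian (\<epsilon> *\<^sub>R \<zeta>) * ?e \<zeta>)"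
      by (rule one(1)[OF \<theta> that], rule one(1)[OF schwartz_gaussian gaussian_simps(1) that])
    have "(LINT \<zeta>|lborel. \<theta> (\<epsilon> *\<^sub>R \<zeta>) * ?e \<zeta>) - (1 - \<phi> 0) * (LINT \<zeta>|lborel. gaussian (\<epsilon> *\<^sub>R \<zeta>) * ?e \<zeta>) =
      (LINT \<zeta>|lborel. \<theta> (\<epsilon> *\<^sub>R \<zeta>) * ?e \<zeta> - (1 - \<phi> 0) * (gaussian (\<epsilon> *\<^sub>R \<zeta>) * ?e \<zeta>))"
      by (subst Bochner_Integration.integral_diff[OF i(1) integrable_mult_right[OF i(2)]], subst integral_mult_right_zero) (rule refl)
    then show ?thesis by (simp add: \<theta>_def algebra_simps)
  qed
  have "((\<lambda>\<epsilon>. (LINT \<zeta>|lborel. \<theta> (\<epsilon> *\<^sub>R \<zeta>) * ?e \<zeta>) - (1 - \<phi> 0) * (LINT \<zeta>|lborel. gaussian (\<epsilon> *\<^sub>R \<zeta>) * ?e \<zeta>)) \<longlongrightarrow>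
     osc_constant TYPE('d) - (1 - \<phi> 0) * osc_constant TYPE('d)) (at_right 0)"
    using one(2)[OF \<theta> zero_less_one] gaussian_osc_limit by (intro tendsto_intros)
  moreover have "osc_constant TYPE('d) - (1 - \<phi> 0) * osc_constant TYPE('d) = osc_constant TYPE('d) * \<phi> 0" by (simp add: algebra_simps)
  ultimately have lim: "((\<lambda>\<epsilon>. (LINT \<zeta>|lborel. \<theta> (\<epsilon> *\<^sub>R \<zeta>) * ?e \<zeta>) - (1 - \<phi> 0) * (LINT \<zeta>|lborel. gaussian (\<epsilon> *\<^sub>R \<zeta>) * ?e \<zeta>)) \<longlongrightarrow>
     osc_constant TYPE('d) * \<phi> 0) (at_right 0)" by simp
  show ?thesis
    by (rule Lim_transform_eventually[OF lim]) (use eq eventually_at_right_less[of "0::real"] in \<open>auto elim: eventually_mono\<close>)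
qed

text \<open>
  The radius plays the role of the cut-off parameter: for \<open>\<phi> v = \<eta> (g \<cdot> (v, 0))\<close> the integral is
  \<open>\<integral> \<phi> (r \<zeta>) exp (i |\<zeta>|\<^sup>2 / 2) d\<zeta>\<close>.
\<close>

lemma osc_tendsto:
  fixes \<eta> :: "'d::finite heis \<Rightarrow> complex"
  assumes \<eta>: "smooth_compact_support \<eta>" and c: "(\<lambda>_ :: 'd phase. c) has_osc_integral J" "c \<noteq> 0"
  shows "((\<lambda>r. osc1 \<eta> r g) \<longlongrightarrow> osc_constant TYPE('d) * \<eta> g) (at_right 0)"
proof -
  define \<phi> where "\<phi> v = \<eta> (g + (v, fst g \<bullet>\<^sub>\<sigma> v))" for v
  have l: "bounded_linear (\<lambda>v. (v, fst g \<bullet>\<^sub>\<sigma> v))"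
    unfolding symp_prod_def
    by (intro bounded_linear_Pair bounded_linear_ident bounded_linear_sub bounded_linear_intros
         bounded_linear_compose[OF bounded_linear_inner_left bounded_linear_fst] bounded_linear_compose[OF bounded_linear_inner_right bounded_linear_snd])
  obtain R where R: "\<And>x. \<eta> x \<noteq> 0 \<Longrightarrow> norm x \<le> R" using \<eta> by (auto simp: smooth_compact_support_iff)
  have "norm v \<le> (R + norm (fst g)) / 1" if "\<phi> v \<noteq> 0" for v
    using ray_support[of g 1 v R 1] R[of "ray g 1 v"] that by (simp add: \<phi>_def plus_prod_def)
  then have "smooth_compact_support \<phi>"
    using smooth_affine_compose[OF smooth_compact_supportD(1)[OF \<eta>] l, of g]
    unfolding smooth_compact_support_iff \<phi>_def[abs_def] by blast
  from has_osc_integral_one[OF c schwartz_smooth_compact_support[OF this]]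
  have "((\<lambda>\<epsilon>. LINT \<zeta>|lborel. \<phi> (\<epsilon> *\<^sub>R \<zeta>) * phase_factor \<zeta>) \<longlongrightarrow> osc_constant TYPE('d) * \<phi> 0) (at_right 0)" .
  moreover have "(LINT \<zeta>|lborel. \<phi> (\<epsilon> *\<^sub>R \<zeta>) * phase_factor \<zeta>) = osc1 \<eta> \<epsilon> g" for \<epsilon>
    unfolding osc_def \<phi>_def by (simp add: symp_prod_simps plus_prod_def mult.commute)
  moreover have "\<phi> 0 = \<eta> g" by (simp add: \<phi>_def symp_prod_simps zero_prod_def[symmetric])
  ultimately show ?thesis by simp
qed

section \<open>Complex scalars\<close>

lemma L2_cases: obtains f where "square_integrable f" "\<psi> = abs_L2 f"
  using square_integrable_rep_L2 abs_L2_rep_L2 by metis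

lemma scaleC_simps:
  "c *\<^sub>C (\<psi> + \<phi>) = c *\<^sub>C \<psi> + c *\<^sub>C \<phi>" "c *\<^sub>C (r *\<^sub>R \<psi>) = r *\<^sub>R (c *\<^sub>C \<psi>)" "norm (c *\<^sub>C \<psi>) = norm c * norm \<psi>"
  "a *\<^sub>C (b *\<^sub>C \<psi>) = (a * b) *\<^sub>C \<psi>" "complex_of_real r *\<^sub>C \<psi> = r *\<^sub>R \<psi>" "1 *\<^sub>C \<psi> = \<psi>"
proof -
  obtain f where f: "square_integrable f" "\<psi> = abs_L2 f" by (rule L2_cases)
  obtain g where g: "square_integrable g" "\<phi> = abs_L2 g" by (rule L2_cases)
  show "c *\<^sub>C (\<psi> + \<phi>) = c *\<^sub>C \<psi> + c *\<^sub>C \<phi>"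
    by (simp add: f g abs_L2_add abs_L2_scaleC square_integrable_add square_integrable_scale distrib_left)
  show "c *\<^sub>C (r *\<^sub>R \<psi>) = r *\<^sub>R (c *\<^sub>C \<psi>)"
    by (simp add: f abs_L2_scaleR abs_L2_scaleC square_integrable_scaleR square_integrable_scale)
  show "a *\<^sub>C (b *\<^sub>C \<psi>) = (a * b) *\<^sub>C \<psi>"
    by (simp add: f abs_L2_scaleC square_integrable_scale mult.assoc)
  show "complex_of_real r *\<^sub>C \<psi> = r *\<^sub>R \<psi>"
    by (simp add: f abs_L2_scaleC abs_L2_scaleR scaleR_conv_of_real)
  show "1 *\<^sub>C \<psi> = \<psi>" by (simp add: f abs_L2_scaleC)
  have "ennreal ((norm (c *\<^sub>C \<psi>))\<^sup>2) = energy (\<lambda>x. c * f x)"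
    by (simp only: f(2) abs_L2_scaleC[OF f(1)] energy_eq_norm[OF square_integrable_scale[OF f(1)]])
  also have "\<dots> = ennreal ((norm c)\<^sup>2) * energy f"
    using f(1) by (intro energy_scale) (simp add: square_integrable_def)
  also have "energy f = ennreal ((norm \<psi>)\<^sup>2)" by (simp only: f(2) energy_eq_norm[OF f(1)])
  also have "ennreal ((norm c)\<^sup>2) * ennreal ((norm \<psi>)\<^sup>2) = ennreal ((norm c * norm \<psi>)\<^sup>2)"
    by (simp add: ennreal_mult power_mult_distrib)
  finally have "(norm (c *\<^sub>C \<psi>))\<^sup>2 = (norm c * norm \<psi>)\<^sup>2" by simp
  then show "norm (c *\<^sub>C \<psi>) = norm c * norm \<psi>" by simp
qed

lemma bounded_linear_scaleC: "bounded_linear (\<lambda>\<psi>. c *\<^sub>C \<psi>)"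
  by (rule bounded_linear_intro[where K = "norm c"]) (simp_all add: scaleC_simps mult.commute)

section \<open>The operators on the core\<close>

lemma osc_constant_nonzero: "osc_constant TYPE('d::finite) \<noteq> 0"
  by (simp add: osc_constant_def)

lemma norm_osc_constant: "(norm (osc_constant TYPE('d::finite)))\<^sup>2 = (2 * pi) ^ (2 * CARD('d))"
  by (simp add: osc_constant_def norm_power norm_mult power_mult mult.commute)

lemma AE_lborel_ex: "AE x in (lborel :: 'a::euclidean_space measure). P x \<Longrightarrow> \<exists>x. P x"
  by (rule eventually_happens'[of "ae_filter lborel"]) (simp_all add: ae_filter_eq_bot_iff emeasure_lborel_UNIV)

lemma extends_osc_operator_value:
  fixes B :: "'d::finite heis L2 \<Rightarrow> 'd heis L2"
  assumes B: "extends_osc_operator \<tau> B" and \<psi>: "schwartz \<psi>" and sq: "square_integrable F"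
    and F: "\<And>z s J. (\<lambda>\<zeta>. \<psi> (z + sqrt \<tau> *\<^sub>R \<zeta>, s + sqrt \<tau> * (z \<bullet>\<^sub>\<sigma> \<zeta>))) has_osc_integral J \<Longrightarrow> J = osc_constant TYPE('d) * F (z, s)"
  shows "B (abs_L2 \<psi>) = abs_L2 F"
proof -
  have "AE (z, s) in lborel. \<exists>J. (\<lambda>\<zeta>. \<psi> (z + sqrt \<tau> *\<^sub>R \<zeta>, s + sqrt \<tau> * (z \<bullet>\<^sub>\<sigma> \<zeta>))) has_osc_integral J \<and>
           rep_L2 (B (abs_L2 \<psi>)) (z, s) = 1 / (2 * pi * \<i>) ^ CARD('d) * J"
    using B \<psi> unfolding extends_osc_operator_def by blast
  then have "AE g in lborel. rep_L2 (B (abs_L2 \<psi>)) g = F g"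
  proof (rule AE_mp, intro AE_I2 impI)
    fix g :: "'d heis"
    obtain z s where g: "g = (z, s)" by (cases g)
    assume "case g of (z, s) \<Rightarrow> \<exists>J. (\<lambda>\<zeta>. \<psi> (z + sqrt \<tau> *\<^sub>R \<zeta>, s + sqrt \<tau> * (z \<bullet>\<^sub>\<sigma> \<zeta>))) has_osc_integral J \<and>
           rep_L2 (B (abs_L2 \<psi>)) (z, s) = 1 / (2 * pi * \<i>) ^ CARD('d) * J"
    then obtain J where J: "(\<lambda>\<zeta>. \<psi> (z + sqrt \<tau> *\<^sub>R \<zeta>, s + sqrt \<tau> * (z \<bullet>\<^sub>\<sigma> \<zeta>))) has_osc_integral J"
      "rep_L2 (B (abs_L2 \<psi>)) (z, s) = 1 / osc_constant TYPE('d) * J"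
      unfolding g osc_constant_def by auto
    show "rep_L2 (B (abs_L2 \<psi>)) g = F g"
      using J(2) F[OF J(1)] osc_constant_nonzero[where 'd = 'd] by (simp add: g)
  qed
  then have "abs_L2 (rep_L2 (B (abs_L2 \<psi>))) = abs_L2 F"
    by (intro abs_L2_eqI square_integrable_rep_L2 sq)
  then show ?thesis by simp
qed

lemma extends_osc_operator_zero:
  fixes B :: "'d::finite heis L2 \<Rightarrow> 'd heis L2"
  assumes B: "extends_osc_operator 0 B" and \<eta>: "smooth_compact_support \<eta>"
  shows "B (abs_L2 \<eta>) = abs_L2 \<eta>"
  by (rule extends_osc_operator_value[OF B schwartz_smooth_compact_support[OF \<eta>] smooth_compact_supportD(3)[OF \<eta>]])
     (simp add: has_osc_integral_const)

text \<open>
  At \<open>\<tau> = 0\<close> the amplitude does not depend on \<open>\<zeta>\<close>, so the operator applied to a Schwartz function without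
  zeros provides an oscillatory integral of a nonzero constant.
\<close>

lemma extends_osc_operator_zero_const:
  fixes B :: "'d::finite heis L2 \<Rightarrow> 'd heis L2"
  assumes B: "extends_osc_operator 0 B"
  obtains c J where "(\<lambda>_ :: 'd phase. c) has_osc_integral J" "c \<noteq> 0"
proof -
  have "AE (z, s) in (lborel :: 'd heis measure). \<exists>J. (\<lambda>\<zeta> :: 'd phase. gaussian (z, s) :: complex) has_osc_integral J"
    using mp[OF spec[OF B[unfolded extends_osc_operator_def], of gaussian] schwartz_gaussian]
    by (rule eventually_mono) auto
  from AE_lborel_ex[OF this] show ?thesis using that gaussian_simps(2) by blast
qed

lemma square_integrable_osc:
  fixes \<eta> :: "'d::finite heis \<Rightarrow> complex"
  assumes \<eta>: "smooth_compact_support \<eta>" and r: "r > 0" shows "square_integrable (osc1 \<eta> r)"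
proof -
  note sm = smooth_compact_supportD[OF \<eta>]
  have "energy (osc1 \<eta> r) < \<infinity>"
    using energy_osc_le[OF sm(2) r] by (rule le_less_trans) (simp add: energy_eq_norm[OF sm(3)] ennreal_mult_less_top)
  then show ?thesis
    using borel_measurable_osc_at[OF continuous_on_const sm(4), of 1 r] by (simp add: square_integrable_iff_energy)
qed

lemma extends_osc_operator_pos:
  fixes B :: "'d::finite heis L2 \<Rightarrow> 'd heis L2"
  assumes B: "extends_osc_operator \<tau> B" and \<eta>: "smooth_compact_support \<eta>" and \<tau>: "\<tau> > 0"
  shows "B (abs_L2 \<eta>) = abs_L2 (\<lambda>g. inverse (osc_constant TYPE('d)) * osc1 \<eta> (sqrt \<tau>) g)"
proof (rule extends_osc_operator_value[OF B schwartz_smooth_compact_support[OF \<eta>]])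
  have r: "sqrt \<tau> > 0" using \<tau> by simp
  note sm = smooth_compact_supportD[OF \<eta>]
  show "square_integrable (\<lambda>g. inverse (osc_constant TYPE('d)) * osc1 \<eta> (sqrt \<tau>) g)"
    by (intro square_integrable_scale square_integrable_osc \<eta> r)
  fix z s J assume J: "(\<lambda>\<zeta>. \<eta> (z + sqrt \<tau> *\<^sub>R \<zeta>, s + sqrt \<tau> * (z \<bullet>\<^sub>\<sigma> \<zeta>))) has_osc_integral J"
  obtain R where R: "\<And>x. \<eta> x \<noteq> 0 \<Longrightarrow> norm x \<le> R" using \<eta> by (auto simp: smooth_compact_support_iff)
  have c: "compactly_supported (\<lambda>\<zeta>. \<eta> (z + sqrt \<tau> *\<^sub>R \<zeta>, s + sqrt \<tau> * (z \<bullet>\<^sub>\<sigma> \<zeta>)))"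
  proof (rule compactly_supportedI[where R = "(R + norm z) / sqrt \<tau>"])
    show "continuous_on UNIV (\<lambda>\<zeta>. \<eta> (z + sqrt \<tau> *\<^sub>R \<zeta>, s + sqrt \<tau> * (z \<bullet>\<^sub>\<sigma> \<zeta>)))"
      by (rule continuous_on_compose2[OF sm(4)]) (auto intro!: continuous_intros)
    fix \<zeta> assume "\<eta> (z + sqrt \<tau> *\<^sub>R \<zeta>, s + sqrt \<tau> * (z \<bullet>\<^sub>\<sigma> \<zeta>)) \<noteq> 0"
    from R[OF this] show "norm \<zeta> \<le> (R + norm z) / sqrt \<tau>"
      using ray_support[of "(z, s)" "sqrt \<tau>" \<zeta> R "sqrt \<tau>"] r by simp
  qed
  have "J = osc1 \<eta> (sqrt \<tau>) (z, s)"
    using has_osc_integral_integrable[OF _ integrable_compactly_supported[OF c] J] c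
    by (simp add: osc_def compactly_supported_def)
  then show "J = osc_constant TYPE('d) * (inverse (osc_constant TYPE('d)) * osc1 \<eta> (sqrt \<tau>) (z, s))"
    using osc_constant_nonzero[where 'd = 'd] by simp
qed

lemma extends_osc_operator_contraction:
  fixes B :: "'d::finite heis L2 \<Rightarrow> 'd heis L2"
  assumes B: "extends_osc_operator \<tau> B" and \<eta>: "smooth_compact_support \<eta>" and \<tau>: "\<tau> > 0"
  shows "norm (B (abs_L2 \<eta>)) \<le> norm (abs_L2 \<eta>)"
proof -
  let ?\<kappa> = "osc_constant TYPE('d)"
  have r: "sqrt \<tau> > 0" using \<tau> by simp
  note sm = smooth_compact_supportD[OF \<eta>]
  have "energy (\<lambda>g. inverse ?\<kappa> * osc1 \<eta> (sqrt \<tau>) g) = ennreal ((norm (inverse ?\<kappa>))\<^sup>2) * energy (osc1 \<eta> (sqrt \<tau>))"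
    using borel_measurable_osc_at[OF continuous_on_const sm(4), of 1 "sqrt \<tau>"] by (intro energy_scale) simp
  also have "\<dots> \<le> ennreal ((norm (inverse ?\<kappa>))\<^sup>2) * (ennreal ((2 * pi) ^ (2 * CARD('d))) * energy \<eta>)"
    by (intro mult_left_mono energy_osc_le sm r) simp
  also have "\<dots> = ennreal ((norm (inverse ?\<kappa>))\<^sup>2 * (norm ?\<kappa>)\<^sup>2) * energy \<eta>"
    by (simp add: norm_osc_constant ennreal_mult mult.assoc)
  also have "(norm (inverse ?\<kappa>))\<^sup>2 * (norm ?\<kappa>)\<^sup>2 = 1"
    using osc_constant_nonzero[where 'd = 'd] by (simp add: norm_inverse power_inverse)
  finally show ?thesis
    unfolding extends_osc_operator_pos[OF B \<eta> \<tau>]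
    by (intro norm_abs_L2_leI square_integrable_scale square_integrable_osc \<eta> r) (simp_all add: energy_eq_norm[OF sm(3)])
qed

text \<open>
  With \<open>h = r\<^sup>2\<close> the second-order expansion leaves an error \<open>O(h\<^sup>2)\<close>, hence \<open>O(h)\<close> after division
  by \<open>h\<close>.
\<close>

lemma extends_osc_operator_consistent:
  fixes S :: "real \<Rightarrow> 'd::finite heis L2 \<Rightarrow> 'd heis L2"
  assumes S: "\<And>\<tau>. \<tau> \<ge> 0 \<Longrightarrow> extends_osc_operator \<tau> (S \<tau>)" and \<eta>: "smooth_compact_support \<eta>"
  shows "((\<lambda>h. (1 / h) *\<^sub>R (S h (abs_L2 \<eta>) - abs_L2 \<eta>)) \<longlongrightarrow> (\<i> / 2) *\<^sub>C abs_L2 (sublaplacian \<eta>)) (at_right 0)"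
proof -
  let ?\<kappa> = "osc_constant TYPE('d)" and ?L = "sublaplacian \<eta>"
  note sm = smooth_compact_supportD[OF \<eta>] and smL = smooth_compact_supportD[OF smooth_compact_support_sublaplacian[OF \<eta>]]
  have k0: "?\<kappa> \<noteq> 0" by (rule osc_constant_nonzero)
  obtain c J where c: "(\<lambda>_ :: 'd phase. c) has_osc_integral J" "c \<noteq> 0"
    using extends_osc_operator_zero_const[OF S] by auto
  define E where "E r g = osc1 \<eta> r g - ?\<kappa> * (\<eta> g + \<i> / 2 * complex_of_real (r\<^sup>2) * ?L g)" for r g
  have "energy_O 8 E" unfolding E_def[abs_def]
    by (rule energy_O_second[OF osc_tendsto[OF _ c] \<eta>])
  then obtain C where C: "C \<ge> 0" "\<And>t. 0 < t \<Longrightarrow> t \<le> 1 \<Longrightarrow> energy (E t) \<le> ennreal (C * t ^ 8)"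
    by (auto simp: energy_O_def)
  define M where "M = norm (inverse ?\<kappa>) * sqrt C"
  have bound: "norm ((1 / h) *\<^sub>R (S h (abs_L2 \<eta>) - abs_L2 \<eta>) - (\<i> / 2) *\<^sub>C abs_L2 ?L) \<le> M * h" if h: "0 < h" "h \<le> 1" for h
  proof -
    let ?r = "sqrt h"
    have r: "0 < ?r" "?r \<le> 1" "?r\<^sup>2 = h" using h by auto
    have r8: "?r ^ 8 = h ^ 4" using power_mult[of ?r 2 4] r(3) by simp
    have sqE: "square_integrable (E ?r)"
      unfolding E_def by (intro square_integrable_diff square_integrable_scale square_integrable_add square_integrable_osc \<eta> r sm smL)
    have "energy (E ?r) \<le> ennreal ((sqrt C * h\<^sup>2)\<^sup>2)"
      using C(2)[OF r(1,2)] C(1) unfolding r8 by (simp add: power_mult_distrib flip: power_mult)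
    then have nE: "norm (abs_L2 (E ?r)) \<le> sqrt C * h\<^sup>2" using C(1) by (intro norm_abs_L2_leI sqE) auto
    have "S h (abs_L2 \<eta>) - abs_L2 \<eta> - h *\<^sub>R ((\<i> / 2) *\<^sub>C abs_L2 ?L) = inverse ?\<kappa> *\<^sub>C abs_L2 (E ?r)"
    proof -
      have "S h (abs_L2 \<eta>) - abs_L2 \<eta> - h *\<^sub>R ((\<i> / 2) *\<^sub>C abs_L2 ?L) =
        abs_L2 (\<lambda>g. inverse ?\<kappa> * osc1 \<eta> ?r g - \<eta> g - h *\<^sub>R (\<i> / 2 * ?L g))"
        unfolding extends_osc_operator_pos[OF S[OF less_imp_le[OF h(1)]] \<eta> h(1)]
        using abs_L2_diff[OF square_integrable_scale[OF square_integrable_osc[OF \<eta> r(1)]] sm(3)]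
          abs_L2_diff[OF square_integrable_diff[OF square_integrable_scale[OF square_integrable_osc[OF \<eta> r(1)]] sm(3)]
            square_integrable_scaleR[OF square_integrable_scale[OF smL(3)]]]
        by (simp only: abs_L2_scaleC[OF smL(3)] abs_L2_scaleR[OF square_integrable_scale[OF smL(3)]])
      also have "(\<lambda>g. inverse ?\<kappa> * osc1 \<eta> ?r g - \<eta> g - h *\<^sub>R (\<i> / 2 * ?L g)) = (\<lambda>g. inverse ?\<kappa> * E ?r g)"
      proof (rule ext)
        fix g
        have *: "inverse ?\<kappa> * (x - ?\<kappa> * y) = inverse ?\<kappa> * x - y" for x y
          using k0 by (simp add: right_diff_distrib flip: mult.assoc)
        show "inverse ?\<kappa> * osc1 \<eta> ?r g - \<eta> g - h *\<^sub>R (\<i> / 2 * ?L g) = inverse ?\<kappa> * E ?r g"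
          unfolding E_def r(3) * by (simp add: scaleR_conv_of_real diff_diff_eq mult_ac)
      qed
      finally show ?thesis by (simp add: abs_L2_scaleC sqE)
    qed
    then have "norm (S h (abs_L2 \<eta>) - abs_L2 \<eta> - h *\<^sub>R ((\<i> / 2) *\<^sub>C abs_L2 ?L)) \<le> M * h\<^sup>2"
      using nE by (simp add: scaleC_simps M_def mult.assoc mult_left_mono)
    moreover have "(1 / h) *\<^sub>R (S h (abs_L2 \<eta>) - abs_L2 \<eta>) - (\<i> / 2) *\<^sub>C abs_L2 ?L = (1 / h) *\<^sub>R (S h (abs_L2 \<eta>) - abs_L2 \<eta> - h *\<^sub>R ((\<i> / 2) *\<^sub>C abs_L2 ?L))"
      using h by (simp add: scaleR_diff_right)
    ultimately show ?thesis using h by (simp add: divide_le_eq power2_eq_square mult.assoc)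
  qed
  have "((\<lambda>h. M * h) \<longlongrightarrow> M * 0) (at_right 0)" by (intro tendsto_intros)
  then have M0: "((\<lambda>h. M * h) \<longlongrightarrow> 0) (at_right 0)" by simp
  have "\<forall>\<^sub>F h in at_right (0::real). 0 < h \<and> h < 1"
    by (rule eventually_at_rightI[of 0 1]) auto
  then have "\<forall>\<^sub>F h in at_right 0. norm ((1 / h) *\<^sub>R (S h (abs_L2 \<eta>) - abs_L2 \<eta>) - (\<i> / 2) *\<^sub>C abs_L2 ?L) \<le> M * h"
    by eventually_elim (use bound in auto)
  then have "((\<lambda>h. (1 / h) *\<^sub>R (S h (abs_L2 \<eta>) - abs_L2 \<eta>) - (\<i> / 2) *\<^sub>C abs_L2 ?L) \<longlongrightarrow> 0) (at_right 0)"
    by (rule Lim_null_comparison[OF _ M0])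
  then show ?thesis by (simp add: LIM_zero_iff)
qed

section \<open>Chernoff equivalence\<close>

lemma isometry_group_of_unitary_group:
  assumes "strongly_continuous_unitary_group U" shows "isometry_group U"
  using assms unfolding strongly_continuous_unitary_group_def unitary_operator_def bounded_operator_def
  by (simp add: isometry_group_def fun_eq_iff)

definition core_graph :: "('d::finite heis L2 \<times> 'd heis L2) set" where
  "core_graph = {(abs_L2 f, (\<i> / 2) *\<^sub>C abs_L2 (sublaplacian f)) | f. smooth_compact_support f}"

text \<open>
  Stone's convention differentiates \<open>U\<close> up to a factor \<open>- i\<close>; undoing it turns the closure of the
  graph of the Laplacian into the closure of the graph of \<open>(i / 2) L\<close> on \<open>C\<^sub>c\<^sup>\<infinity>\<close>.
\<close>

lemma generator_subset_closure_core:
  assumes U: "unitary_group_of (scale_operator (1 / 2) horizontal_laplacian) U"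
  shows "isometry_group.generator U \<subseteq> closure core_graph"
proof clarify
  interpret isometry_group U
    using U isometry_group_of_unitary_group unfolding unitary_group_of_def by blast
  let ?m = "\<lambda>(x, y). (x, (\<i> / 2) *\<^sub>C y)"
  fix x y assume "(x, y) \<in> generator"
  then have "((\<lambda>t. (1 / t) *\<^sub>R (U t x - x)) \<longlongrightarrow> y) (at 0)" by (simp add: generator_def)
  then have "((\<lambda>t. (- \<i>) *\<^sub>C ((1 / t) *\<^sub>R (U t x - x))) \<longlongrightarrow> (- \<i>) *\<^sub>C y) (at 0)"
    by (rule bounded_linear.tendsto[OF bounded_linear_scaleC])
  moreover have "(- \<i>) *\<^sub>C ((1 / t) *\<^sub>R (U t x - x)) = (1 / (\<i> * complex_of_real t)) *\<^sub>C (U t x - x)" for t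
  proof -
    have "(- \<i>) *\<^sub>C ((1 / t) *\<^sub>R (U t x - x)) = (- \<i> * complex_of_real (1 / t)) *\<^sub>C (U t x - x)"
      by (metis scaleC_simps(4,5))
    also have "- \<i> * complex_of_real (1 / t) = 1 / (\<i> * complex_of_real t)"
      by (simp add: divide_inverse)
    finally show ?thesis .
  qed
  ultimately have "(x, (- \<i>) *\<^sub>C y) \<in> scale_operator (1 / 2) horizontal_laplacian"
    using U unfolding unitary_group_of_def by simp
  then obtain \<eta> where \<eta>: "(x, \<eta>) \<in> closure L0_graph" "(- \<i>) *\<^sub>C y = (1 / 2) *\<^sub>C \<eta>"
    by (auto simp: scale_operator_def horizontal_laplacian_def)
  have "y = \<i> *\<^sub>C ((- \<i>) *\<^sub>C y)" by (simp add: scaleC_simps)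
  also have "\<dots> = (\<i> / 2) *\<^sub>C \<eta>" unfolding \<eta>(2) by (simp add: scaleC_simps)
  finally have y: "(x, y) = ?m (x, \<eta>)" by simp
  have "continuous_on (closure L0_graph) ?m"
    unfolding case_prod_beta
    by (intro continuous_intros bounded_linear.continuous_on[OF bounded_linear_scaleC])
  then have "?m ` closure L0_graph \<subseteq> closure core_graph"
    by (rule image_closure_subset) (auto simp: L0_graph_def core_graph_def intro!: closure_subset[THEN subsetD])
  then show "(x, y) \<in> closure core_graph" unfolding y using \<eta>(1) by blast
qed

text \<open>
  The first components of the closure of the core contain the domain of the generator, which is dense.
\<close>

lemma core_dense:
  fixes A :: "'d::finite heis L2 set" and U :: "real \<Rightarrow> 'd heis L2 \<Rightarrow> 'd heis L2"
  assumes U: "isometry_group U" "isometry_group.generator U \<subseteq> closure core_graph"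
    and cl: "closed A" and A: "\<And>\<eta>. smooth_compact_support \<eta> \<Longrightarrow> abs_L2 \<eta> \<in> A"
  shows "x \<in> A"
proof -
  interpret isometry_group U by (rule U)
  have "closed (A \<times> (UNIV :: 'd heis L2 set))" using cl by (intro closed_Times) auto
  then have sub: "closure core_graph \<subseteq> A \<times> UNIV"
    using A by (intro closure_minimal) (auto simp: core_graph_def)
  have "x \<in> closure A"
    unfolding closure_approachable
  proof (intro allI impI)
    fix e :: real assume "e > 0"
    then obtain p q where "(p, q) \<in> generator" "norm (p - x) < e" by (rule generator_domain_dense)
    then show "\<exists>y\<in>A. dist y x < e" using sub U(2) by (auto simp: dist_norm)
  qed
  then show ?thesis using cl by simp
qed

theorem theorem7:
  fixes S U :: "real \<Rightarrow> 'd::finite heis L2 \<Rightarrow> 'd heis L2"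
  assumes "unitary_group_of (scale_operator (1 / 2) horizontal_laplacian) U"
    and "\<And>\<tau>. \<tau> \<ge> 0 \<Longrightarrow> bounded_operator (S \<tau>)"
    and "\<And>\<tau>. \<tau> \<ge> 0 \<Longrightarrow> extends_osc_operator \<tau> (S \<tau>)"
  shows "chernoff_equivalent S U"
proof -
  have grp: "isometry_group U"
    using assms(1) isometry_group_of_unitary_group unfolding unitary_group_of_def by blast
  interpret U: isometry_group U by (rule grp)
  note core = generator_subset_closure_core[OF assms(1)]
  have bl: "bounded_linear (S h)" if "h \<ge> 0" for h
    using assms(2)[OF that] by (simp add: bounded_operator_def)
  have contS: "continuous_on UNIV (S h)" if "h \<ge> 0" for h
    by (rule linear_continuous_on[OF bl[OF that]])
  have contr: "norm (S h x) \<le> norm x" if h: "h > 0" for h x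
  proof -
    have "x \<in> {x. norm (S h x) \<le> norm x}"
    proof (rule core_dense[OF grp core])
      show "closed {x. norm (S h x) \<le> norm x}"
        using h by (intro closed_Collect_le continuous_intros contS) auto
      show "abs_L2 \<eta> \<in> {x. norm (S h x) \<le> norm x}" if "smooth_compact_support \<eta>" for \<eta>
        using extends_osc_operator_contraction[OF assms(3) that h] h by simp
    qed
    then show ?thesis by simp
  qed
  have S0: "S 0 x = x" for x
  proof -
    have "x \<in> {x. S 0 x = x}"
    proof (rule core_dense[OF grp core])
      show "closed {x. S 0 x = x}" by (intro closed_Collect_eq continuous_intros contS) auto
      show "abs_L2 \<eta> \<in> {x. S 0 x = x}" if "smooth_compact_support \<eta>" for \<eta>
        using extends_osc_operator_zero[OF assms(3) that] by simp
    qed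
    then show ?thesis by simp
  qed
  have S0n: "(S 0 ^^ n) x = x" for n x by (induction n) (simp_all add: S0)
  have consistent: "((\<lambda>h. (1 / h) *\<^sub>R (S h x - x)) \<longlongrightarrow> y) (at_right 0)" if "(x, y) \<in> core_graph" for x y
    using that extends_osc_operator_consistent[OF assms(3)] by (auto simp: core_graph_def)
  show ?thesis
    unfolding chernoff_equivalent_def
  proof (intro allI impI)
    fix \<psi> :: "'d heis L2" and T :: real assume T: "T > 0"
    let ?s = "\<lambda>n. SUP \<tau>\<in>{0..T}. ennreal (norm ((S (\<tau> / real n) ^^ n) \<psi> - U \<tau> \<psi>))"
    have small: "\<forall>\<^sub>F n in sequentially. ?s n \<le> ennreal e" if e: "e > 0" for e
    proof -
      have blp: "h > 0 \<Longrightarrow> bounded_linear (S h)" for h by (rule bl) simp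
      obtain h0 where h0: "h0 > 0" "\<And>h n. 0 < h \<Longrightarrow> h < h0 \<Longrightarrow> real n * h \<le> T \<Longrightarrow> norm ((S h ^^ n) \<psi> - U (real n * h) \<psi>) < e"
        using chernoff_product_formula[OF grp core blp contr consistent T e, of \<psi>] by blast
      obtain N where N: "real N > T / h0" using reals_Archimedean2 by blast
      show ?thesis
        using eventually_ge_at_top[of "Suc N"]
      proof eventually_elim
        case (elim n)
        have n: "real n > 0" "T / h0 < real n" using elim N by auto
        show ?case
        proof (rule SUP_least)
          fix \<tau> assume \<tau>: "\<tau> \<in> {0..T}"
          show "ennreal (norm ((S (\<tau> / real n) ^^ n) \<psi> - U \<tau> \<psi>)) \<le> ennreal e"
          proof (cases "\<tau> = 0")
            \<comment> \<open>The product formula is about positive steps, so \<open>\<tau> = 0\<close> is separate: both sides are \<open>\<psi>\<close>.\<close>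
            case True then show ?thesis using e by (simp add: S0n U.zero)
          next
            case False
            have "T < h0 * real n" using n(2) h0(1) by (simp add: divide_less_eq mult.commute)
            then have "\<tau> / real n < h0" using \<tau> n(1) by (simp add: divide_less_eq)
            then have "norm ((S (\<tau> / real n) ^^ n) \<psi> - U (real n * (\<tau> / real n)) \<psi>) < e"
              using False \<tau> n by (intro h0(2)) auto
            then show ?thesis using n(1) by (intro ennreal_leI) simp
          qed
        qed
      qed
    qed
    show "?s \<longlonglongrightarrow> 0"
    proof (rule order_tendstoI)
      fix a :: ennreal assume "0 < a"
      then obtain b where b: "0 < b" "b < a" using dense by blast
      then obtain e where e: "b = ennreal e" "e > 0" by (cases b) auto
      show "\<forall>\<^sub>F n in sequentially. ?s n < a"
        using small[OF e(2)] by eventually_elim (use b e in auto)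
    qed simp
  qed
qed

end
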